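(* For every fixed order of the agents, the mechanism SDMT-2 (defined in the context) for the House Allocation problem with ties is truthful, is Pareto optimal (it always returns a Pareto optimal matching), and terminates in $O(n_1^2\gamma+m)$ running time, where $n_1$ is the number of agents, $\gamma$ is the size of the largest indifference class in any agent's preference list, and $m$ is the total length of the agents' preference lists.
   Context: House Allocation (HA). $N=\{1,\dots,n_1\}$ is a finite set of agents and $O=\{o_1,\dots,o_{n_2}\}$ a finite set of objects. Each agent $i$ has a preference list $L(i)=(C^i_1\succ_i C^i_2\succ_i\cdots)$, an ordered sequence of pairwise disjoint subsets of $O$ (indifference classes); objects in $C^i_k$ are strictly preferred to those in $C^i_l$ for $k<l$, and $i$ is indifferent between objects in the same class; if $C^i_l=\emptyset$ then $C^i_q=\emptyset$ for all $q\ge l$ and $C^i_{n_2+1}=\emptyset$. Objects in $\bigcup_k C^i_k$ are acceptable to $i$ (written $o\in L(i)$). $rank(i,o)=k$ if $o\in C^i_k$, and $n_2+1$ if $o$ is unacceptable or if $i$ is unmatched; $i$ prefers smaller rank. A matching is a set of (agent, acceptable object) pairs in which every agent and every object occurs at most once. $\mu$ is Pareto optimal if there is no matching $\mu'$ with $\mu'(i)\succeq_i\mu(i)$ for all $i$ and $\mu'(i')\succ_{i'}\mu(i')$ for some $i'$. A mechanism $\phi$ mapping profiles to matchings is truthful if for all profiles $L$, agents $i$ and lists $L'(i)$, agent $i$ weakly prefers, according to $L(i)$, his outcome under $\phi(L(i),L(-i))$ to his outcome under $\phi(L'(i),L(-i))$. Trading graphs. During SDMT-2 agents are temporarily allocated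 sets of objects ("own" them), all objects owned by an agent lying in one of his indifference classes. An agent owning more than one object is called labelled, otherwise unlabelled. For an agent $i$, a set $S$ of agents with $i\notin S$, and $B\subseteq L(i)$, the trading graph $TG(i,B,S)$ is the directed graph on $\{i\}\cup S$ built as follows: $i$ points to each agent in $S$ owning an object of $B$; each unlabelled agent $j\in S$ that is pointed to, whose owned object lies in $C^j_k$, points to each agent in $S$ owning an object of $C^j_k$ not owned by $j$; this is repeated for newly pointed-to unlabelled agents until nothing changes. Labelled agents point to nobody. Write $TG(i,a,S)=TG(i,\{a\},S)$. Fix a common strict order on all objects (used only for tie-breaking). Let $H$ be the set of $a\in L(i)$ such that $TG(i,a,S)$ contains a directed path from $i$ to a labelled agent. If $H=\emptyset$, put $\max TG(i,L(i),S)=\emptyset$. Otherwise let $\ell$ be the smallest index with $H\cap C^i_\ell\ne\emptyset$; $\max TG(i,L(i),S)$ is the highest object of $H\cap C^i_\ell$ in the common order. $Trading(i,a,S)$: take a simple directed path $(i=i_0,i_1,\dots,i_k)$ in $TG(i,a,S)$ with only $i_k$ labelled (e.g. found by breadth-first search); for $s=0,\dots,k-1$ the object owned by $i_{s+1}$ is given to $i_s$, where $i_{k-1}$ receives the highest object in the common order among those owned by $i_k$ because of which $i_{k-1}$ points to $i_k$; afterwards $i_k$ remains labelled iff he still owns more than one object. SDMT-2, given an order of the agents: initially all objects are unallocated. Process agents in the given order. When agent $i$ is processed, let $O_i$ be the set of currently unallocated objects and $S$ the set of previously processed agents. Let $j_1$ be the smallest $j$ with $O_i\cap C^i_j\neq\emptyset$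 ($j_1=n_2+1$ if none), and let $j_2$ be the index of the class $C^i_{j_2}$ containing $\max TG(i,L(i),S)$ ($j_2=n_2+1$ if $\max TG(i,L(i),S)=\emptyset$). If $j_1\le j_2$, allocate all objects of $O_i\cap C^i_{j_1}$ to $i$. Otherwise perform $Trading(i,\max TG(i,L(i),S),S)$. After all agents are processed, each labelled agent is matched to the highest object he owns in the common order, each unlabelled agent owning one object is matched to it, and all others are unmatched. *)

theory Defs
  imports Main
begin

section \<open>House allocation with ties\<close>

text \<open>
  Agents are the numbers below \<open>n1\<close> and objects the numbers below \<open>n2\<close>. A preference list is the
  list of its nonempty indifference classes, most preferred first; the class written \<open>C_k\<close> on paper
  is entry \<open>k - 1\<close>, and the classes beyond the end of the list are empty.
\<close>

type_synonym pref = "nat set list"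
type_synonym profile = "nat \<Rightarrow> pref"
type_synonym matching = "(nat \<times> nat) set"

definition valid_pref :: "nat \<Rightarrow> pref \<Rightarrow> bool" where
  "valid_pref n2 l \<longleftrightarrow>
     (\<forall>C \<in> set l. C \<noteq> {} \<and> C \<subseteq> {..<n2}) \<and>
     (\<forall>j k. j < k \<and> k < length l \<longrightarrow> l ! j \<inter> l ! k = {})"

definition valid_profile :: "nat \<Rightarrow> nat \<Rightarrow> profile \<Rightarrow> bool" where
  "valid_profile n1 n2 L \<longleftrightarrow> (\<forall>i < n1. valid_pref n2 (L i))"

definition acceptable :: "pref \<Rightarrow> nat set" where
  "acceptable l = \<Union> (set l)"

definition nth_class :: "pref \<Rightarrow> nat \<Rightarrow> nat set" where
  "nth_class l k = (if 1 \<le> k \<and> k \<le> length l then l ! (k - 1) else {})"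

definition first_class :: "nat \<Rightarrow> pref \<Rightarrow> nat set \<Rightarrow> nat" where
  "first_class n2 l A =
     (if \<exists>k. nth_class l k \<inter> A \<noteq> {} then LEAST k. nth_class l k \<inter> A \<noteq> {} else n2 + 1)"

definition rank :: "nat \<Rightarrow> pref \<Rightarrow> nat \<Rightarrow> nat" where
  "rank n2 l a = first_class n2 l {a}"

definition matching :: "nat \<Rightarrow> nat \<Rightarrow> profile \<Rightarrow> matching \<Rightarrow> bool" where
  "matching n1 n2 L \<mu> \<longleftrightarrow>
     (\<forall>(i, a) \<in> \<mu>. i < n1 \<and> a < n2 \<and> a \<in> acceptable (L i)) \<and>
     (\<forall>i a b. (i, a) \<in> \<mu> \<and> (i, b) \<in> \<mu> \<longrightarrow> a = b) \<and>
     (\<forall>i j a. (i, a) \<in> \<mu> \<and> (j, a) \<in> \<mu> \<longrightarrow> i = j)"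

definition outcome_rank :: "nat \<Rightarrow> pref \<Rightarrow> matching \<Rightarrow> nat \<Rightarrow> nat" where
  "outcome_rank n2 l \<mu> i =
     (if \<exists>a. (i, a) \<in> \<mu> then rank n2 l (THE a. (i, a) \<in> \<mu>) else n2 + 1)"

definition pareto_optimal :: "nat \<Rightarrow> nat \<Rightarrow> profile \<Rightarrow> matching \<Rightarrow> bool" where
  "pareto_optimal n1 n2 L \<mu> \<longleftrightarrow>
     matching n1 n2 L \<mu> \<and>
     \<not> (\<exists>\<mu>'. matching n1 n2 L \<mu>' \<and>
            (\<forall>i < n1. outcome_rank n2 (L i) \<mu>' i \<le> outcome_rank n2 (L i) \<mu> i) \<and>
            (\<exists>i < n1. outcome_rank n2 (L i) \<mu>' i < outcome_rank n2 (L i) \<mu> i))"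

definition truthful :: "nat \<Rightarrow> nat \<Rightarrow> (profile \<Rightarrow> matching) \<Rightarrow> bool" where
  "truthful n1 n2 \<phi> \<longleftrightarrow>
     (\<forall>L i l'. valid_profile n1 n2 L \<and> i < n1 \<and> valid_pref n2 l' \<longrightarrow>
        outcome_rank n2 (L i) (\<phi> L) i \<le> outcome_rank n2 (L i) (\<phi> (L(i := l'))) i)"

definition agent_order :: "nat \<Rightarrow> nat list \<Rightarrow> bool" where
  "agent_order n1 \<sigma> \<longleftrightarrow> distinct \<sigma> \<and> set \<sigma> = {..<n1}"

text \<open>The common strict order is given by positions: position 0 is the highest object.\<close>

definition common_order :: "nat \<Rightarrow> (nat \<Rightarrow> nat) \<Rightarrow> bool" where
  "common_order n2 pr \<longleftrightarrow> bij_betw pr {..<n2} {..<n2}"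

definition highest :: "(nat \<Rightarrow> nat) \<Rightarrow> nat set \<Rightarrow> nat" where
  "highest pr A = arg_min_on pr A"


section \<open>Trading graphs\<close>

text \<open>\<open>w j\<close> is the set of objects temporarily owned by agent \<open>j\<close>.\<close>

type_synonym ownership = "nat \<Rightarrow> nat set"

definition labelled :: "ownership \<Rightarrow> nat \<Rightarrow> bool" where
  "labelled w j \<longleftrightarrow> card (w j) > 1"

text \<open>
  The objects because of which \<open>x\<close> points to other agents: the source \<open>i\<close> points because of \<open>B\<close>,
  any other agent because of the objects it does not own in the class of the object it owns.
\<close>

definition wanted :: "profile \<Rightarrow> ownership \<Rightarrow> nat \<Rightarrow> nat set \<Rightarrow> nat \<Rightarrow> nat set" where
  "wanted L w i B x =
     (if x = i then B else \<Union> {C \<in> set (L x). w x \<inter> C \<noteq> {}} - w x)"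

inductive_set trading_graph ::
    "profile \<Rightarrow> ownership \<Rightarrow> nat \<Rightarrow> nat set \<Rightarrow> nat set \<Rightarrow> (nat \<times> nat) set"
  for L :: profile and w :: ownership and i :: nat and B :: "nat set" and S :: "nat set"
  where
    source: "\<lbrakk>y \<in> S; w y \<inter> wanted L w i B i \<noteq> {}\<rbrakk> \<Longrightarrow> (i, y) \<in> trading_graph L w i B S"
  | forward: "\<lbrakk>(u, x) \<in> trading_graph L w i B S; \<not> labelled w x;
               y \<in> S; w y \<inter> wanted L w i B x \<noteq> {}\<rbrakk> \<Longrightarrow> (x, y) \<in> trading_graph L w i B S"

definition obtainable :: "profile \<Rightarrow> ownership \<Rightarrow> nat \<Rightarrow> nat set \<Rightarrow> nat set" where
  "obtainable L w i S =
     {a \<in> acceptable (L i). \<exists>j. labelled w j \<and> (i, j) \<in> (trading_graph L w i {a} S)\<^sup>+}"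

definition max_TG ::
    "nat \<Rightarrow> (nat \<Rightarrow> nat) \<Rightarrow> profile \<Rightarrow> ownership \<Rightarrow> nat \<Rightarrow> nat set \<Rightarrow> nat option" where
  "max_TG n2 pr L w i S =
     (let H = obtainable L w i S in
      if H = {} then None
      else Some (highest pr (H \<inter> nth_class (L i) (first_class n2 (L i) H))))"

text \<open>Simple directed paths from \<open>i\<close> on which the last agent is the only labelled one.\<close>

definition trading_path :: "ownership \<Rightarrow> (nat \<times> nat) set \<Rightarrow> nat \<Rightarrow> nat list \<Rightarrow> bool" where
  "trading_path w E i p \<longleftrightarrow>
     length p \<ge> 2 \<and> hd p = i \<and> distinct p \<and> successively (\<lambda>x y. (x, y) \<in> E) p \<and>
     labelled w (last p) \<and> (\<forall>x \<in> set (butlast p). \<not> labelled w x)"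

text \<open>
  The mechanism leaves open which such path is used for trading. A path rule makes this choice; it
  sees the current ownership, the trading graph and its source, but not the lists of agents that
  have not been processed.
\<close>

type_synonym path_rule = "ownership \<Rightarrow> (nat \<times> nat) set \<Rightarrow> nat \<Rightarrow> nat list"

definition path_rule :: "path_rule \<Rightarrow> bool" where
  "path_rule sel \<longleftrightarrow>
     (\<forall>w E i. (\<exists>p. trading_path w E i p) \<longrightarrow> trading_path w E i (sel w E i))"

text \<open>
  All exchanges along the path refer to the ownership \<open>w\<close> before the trade; \<open>wt x\<close> are the objects
  because of which \<open>x\<close> points to other agents.
\<close>

fun trade_along ::
    "(nat \<Rightarrow> nat) \<Rightarrow> (nat \<Rightarrow> nat set) \<Rightarrow> ownership \<Rightarrow> nat list \<Rightarrow> ownership" where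
  "trade_along pr wt w [x, z] =
     (let b = highest pr (w z \<inter> wt x) in w(z := w z - {b}, x := {b}))"
| "trade_along pr wt w (x # y # z # p) = (trade_along pr wt w (y # z # p))(x := w y)"
| "trade_along pr wt w _ = w"

definition trading ::
    "(nat \<Rightarrow> nat) \<Rightarrow> path_rule \<Rightarrow> profile \<Rightarrow> ownership \<Rightarrow> nat \<Rightarrow> nat \<Rightarrow> nat set \<Rightarrow> ownership" where
  "trading pr sel L w i a S =
     trade_along pr (wanted L w i {a}) w (sel w (trading_graph L w i {a} S) i)"


section \<open>The mechanism SDMT-2\<close>

text \<open>A state consists of the set of processed agents and the current ownership.\<close>

definition sdmt2_step ::
    "nat \<Rightarrow> (nat \<Rightarrow> nat) \<Rightarrow> path_rule \<Rightarrow> profile \<Rightarrow> nat \<Rightarrow>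
     nat set \<times> ownership \<Rightarrow> nat set \<times> ownership" where
  "sdmt2_step n2 pr sel L i = (\<lambda>(S, w).
     let free = {..<n2} - (\<Union>j \<in> S. w j);
         j1 = first_class n2 (L i) free;
         j2 = (case max_TG n2 pr L w i S of None \<Rightarrow> n2 + 1 | Some a \<Rightarrow> rank n2 (L i) a)
     in (insert i S,
         if j1 \<le> j2 then w(i := free \<inter> nth_class (L i) j1)
         else trading pr sel L w i (the (max_TG n2 pr L w i S)) S))"

definition sdmt2_ownership ::
    "nat \<Rightarrow> (nat \<Rightarrow> nat) \<Rightarrow> path_rule \<Rightarrow> profile \<Rightarrow> nat list \<Rightarrow> ownership" where
  "sdmt2_ownership n2 pr sel L \<sigma> = snd (fold (sdmt2_step n2 pr sel L) \<sigma> ({}, \<lambda>_. {}))"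

definition sdmt2 ::
    "nat \<Rightarrow> nat \<Rightarrow> nat list \<Rightarrow> (nat \<Rightarrow> nat) \<Rightarrow> path_rule \<Rightarrow> profile \<Rightarrow> matching" where
  "sdmt2 n1 n2 \<sigma> pr sel L =
     (let w = sdmt2_ownership n2 pr sel L \<sigma>
      in {(i, a). i < n1 \<and> w i \<noteq> {} \<and> a = highest pr (w i)})"

definition max_class_size :: "nat \<Rightarrow> profile \<Rightarrow> nat" where
  "max_class_size n1 L = Max (insert 0 (\<Union>i \<in> {..<n1}. card ` set (L i)))"

definition total_length :: "nat \<Rightarrow> profile \<Rightarrow> nat" where
  "total_length n1 L = (\<Sum>i < n1. card (acceptable (L i)))"


section \<open>A random access machine language with running times\<close>

text \<open>
  The store consists of named arrays of natural numbers with random access; cell 0 of an array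
  serves as a scalar variable. Arithmetic is restricted to addition and truncated subtraction.
  Every assignment, skip and branching decision costs one unit. Since a fixed program contains
  only finitely many expressions and they have no loops, charging their evaluation separately would
  change running times by at most a constant factor that depends on the program only.
\<close>

type_synonym store = "string \<Rightarrow> nat \<Rightarrow> nat"

datatype aexp = Const nat | Cell string aexp | Add aexp aexp | Sub aexp aexp

datatype bexp = Less aexp aexp | Neg bexp | Conj bexp bexp

datatype com =
    Skip
  | Assign string aexp aexp
  | Seq com com
  | Cond bexp com com
  | While bexp com

fun aval :: "aexp \<Rightarrow> store \<Rightarrow> nat" where
  "aval (Const n) s = n"
| "aval (Cell x e) s = s x (aval e s)"
| "aval (Add e f) s = aval e s + aval f s"
| "aval (Sub e f) s = aval e s - aval f s"

fun bval :: "bexp \<Rightarrow> store \<Rightarrow> bool" where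
  "bval (Less e f) s = (aval e s < aval f s)"
| "bval (Neg b) s = (\<not> bval b s)"
| "bval (Conj b c) s = (bval b s \<and> bval c s)"

text \<open>\<open>exec c s t s'\<close>: started in \<open>s\<close>, the program \<open>c\<close> halts after exactly \<open>t\<close> time units in \<open>s'\<close>.\<close>

inductive exec :: "com \<Rightarrow> store \<Rightarrow> nat \<Rightarrow> store \<Rightarrow> bool" where
  Skip: "exec Skip s 1 s"
| Assign: "exec (Assign x e f) s 1 (s(x := (s x)(aval e s := aval f s)))"
| Seq: "\<lbrakk>exec c s t s'; exec d s' t' s''\<rbrakk> \<Longrightarrow> exec (Seq c d) s (t + t') s''"
| CondTrue: "\<lbrakk>bval b s; exec c s t s'\<rbrakk> \<Longrightarrow> exec (Cond b c d) s (1 + t) s'"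
| CondFalse: "\<lbrakk>\<not> bval b s; exec d s t s'\<rbrakk> \<Longrightarrow> exec (Cond b c d) s (1 + t) s'"
| WhileFalse: "\<not> bval b s \<Longrightarrow> exec (While b c) s 1 s"
| WhileTrue: "\<lbrakk>bval b s; exec c s t s'; exec (While b c) s' t' s''\<rbrakk> \<Longrightarrow>
              exec (While b c) s (1 + t + t') s''"


section \<open>Input and output of implementations\<close>

text \<open>
  The input profile is presented as a listing \<open>D\<close>: \<open>D i ! (k - 1)\<close> lists the objects of class
  \<open>C_k\<close> of agent \<open>i\<close> without repetition, in any order.
\<close>

definition listing :: "nat \<Rightarrow> (nat \<Rightarrow> nat list list) \<Rightarrow> profile \<Rightarrow> bool" where
  "listing n1 D L \<longleftrightarrow> (\<forall>i < n1. map set (D i) = L i \<and> (\<forall>c \<in> set (D i). distinct c))"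

definition entries :: "nat list list \<Rightarrow> (nat \<times> nat) list" where
  "entries cs = concat (map (\<lambda>k. map (\<lambda>a. (k + 1, a)) (cs ! k)) [0..<length cs])"

definition table :: "nat list \<Rightarrow> nat \<Rightarrow> nat" where
  "table xs p = (if p < length xs then xs ! p else 0)"

text \<open>
  The lists of agents \<open>0, 1, ..., n1 - 1\<close> are stored one after another in the arrays \<open>obj\<close>
  (objects) and \<open>cls\<close> (their class indices, starting from 1); the list of agent \<open>i\<close> occupies the
  positions from \<open>off i\<close> up to but excluding \<open>off (i + 1)\<close>. All other cells are initially 0.
\<close>

definition input_store ::
    "nat \<Rightarrow> nat \<Rightarrow> nat list \<Rightarrow> (nat \<Rightarrow> nat) \<Rightarrow> (nat \<Rightarrow> nat list list) \<Rightarrow> store" where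
  "input_store n1 n2 \<sigma> pr D =
     (let es = concat (map (\<lambda>i. entries (D i)) [0..<n1])
      in (\<lambda>_ _. 0)
         (''n1'' := table [n1],
          ''n2'' := table [n2],
          ''order'' := table \<sigma>,
          ''pos'' := table (map pr [0..<n2]),
          ''off'' := table (map (\<lambda>i. \<Sum>j < i. length (entries (D j))) [0..<n1 + 1]),
          ''cls'' := table (map fst es),
          ''obj'' := table (map snd es)))"

text \<open>
  An owner or partner \<open>j\<close> is stored as \<open>j + 1\<close>, so that 0 stands for ``none''.
\<close>

definition stored_ownership :: "store \<Rightarrow> ownership" where
  "stored_ownership s j = {a. s ''owner'' a = j + 1}"

definition stored_matching :: "nat \<Rightarrow> store \<Rightarrow> matching" where
  "stored_matching n1 s = {(i, a). i < n1 \<and> s ''partner'' i = a + 1}"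

text \<open>
  The program \<open>init; while b do body; final\<close> is an implementation of SDMT-2 on the given instance
  with running time \<open>T\<close>: it halts after \<open>T\<close> units with the resulting matching in the store, it
  executes \<open>body\<close> exactly once per agent, and after \<open>k\<close> executions the store contains the ownership
  that results from processing the first \<open>k\<close> agents of the order.
\<close>

definition implements_sdmt2 ::
    "com \<Rightarrow> bexp \<Rightarrow> com \<Rightarrow> com \<Rightarrow> path_rule \<Rightarrow>
     nat \<Rightarrow> nat \<Rightarrow> nat list \<Rightarrow> (nat \<Rightarrow> nat) \<Rightarrow> profile \<Rightarrow> (nat \<Rightarrow> nat list list) \<Rightarrow> nat \<Rightarrow> bool"
  where
  "implements_sdmt2 init b body final sel n1 n2 \<sigma> pr L D T \<longleftrightarrow>
     (\<exists>out. exec (Seq init (Seq (While b body) final)) (input_store n1 n2 \<sigma> pr D) T out \<and>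
            stored_matching n1 out = sdmt2 n1 n2 \<sigma> pr sel L) \<and>
     (\<exists>s. (\<exists>t. exec init (input_store n1 n2 \<sigma> pr D) t (s 0)) \<and>
          (\<forall>k < n1. bval b (s k) \<and> (\<exists>t. exec body (s k) t (s (k + 1)))) \<and>
          \<not> bval b (s n1) \<and>
          (\<forall>k \<le> n1. stored_ownership (s k) = sdmt2_ownership n2 pr sel L (take k \<sigma>)))"

end

theory Submission
  imports Defs
begin

text \<open>
  Call the rank of an agent the index of the class from which he owns objects. Ranks never change
  once assigned, and all objects of such a class stay allocated. If the agent \<open>i\<close> being processed
  could be given an object better than his new rank while all processed agents keep their ranks,
  then \<open>i\<close> and the agents reachable from him in the trading graph could be matched injectively to
  the objects owned by the reachable agents; as none of these is labelled, there is one object too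
  few. So every agent gets the best rank compatible with the ranks of his predecessors. This
  implies Pareto optimality, and also truthfulness, because the lists of \<open>i\<close> and of later agents have
  no influence on the ranks of his predecessors.

  For the running time, an agent goes through his classes and, if a class contains no free object,
  tries its objects from the top of the common order by breadth-first search for a labelled agent.
  Agents visited by an unsuccessful search stay marked: no labelled agent can be reached from them.
  Each search visits a new agent, each visit scans one class, and so does the choice of the next
  object to try, so that one agent costs \<open>O(n1 \<gamma>)\<close> steps besides the length of his list.
  The path traded along must be determined by the trading graph alone; it is made
  canonical by taking the least labelled agent as target and least predecessors among the shortest
  paths.
\<close>


section \<open>Preference lists\<close>

text \<open>The counting argument closes up because \<open>alloc_inv\<close> demands that the whole
  class of every processed agent be allocated: whatever object of that class a rival matching gives
  him, its owner is again reachable. The rank granted by a step, \<open>best_rank\<close>, is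
  expressed without tie-breaking and without the path rule, so the first half of the theorem covers
  every path rule. The second half needs one rule that a program can reproduce exactly, although its
  searches leave marks behind. Two facts reconcile this. Once the reachability condition is dropped
  (\<open>full_graph\<close>), only the edges at the source depend on the object tried, so a set of
  agents closed under edges stays closed in later searches. And a closed set without labelled agents
  cannot meet a path to a labelled agent, so ignoring it changes neither distances nor least parents
  outside it. A search is charged to its new marks; there is at least one because only objects of
  unmarked owners are tried.\<close>

lemma nth_class_range: "a \<in> nth_class l k \<Longrightarrow> 1 \<le> k \<and> k \<le> length l"
  by (auto simp: nth_class_def split: if_splits)

lemma nth_class_Suc: "k < length l \<Longrightarrow> nth_class l (Suc k) = l ! k"
  by (simp add: nth_class_def)

lemma acceptable_iff: "a \<in> acceptable l \<longleftrightarrow> (\<exists>k. a \<in> nth_class l k)"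
proof
  assume "a \<in> acceptable l"
  then obtain k where "k < length l" "a \<in> l ! k"
    by (auto simp: acceptable_def in_set_conv_nth)
  then show "\<exists>k. a \<in> nth_class l k" by (metis nth_class_Suc)
next
  assume "\<exists>k. a \<in> nth_class l k"
  then show "a \<in> acceptable l"
    by (auto simp: acceptable_def nth_class_def split: if_splits)
qed

lemma nth_class_disjoint:
  assumes "valid_pref n2 l" "a \<in> nth_class l j" "a \<in> nth_class l k"
  shows "j = k"
proof -
  have D: "\<And>j k. j < k \<Longrightarrow> k < length l \<Longrightarrow> l ! j \<inter> l ! k = {}"
    using assms(1) unfolding valid_pref_def by blast
  have jk: "1 \<le> j" "j \<le> length l" "1 \<le> k" "k \<le> length l"
    using assms nth_class_range by blast+
  then have "a \<in> l ! (j - 1)" "a \<in> l ! (k - 1)"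
    using assms by (auto simp: nth_class_def)
  then have "\<not> j - 1 < k - 1" "\<not> k - 1 < j - 1"
    using D[of "j - 1" "k - 1"] D[of "k - 1" "j - 1"] jk by force+
  then show ?thesis using jk by linarith
qed

lemma nth_class_bound: "valid_pref n2 l \<Longrightarrow> nth_class l k \<subseteq> {..<n2}"
  by (auto simp: nth_class_def valid_pref_def dest: nth_mem split: if_splits)

lemma nth_class_nonempty: "valid_pref n2 l \<Longrightarrow> k < length l \<Longrightarrow> l ! k \<noteq> {}"
  by (auto simp: valid_pref_def)

text \<open>Picking one object from each nonempty class injects the class indices into the objects,
  because the classes are disjoint. Hence no class has index \<open>n2 + 1\<close>, and that value
  is free to encode being unmatched.\<close>

lemma valid_pref_length:
  assumes "valid_pref n2 l"
  shows "length l \<le> n2"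
proof -
  define f where "f k = (SOME a. a \<in> l ! k)" for k
  have f: "f k \<in> l ! k" if "k < length l" for k
    using nth_class_nonempty[OF assms that] unfolding f_def by (simp add: some_in_eq)
  have "inj_on f {..<length l}"
  proof (rule inj_onI)
    fix j k assume "j \<in> {..<length l}" "k \<in> {..<length l}" "f j = f k"
    then show "j = k"
      using nth_class_disjoint[OF assms, of "f j" "Suc j" "Suc k"] f[of j] f[of k]
      by (simp add: nth_class_Suc)
  qed
  moreover have "f ` {..<length l} \<subseteq> {..<n2}"
    using f nth_class_bound[OF assms] by (force simp: nth_class_Suc[symmetric])
  ultimately show ?thesis
    using card_inj_on_le[of f "{..<length l}" "{..<n2}"] by simp
qed

lemma nth_class_beyond: "valid_pref n2 l \<Longrightarrow> nth_class l (n2 + 1) = {}"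
  using valid_pref_length[of n2 l] by (simp add: nth_class_def)

lemma first_class_le: "a \<in> A \<Longrightarrow> a \<in> nth_class l k \<Longrightarrow> first_class n2 l A \<le> k"
  unfolding first_class_def by (auto intro!: Least_le)

lemma first_class_none: "A \<inter> acceptable l = {} \<Longrightarrow> first_class n2 l A = n2 + 1"
  unfolding first_class_def using acceptable_iff by fastforce

lemma first_class_witness:
  assumes "A \<inter> acceptable l \<noteq> {}"
  shows "nth_class l (first_class n2 l A) \<inter> A \<noteq> {}"
proof -
  have ex: "\<exists>k. nth_class l k \<inter> A \<noteq> {}" using assms acceptable_iff by fastforce
  show ?thesis unfolding first_class_def using LeastI_ex[OF ex] ex by simp
qed

lemma first_class_eq:
  assumes "valid_pref n2 l" "A \<subseteq> nth_class l k" "A \<noteq> {}"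
  shows "first_class n2 l A = k"
proof -
  have "A \<inter> acceptable l \<noteq> {}" using assms acceptable_iff by fastforce
  then show ?thesis
    using first_class_witness[of A l n2] nth_class_disjoint[OF assms(1)] assms(2) by blast
qed

lemma first_class_bound:
  assumes "valid_pref n2 l"
  shows "first_class n2 l A \<le> n2 + 1"
proof (cases "A \<inter> acceptable l = {}")
  case False
  then obtain a where "a \<in> nth_class l (first_class n2 l A)"
    using first_class_witness by blast
  then show ?thesis using nth_class_range valid_pref_length[OF assms] by fastforce
qed (simp add: first_class_none)

text \<open>The class with index \<open>n2 + 1\<close> is empty, so a minimum that has a witness
  cannot coincide with the default value.\<close>

lemma first_class_acceptable:
  assumes "valid_pref n2 l" "A \<inter> acceptable l \<noteq> {}"
  shows "first_class n2 l A \<le> n2"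
  using first_class_witness[OF assms(2), of n2] nth_class_beyond[OF assms(1)]
    first_class_bound[OF assms(1), of A] by (cases "first_class n2 l A = n2 + 1") auto

lemma rank_eq: "valid_pref n2 l \<Longrightarrow> a \<in> nth_class l k \<Longrightarrow> rank n2 l a = k"
  unfolding rank_def by (rule first_class_eq) auto

lemma rank_unacceptable: "a \<notin> acceptable l \<Longrightarrow> rank n2 l a = n2 + 1"
  unfolding rank_def by (rule first_class_none) auto

lemma nth_class_rank:
  assumes "valid_pref n2 l" "rank n2 l a \<le> n2"
  shows "a \<in> nth_class l (rank n2 l a)"
proof -
  have "a \<in> acceptable l" using assms(2) rank_unacceptable[of a l n2] by fastforce
  then show ?thesis using rank_eq[OF assms(1)] acceptable_iff by metis
qed

text \<open>The list \<open>l\<close> is independent of \<open>L\<close> because truthfulness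
  evaluates the outcome of a misreported profile by the true list.\<close>

lemma outcome_rank_eq:
  "matching n1 n2 L \<mu> \<Longrightarrow> (i, a) \<in> \<mu> \<Longrightarrow> outcome_rank n2 l \<mu> i = rank n2 l a"
  unfolding outcome_rank_def matching_def
  by (smt (verit, best) the_equality)

lemma outcome_rank_unmatched: "(\<And>a. (i, a) \<notin> \<mu>) \<Longrightarrow> outcome_rank n2 l \<mu> i = n2 + 1"
  unfolding outcome_rank_def by simp

lemma highest_in: "A \<noteq> {} \<Longrightarrow> highest pr A \<in> A"
  and highest_le: "b \<in> A \<Longrightarrow> pr (highest pr A) \<le> pr b"
  unfolding highest_def arg_min_on_def
  using arg_min_nat_lemma[of "\<lambda>x. x \<in> A" _ pr] by blast+

lemma highest_eq:
  assumes "inj_on pr A" "a \<in> A" "\<And>b. b \<in> A \<Longrightarrow> pr a \<le> pr b"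
  shows "highest pr A = a"
proof -
  have "highest pr A \<in> A" "pr (highest pr A) \<le> pr a"
    using highest_in highest_le assms(2) by blast+
  then show ?thesis using assms by (meson antisym inj_onD)
qed

lemma common_order_inj: "common_order n2 pr \<Longrightarrow> A \<subseteq> {..<n2} \<Longrightarrow> inj_on pr A"
  unfolding common_order_def bij_betw_def by (blast intro: inj_on_subset)


section \<open>Canonical shortest paths\<close>

definition bfs_dist :: "(nat \<times> nat) set \<Rightarrow> nat \<Rightarrow> nat \<Rightarrow> nat" where
  "bfs_dist E i y = (LEAST n. (i, y) \<in> E ^^ n)"

text \<open>The least predecessor on the previous level depends on the graph and the source alone,
  and a program can maintain it while scanning edges. At \<open>y = i\<close> the value has no
  intended meaning.\<close>

definition bfs_parent :: "(nat \<times> nat) set \<Rightarrow> nat \<Rightarrow> nat \<Rightarrow> nat" where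
  "bfs_parent E i y = (LEAST x. (i, x) \<in> E ^^ (bfs_dist E i y - 1) \<and> (x, y) \<in> E)"

text \<open>The path is read backwards from \<open>z\<close>: entry \<open>s\<close> results from
  \<open>bfs_dist E i z - s\<close> parent steps and so lies at distance \<open>s\<close> from
  \<open>i\<close>. Pairwise different distances make the path simple.\<close>

definition bfs_path :: "(nat \<times> nat) set \<Rightarrow> nat \<Rightarrow> nat \<Rightarrow> nat list" where
  "bfs_path E i z =
     map (\<lambda>s. (bfs_parent E i ^^ (bfs_dist E i z - s)) z) [0..<Suc (bfs_dist E i z)]"

text \<open>
  The labelled agents of a trading graph have no successors, but a path rule has to cope with
  arbitrary graphs.
\<close>

definition bfs_rule :: path_rule where
  "bfs_rule w E i =
     (let E' = {(x, y) \<in> E. \<not> labelled w x}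
      in bfs_path E' i (LEAST z. labelled w z \<and> (i, z) \<in> E'\<^sup>*))"

lemma bfs_dist_reach: "(i, y) \<in> E\<^sup>* \<Longrightarrow> (i, y) \<in> E ^^ bfs_dist E i y"
  unfolding bfs_dist_def by (rule LeastI_ex) (rule rtrancl_imp_relpow)

lemma bfs_dist_le: "(i, y) \<in> E ^^ n \<Longrightarrow> bfs_dist E i y \<le> n"
  unfolding bfs_dist_def by (rule Least_le)

text \<open>A parent at a distance below \<open>d\<close> would place \<open>y\<close> at a distance
  below \<open>Suc d\<close>, so the walk of length \<open>d\<close> to the parent is a shortest
  one.\<close>

lemma bfs_parent_step:
  assumes "(i, y) \<in> E\<^sup>*" "bfs_dist E i y = Suc d"
  shows "(i, bfs_parent E i y) \<in> E ^^ d" "(bfs_parent E i y, y) \<in> E"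
    "bfs_dist E i (bfs_parent E i y) = d"
proof -
  have "(i, y) \<in> E ^^ Suc d" using bfs_dist_reach[OF assms(1)] assms(2) by simp
  then have "\<exists>x. (i, x) \<in> E ^^ (bfs_dist E i y - 1) \<and> (x, y) \<in> E"
    using assms(2) by auto
  then have *: "(i, bfs_parent E i y) \<in> E ^^ (bfs_dist E i y - 1) \<and> (bfs_parent E i y, y) \<in> E"
    unfolding bfs_parent_def by (rule LeastI_ex)
  then show 1: "(i, bfs_parent E i y) \<in> E ^^ d" "(bfs_parent E i y, y) \<in> E"
    using assms(2) by auto
  have "(i, y) \<in> E ^^ Suc (bfs_dist E i (bfs_parent E i y))"
    using bfs_dist_reach[of i "bfs_parent E i y" E] 1 relpow_imp_rtrancl by fastforce
  then show "bfs_dist E i (bfs_parent E i y) = d"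
    using bfs_dist_le[OF 1(1)] bfs_dist_le[of i y _ E] assms(2) by fastforce
qed

lemma bfs_parent_funpow:
  assumes "(i, z) \<in> E\<^sup>*" "k \<le> bfs_dist E i z"
  shows "(i, (bfs_parent E i ^^ k) z) \<in> E\<^sup>* \<and>
    bfs_dist E i ((bfs_parent E i ^^ k) z) = bfs_dist E i z - k"
  using assms(2)
proof (induction k)
  case (Suc k)
  let ?y = "(bfs_parent E i ^^ k) z"
  have "(i, ?y) \<in> E\<^sup>*" "bfs_dist E i ?y = Suc (bfs_dist E i z - Suc k)"
    using Suc by auto
  from bfs_parent_step[OF this] show ?case
    by (auto dest: relpow_imp_rtrancl)
qed (use assms in simp)

lemma bfs_path_length: "length (bfs_path E i z) = Suc (bfs_dist E i z)"
  by (simp add: bfs_path_def)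

lemma bfs_path_nth:
  "s \<le> bfs_dist E i z \<Longrightarrow> bfs_path E i z ! s = (bfs_parent E i ^^ (bfs_dist E i z - s)) z"
  unfolding bfs_path_def by (subst nth_map) (auto simp del: upt_Suc)

lemma bfs_path_parent:
  assumes "Suc s \<le> bfs_dist E i z"
  shows "bfs_path E i z ! s = bfs_parent E i (bfs_path E i z ! Suc s)"
proof -
  have "bfs_dist E i z - s = Suc (bfs_dist E i z - Suc s)" using assms by simp
  then show ?thesis using assms by (simp add: bfs_path_nth)
qed

lemma bfs_path_facts:
  assumes "(i, z) \<in> E\<^sup>*" "s \<le> bfs_dist E i z"
  shows "(i, bfs_path E i z ! s) \<in> E\<^sup>*" "bfs_dist E i (bfs_path E i z ! s) = s"
  using bfs_parent_funpow[OF assms(1), of "bfs_dist E i z - s"] assms(2)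
  by (simp_all add: bfs_path_nth)

lemma bfs_path_edge:
  assumes "(i, z) \<in> E\<^sup>*" "Suc s \<le> bfs_dist E i z"
  shows "(bfs_path E i z ! s, bfs_path E i z ! Suc s) \<in> E"
  using bfs_parent_step(2)[OF bfs_path_facts[OF assms]] bfs_path_parent[OF assms(2)] by simp

lemma bfs_path_0:
  assumes "(i, z) \<in> E\<^sup>*"
  shows "bfs_path E i z ! 0 = i"
  using bfs_dist_reach[OF bfs_path_facts(1)[OF assms, of 0]] bfs_path_facts(2)[OF assms, of 0]
  by simp

lemma bfs_path_distinct:
  assumes "(i, z) \<in> E\<^sup>*"
  shows "distinct (bfs_path E i z)"
  unfolding distinct_conv_nth bfs_path_length
  using bfs_path_facts(2)[OF assms] by (metis less_Suc_eq_le)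

lemma bfs_path_last: "bfs_path E i z ! bfs_dist E i z = z"
  by (simp add: bfs_path_nth)

text \<open>Deleting the edges that leave labelled agents keeps every agent before the last one
  unlabelled. Since \<open>i\<close> is unlabelled, the target differs from him and the path has at
  least one edge.\<close>

lemma trading_path_bfs_rule:
  assumes "labelled w z" "(i, z) \<in> {(x, y) \<in> E. \<not> labelled w x}\<^sup>*" "\<not> labelled w i"
  shows "trading_path w E i (bfs_rule w E i)"
proof -
  define E' where "E' = {(x, y) \<in> E. \<not> labelled w x}"
  define u where "u = (LEAST z. labelled w z \<and> (i, z) \<in> E'\<^sup>*)"
  have u: "labelled w u \<and> (i, u) \<in> E'\<^sup>*"
    unfolding u_def by (rule LeastI[of _ z]) (use assms in \<open>simp add: E'_def\<close>)
  have p: "bfs_rule w E i = bfs_path E' i u"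
    by (simp add: bfs_rule_def Let_def E'_def u_def)
  let ?p = "bfs_path E' i u" and ?n = "bfs_dist E' i u"
  have ui: "(i, u) \<in> E'\<^sup>*" using u by simp
  have "?n \<noteq> 0"
    using bfs_path_0[OF ui] bfs_path_last[of E' i u] u assms(3) by metis
  then obtain n where n: "?n = Suc n" by (cases ?n) auto
  have edge: "(?p ! s, ?p ! Suc s) \<in> E'" if "s < ?n" for s
    using bfs_path_edge[OF ui] that by simp
  have "hd ?p = i"
    using bfs_path_0[OF ui] by (simp add: hd_conv_nth bfs_path_def)
  moreover have "last ?p = u"
    using bfs_path_last[of E' i u] bfs_path_length[of E' i u]
    by (metis Zero_not_Suc diff_Suc_1 last_conv_nth list.size(3))
  moreover have "successively (\<lambda>x y. (x, y) \<in> E) ?p"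
    unfolding successively_conv_nth bfs_path_length using edge E'_def by auto
  moreover have "\<not> labelled w x" if x: "x \<in> set (butlast ?p)" for x
  proof -
    have "length (butlast ?p) = ?n" by (simp add: bfs_path_length)
    then obtain s where "s < ?n" "x = ?p ! s"
      using x by (metis in_set_conv_nth nth_butlast)
    then show ?thesis using edge[of s] E'_def by auto
  qed
  ultimately show ?thesis
    unfolding p trading_path_def
    using bfs_path_distinct[OF ui] u bfs_path_length[of E' i u] n by auto
qed

text \<open>Converse needed for \<open>path_rule_bfs_rule\<close>: a trading path survives the
  deletion of the edges leaving labelled agents, so the canonical rule succeeds whenever some path
  exists.\<close>

lemma trading_path_reaches:
  assumes "trading_path w E i p"
  shows "(i, last p) \<in> {(x, y) \<in> E. \<not> labelled w x}\<^sup>*"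
proof -
  let ?E = "{(x, y) \<in> E. \<not> labelled w x}"
  have p: "length p \<ge> 2" "hd p = i" "successively (\<lambda>x y. (x, y) \<in> E) p"
    "\<forall>x \<in> set (butlast p). \<not> labelled w x"
    using assms unfolding trading_path_def by auto
  have "(i, p ! s) \<in> ?E\<^sup>*" if "s < length p" for s
    using that
  proof (induction s)
    case 0 then show ?case using p by (simp add: hd_conv_nth[symmetric])
  next
    case (Suc s)
    have "(p ! s, p ! Suc s) \<in> E" using p(3) Suc.prems by (simp add: successively_conv_nth)
    moreover have "p ! s \<in> set (butlast p)"
      using Suc.prems by (auto simp: in_set_conv_nth nth_butlast intro!: exI[of _ s])
    ultimately have "(p ! s, p ! Suc s) \<in> ?E" using p(4) by auto
    then show ?case using Suc by (meson Suc_lessD rtrancl.rtrancl_into_rtrancl)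
  qed
  then show ?thesis using p(1) by (subst last_conv_nth) auto
qed

lemma path_rule_bfs_rule: "path_rule bfs_rule"
  unfolding path_rule_def
proof (intro allI impI, elim exE)
  fix w E i p assume p: "trading_path w E i p"
  then have "i \<in> set (butlast p)" "labelled w (last p)"
    unfolding trading_path_def by (cases p; auto)+
  then have "\<not> labelled w i" using p unfolding trading_path_def by blast
  then show "trading_path w E i (bfs_rule w E i)"
    using trading_path_bfs_rule trading_path_reaches[OF p] \<open>labelled w (last p)\<close> by blast
qed


section \<open>Trading along a path\<close>

text \<open>Replaces the recursion by a description by positions. The induction works because the
  list is distinct: the outermost update, at the head, cannot disturb the positions settled in the
  tail.\<close>

lemma trade_along_nth:
  assumes "distinct p" "length p = Suc (Suc n)" "b = highest pr (w (p ! Suc n) \<inter> wt (p ! n))"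
  shows "(\<forall>j. j \<notin> set p \<longrightarrow> trade_along pr wt w p j = w j) \<and>
    trade_along pr wt w p (p ! Suc n) = w (p ! Suc n) - {b} \<and>
    trade_along pr wt w p (p ! n) = {b} \<and>
    (\<forall>s < n. trade_along pr wt w p (p ! s) = w (p ! Suc s))"
  using assms
proof (induction n arbitrary: p)
  case 0
  then obtain x z where "p = [x, z]" by (auto simp: length_Suc_conv)
  then show ?case using 0 by (auto simp: Let_def)
next
  case (Suc n)
  then obtain x y z q where p: "p = x # y # z # q"
    by (auto simp: length_Suc_conv)
  have IH: "(\<forall>j. j \<notin> set (y # z # q) \<longrightarrow> trade_along pr wt w (y # z # q) j = w j) \<and>
    trade_along pr wt w (y # z # q) ((y # z # q) ! Suc n) = w ((y # z # q) ! Suc n) - {b} \<and>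
    trade_along pr wt w (y # z # q) ((y # z # q) ! n) = {b} \<and>
    (\<forall>s < n. trade_along pr wt w (y # z # q) ((y # z # q) ! s) = w ((y # z # q) ! Suc s))"
    by (rule Suc.IH) (use Suc.prems p in auto)
  have x: "x \<notin> set (y # z # q)" using Suc.prems p by auto
  have ne: "(y # z # q) ! s \<noteq> x" if "s \<le> Suc n" for s
    using x nth_mem[of s "y # z # q"] that Suc.prems(2) p by (metis length_Cons less_Suc_eq_le Suc_inject)
  have T: "trade_along pr wt w p = (trade_along pr wt w (y # z # q))(x := w y)"
    by (simp add: p)
  have N: "p ! Suc s = (y # z # q) ! s" "p ! 0 = x" for s by (simp_all add: p)
  show ?case
  proof (intro conjI allI impI)
    fix j assume "j \<notin> set p" then show "trade_along pr wt w p j = w j"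
      unfolding T using IH p by simp
  next
    show "trade_along pr wt w p (p ! Suc (Suc n)) = w (p ! Suc (Suc n)) - {b}"
      unfolding T N using IH ne[of "Suc n"] by simp
    show "trade_along pr wt w p (p ! Suc n) = {b}"
      unfolding T N using IH ne by simp
  next
    fix s assume s: "s < Suc n"
    show "trade_along pr wt w p (p ! s) = w (p ! Suc s)"
    proof (cases s)
      case 0 then show ?thesis by (simp add: T p)
    next
      case (Suc t)
      then have "t < n" using s by simp
      then show ?thesis unfolding T Suc N using IH ne[of t] by simp
    qed
  qed
qed

text \<open>Along the path \<open>p\<close>, agent \<open>p ! Suc s\<close> hands over the object \<open>ob (Suc s)\<close> to \<open>p ! s\<close>.\<close>

definition shifted :: "ownership \<Rightarrow> nat list \<Rightarrow> nat \<Rightarrow> (nat \<Rightarrow> nat) \<Rightarrow> ownership \<Rightarrow> bool" where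
  "shifted w p n ob w' \<longleftrightarrow> length p = Suc n \<and> 1 \<le> n \<and> distinct p \<and> w (p ! 0) = {} \<and>
     (\<forall>s. 1 \<le> s \<and> s < n \<longrightarrow> w (p ! s) = {ob s}) \<and> ob n \<in> w (p ! n) \<and>
     (\<forall>s < n. w' (p ! s) = {ob (Suc s)}) \<and> w' (p ! n) = w (p ! n) - {ob n} \<and>
     (\<forall>j. j \<notin> set p \<longrightarrow> w' j = w j)"

lemma shifted_old: "shifted w p n ob w' \<Longrightarrow> 1 \<le> s \<Longrightarrow> s \<le> n \<Longrightarrow> ob s \<in> w (p ! s)"
  unfolding shifted_def by (cases "s = n") auto

lemma shifted_inj:
  assumes "shifted w p n ob w'" "\<forall>i j. i \<noteq> j \<longrightarrow> w i \<inter> w j = {}"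
    and "1 \<le> s" "s \<le> n" "1 \<le> t" "t \<le> n" "ob s = ob t"
  shows "s = t"
proof -
  have "p ! s = p ! t" using shifted_old[OF assms(1)] assms(2-) by (metis disjoint_iff)
  then show ?thesis using assms unfolding shifted_def by (simp add: nth_eq_iff_index_eq)
qed

text \<open>Describes the trade object by object instead of agent by agent: exactly
  \<open>ob 1, ..., ob n\<close> change hands. This is the view of the array \<open>owner\<close> in
  the program.\<close>

lemma shifted_iff:
  assumes "shifted w p n ob w'" "\<forall>i j. i \<noteq> j \<longrightarrow> w i \<inter> w j = {}"
  shows "a \<in> w' j \<longleftrightarrow> (\<exists>s < n. j = p ! s \<and> a = ob (Suc s)) \<or> (a \<in> w j \<and> a \<notin> ob ` {1..n})"
    (is "?l \<longleftrightarrow> ?r")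
proof -
  note sh = assms(1)[unfolded shifted_def]
  have own: "j = p ! s" if "a \<in> w j" "a = ob s" "1 \<le> s" "s \<le> n" for s
    using shifted_old[OF assms(1) that(3,4)] assms(2) that by (metis disjoint_iff)
  show ?thesis
  proof (cases "j \<in> set p")
    case False
    moreover have "p ! s \<noteq> j" if "s \<le> n" for s
      using sh False that nth_mem[of s p] by (metis less_Suc_eq_le)
    ultimately show ?thesis using sh own by fastforce
  next
    case True
    then obtain s where s: "j = p ! s" "s \<le> n" using sh by (metis in_set_conv_nth less_Suc_eq_le)
    have eq: "p ! s = p ! t \<longleftrightarrow> s = t" if "t \<le> n" for t
      using sh s(2) that by (simp add: nth_eq_iff_index_eq)
    show ?thesis
    proof (cases "s = n")
      case True
      have "t = n" if "a \<in> w j" "a = ob t" "1 \<le> t" "t \<le> n" for t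
        using own[OF that] eq[OF that(4)] s True by simp
      then have "a \<in> w j \<Longrightarrow> a \<in> ob ` {1..n} \<longleftrightarrow> a = ob n"
        using sh by fastforce
      moreover have "w' j = w j - {ob n}" "\<And>t. t < n \<Longrightarrow> j \<noteq> p ! t"
        using sh s eq True by auto
      ultimately show ?thesis by blast
    next
      case False
      \<comment> \<open>Before the end of the path an agent owns nothing (\<open>s = 0\<close>) or
        just the object he hands over, so nothing of his old property stays with him.\<close>
      then have "w j = {} \<or> w j = {ob s} \<and> 1 \<le> s" using sh s by (cases s) auto
      then have "\<not> (a \<in> w j \<and> a \<notin> ob ` {1..n})" using s by auto
      moreover have "a \<in> w' j \<longleftrightarrow> a = ob (Suc s)" "s < n" using sh s False by auto
      moreover have "(\<exists>t < n. j = p ! t \<and> a = ob (Suc t)) \<longleftrightarrow> a = ob (Suc s)"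
        using eq s(1) \<open>s < n\<close> by (metis less_imp_le)
      ultimately show ?thesis by blast
    qed
  qed
qed

lemma shifted_disjoint:
  assumes "shifted w p n ob w'" "\<forall>i j. i \<noteq> j \<longrightarrow> w i \<inter> w j = {}" "i \<noteq> j"
  shows "w' i \<inter> w' j = {}"
proof (rule ccontr)
  assume "w' i \<inter> w' j \<noteq> {}"
  then obtain a where a: "a \<in> w' i" "a \<in> w' j" by auto
  note iff = shifted_iff[OF assms(1,2), of a]
  have inj: "s = t" if "ob (Suc s) = ob (Suc t)" "s < n" "t < n" for s t
    using shifted_inj[OF assms(1,2), of "Suc s" "Suc t"] that by simp
  have mem: "ob (Suc s) \<in> ob ` {1..n}" if "s < n" for s using that by auto
  show False
    using a[unfolded iff]
  proof (elim disjE exE conjE)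
    fix s t assume "s < n" "i = p ! s" "a = ob (Suc s)" "t < n" "j = p ! t" "a = ob (Suc t)"
    then show False using inj[of s t] assms(3) by simp
  next
    assume "a \<in> w i" "a \<in> w j" then show False using assms(2,3) by auto
  qed (use mem in auto)
qed

text \<open>Objects move only between agents on the path. Thus a trade leaves the set of allocated
  objects unchanged, which keeps the classes covered in \<open>trade_inv\<close>.\<close>

lemma shifted_union:
  assumes "shifted w p n ob w'" "\<forall>i j. i \<noteq> j \<longrightarrow> w i \<inter> w j = {}" "set p \<subseteq> A"
  shows "(\<Union>j \<in> A. w' j) = (\<Union>j \<in> A. w j)"
proof -
  have mem: "p ! s \<in> A" if "s \<le> n" for s
    using assms(1,3) that unfolding shifted_def by (metis less_Suc_eq_le nth_mem subsetD)
  have "a \<in> (\<Union>j \<in> A. w' j) \<longleftrightarrow> a \<in> (\<Union>j \<in> A. w j)" for a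
  proof (cases "a \<in> ob ` {1..n}")
    case True
    then obtain s where s: "1 \<le> s" "s \<le> n" "a = ob s" by auto
    then obtain t where t: "s = Suc t" by (cases s) auto
    have "a \<in> w (p ! s)" using shifted_old[OF assms(1) s(1,2)] s(3) by simp
    moreover have "a \<in> w' (p ! t)"
      unfolding shifted_iff[OF assms(1,2), of a "p ! t"] using s t by (intro disjI1 exI[of _ t]) simp
    ultimately show ?thesis using mem[of s] mem[of t] s t by auto
  next
    case False
    then show ?thesis using shifted_iff[OF assms(1,2), of a] by force
  qed
  then show ?thesis by blast
qed


section \<open>The allocation invariant\<close>

abbreviation own_rank :: "nat \<Rightarrow> profile \<Rightarrow> ownership \<Rightarrow> nat \<Rightarrow> nat" where
  "own_rank n2 L w j \<equiv> first_class n2 (L j) (w j)"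

text \<open>The last conjunct is the crucial one: it makes the set of agents reachable in a trading
  graph closed under "some other object of the same class". For an agent owning nothing,
  \<open>own_rank\<close> is \<open>n2 + 1\<close>, whose class is empty, so the last two conditions
  hold trivially.\<close>

definition alloc_inv :: "nat \<Rightarrow> nat \<Rightarrow> profile \<Rightarrow> nat set \<Rightarrow> ownership \<Rightarrow> bool" where
  "alloc_inv n1 n2 L S w \<longleftrightarrow>
     S \<subseteq> {..<n1} \<and> (\<forall>j. j \<notin> S \<longrightarrow> w j = {}) \<and> (\<forall>i j. i \<noteq> j \<longrightarrow> w i \<inter> w j = {}) \<and>
     (\<forall>j \<in> S. w j \<subseteq> nth_class (L j) (own_rank n2 L w j) \<and>
              nth_class (L j) (own_rank n2 L w j) \<subseteq> (\<Union>j \<in> S. w j))"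

context
  fixes n1 n2 L S w
  assumes L: "valid_profile n1 n2 L" and inv: "alloc_inv n1 n2 L S w"
begin

lemma inv_S: "S \<subseteq> {..<n1}" and inv_out: "j \<notin> S \<Longrightarrow> w j = {}"
  and inv_disj: "\<forall>i j. i \<noteq> j \<longrightarrow> w i \<inter> w j = {}"
  and inv_class: "w j \<subseteq> nth_class (L j) (own_rank n2 L w j)"
  and inv_covered: "j \<in> S \<Longrightarrow> nth_class (L j) (own_rank n2 L w j) \<subseteq> (\<Union>j \<in> S. w j)"
  using inv unfolding alloc_inv_def by blast+

lemma inv_pref: "j \<in> S \<Longrightarrow> valid_pref n2 (L j)"
  using L inv_S unfolding valid_profile_def by blast

lemma inv_finite: "finite (w j)" and inv_bound: "w j \<subseteq> {..<n2}"
proof -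
  show *: "w j \<subseteq> {..<n2}"
    using inv_class[of j] nth_class_bound[OF inv_pref] inv_out by (cases "j \<in> S") blast+
  then show "finite (w j)" using finite_subset by blast
qed

lemma unlabelled_singleton: "\<not> labelled w j \<Longrightarrow> a \<in> w j \<Longrightarrow> w j = {a}"
  unfolding labelled_def using inv_finite[of j] card_le_Suc0_iff_eq[of "w j"] by auto

text \<open>All objects of \<open>x\<close> lie in one class, and classes are disjoint, so the union
  in \<open>wanted\<close> has a single member.\<close>

lemma wanted_other:
  assumes "x \<in> S" "x \<noteq> i" "w x \<noteq> {}"
  shows "wanted L w i B x = nth_class (L x) (own_rank n2 L w x) - w x"
proof -
  let ?k = "own_rank n2 L w x"
  obtain a where a: "a \<in> w x" using assms by auto
  have k: "a \<in> nth_class (L x) ?k" using inv_class a by blast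
  have "{C \<in> set (L x). w x \<inter> C \<noteq> {}} = {nth_class (L x) ?k}" (is "?A = ?B")
  proof
    show "?B \<subseteq> ?A" using k a nth_class_range[OF k] by (auto simp: nth_class_def)
    show "?A \<subseteq> ?B"
    proof
      fix C assume "C \<in> ?A"
      then obtain m c where "m < length (L x)" "L x ! m = C" "c \<in> w x" "c \<in> C"
        by (auto simp: in_set_conv_nth)
      then have "c \<in> nth_class (L x) (Suc m)" "c \<in> nth_class (L x) ?k"
        using inv_class by (auto simp: nth_class_Suc)
      then have "Suc m = ?k" using nth_class_disjoint[OF inv_pref[OF assms(1)]] by blast
      then show "C \<in> ?B" using \<open>L x ! m = C\<close> \<open>m < length (L x)\<close> nth_class_Suc by force
    qed
  qed
  then show ?thesis using assms by (simp add: wanted_def)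
qed

context
  fixes i
  assumes i: "i \<notin> S" "i < n1"
begin

lemma wi: "w i = {}" using inv_out i by blast

lemma i_unlabelled: "\<not> labelled w i" by (simp add: labelled_def wi)

lemma i_pref: "valid_pref n2 (L i)" using L i by (simp add: valid_profile_def)

lemma trading_graph_edge:
  assumes "(x, y) \<in> trading_graph L w i B S"
  shows "y \<in> S \<and> (x = i \<or> x \<in> S) \<and> w y \<inter> wanted L w i B x \<noteq> {} \<and> \<not> labelled w x \<and>
    (x \<noteq> i \<longrightarrow> w x \<noteq> {})"
  using assms
  by induction (auto simp: i_unlabelled)

lemma trading_graph_unlabelled:
  "{(x, y) \<in> trading_graph L w i B S. \<not> labelled w x} = trading_graph L w i B S"
  using trading_graph_edge by auto

text \<open>\<open>bfs_rule\<close> serves as a witness that a trading path exists; any path rule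
  then has to return one.\<close>

lemma obtainable_path:
  assumes "a \<in> obtainable L w i S" "path_rule sel"
  shows "trading_path w (trading_graph L w i {a} S) i (sel w (trading_graph L w i {a} S) i)"
proof -
  let ?E = "trading_graph L w i {a} S"
  obtain z where "labelled w z" "(i, z) \<in> ?E\<^sup>+" using assms by (auto simp: obtainable_def)
  then have "trading_path w ?E i (bfs_rule w ?E i)"
    by (intro trading_path_bfs_rule[of w z])
      (auto simp: trading_graph_unlabelled i_unlabelled)
  then show ?thesis using assms(2) unfolding path_rule_def by blast
qed

text \<open>An agent strictly inside the path is pointed to, so he owns something, and he is
  unlabelled, so he owns exactly one object. That object is both what he hands over and what his
  predecessor wants. The first object is \<open>a\<close>, since the source wants nothing
  else.\<close>

lemma trade_shifted:
  assumes p: "trading_path w (trading_graph L w i {a} S) i p"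
  shows "\<exists>n ob. shifted w p n ob (trade_along pr (wanted L w i {a}) w p) \<and>
     p ! 0 = i \<and> labelled w (p ! n) \<and> ob 1 = a \<and>
     ob n = highest pr (w (p ! n) \<inter> wanted L w i {a} (p ! (n - 1))) \<and>
     (\<forall>s. 1 \<le> s \<and> s \<le> n \<longrightarrow> p ! s \<in> S) \<and>
     (\<forall>s < n. ob (Suc s) \<in> wanted L w i {a} (p ! s) \<and> \<not> labelled w (p ! s))"
proof -
  let ?E = "trading_graph L w i {a} S" and ?wt = "wanted L w i {a}"
  obtain n where len: "length p = Suc (Suc n)"
    using p unfolding trading_path_def
    by (metis Suc_pred add_2_eq_Suc le_add_diff_inverse)
  have edge: "(p ! s, p ! Suc s) \<in> ?E" if "s \<le> n" for s
    using p that len unfolding trading_path_def successively_conv_nth by simp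
  define b where "b = highest pr (w (p ! Suc n) \<inter> ?wt (p ! n))"
  \<comment> \<open>For inner agents the choice is forced, as they own a single object; a tie can
    arise only at the labelled end, where \<open>b\<close> resolves it.\<close>
  define ob where "ob s = (if s = Suc n then b else (SOME c. c \<in> w (p ! s)))" for s
  have p0: "p ! 0 = i" using p len unfolding trading_path_def by (cases p) auto
  have "last p = p ! Suc n" using len last_conv_nth[of p] by (cases "p = []") auto
  then have dist: "distinct p" and lab: "labelled w (p ! Suc n)"
    using p unfolding trading_path_def by auto
  have b: "b \<in> w (p ! Suc n) \<inter> ?wt (p ! n)"
    unfolding b_def by (rule highest_in) (use trading_graph_edge[OF edge[of n]] in simp)
  have S: "p ! s \<in> S" if "1 \<le> s" "s \<le> Suc n" for s
    using trading_graph_edge[OF edge[of "s - 1"]] that by auto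
  have single: "w (p ! s) = {ob s} \<and> ob s \<in> ?wt (p ! (s - 1))" if "1 \<le> s" "s < Suc n" for s
  proof -
    have ne: "w (p ! s) \<inter> ?wt (p ! (s - 1)) \<noteq> {}"
      using trading_graph_edge[OF edge[of "s - 1"]] that by auto
    then obtain c where c: "c \<in> w (p ! s)" by auto
    have "w (p ! s) = {c}"
      using unlabelled_singleton[OF _ c] trading_graph_edge[OF edge[of s]] that by auto
    then show ?thesis using ne that by (auto simp: ob_def)
  qed
  note T = trade_along_nth[OF dist len, of b pr w ?wt]
  have obS: "ob (Suc n) = b" by (simp add: ob_def)
  have "shifted w p (Suc n) ob (trade_along pr ?wt w p)"
    unfolding shifted_def
  proof (intro conjI allI impI)
    fix s assume "s < Suc n"
    then show "trade_along pr ?wt w p (p ! s) = {ob (Suc s)}"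
      using T[OF b_def] single[of "Suc s"] obS by (cases "s = n") auto
  qed (use len dist p0 wi single b T[OF b_def] obS in auto)
  moreover have "ob (Suc s) \<in> ?wt (p ! s)" if "s < Suc n" for s
    using single[of "Suc s"] that b obS by (cases "s = n") auto
  moreover have "ob 1 = a"
    using calculation(2)[of 0] p0 by (simp add: wanted_def)
  moreover have "\<not> labelled w (p ! s)" if "s < Suc n" for s
    using trading_graph_edge[OF edge[of s]] that by simp
  ultimately show ?thesis
    using p0 lab S obS b_def by (intro exI[of _ "Suc n"] exI[of _ ob]) auto
qed

text \<open>Inner agents exchange one object of their class for another, the labelled end keeps at
  least one object, and \<open>i\<close> enters with class \<open>k\<close>. The hypothesis
  \<open>covered\<close> re-establishes the last conjunct of \<open>alloc_inv\<close> for
  \<open>i\<close>, because a trade allocates nothing new.\<close>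

lemma trade_inv:
  fixes pr :: "nat \<Rightarrow> nat"
  assumes a: "a \<in> nth_class (L i) k"
    and covered: "nth_class (L i) k \<subseteq> (\<Union>j \<in> S. w j)"
    and p: "trading_path w (trading_graph L w i {a} S) i p"
  defines "w' \<equiv> trade_along pr (wanted L w i {a}) w p"
  shows "alloc_inv n1 n2 L (insert i S) w'"
    and "\<And>j. j \<in> S \<Longrightarrow> own_rank n2 L w' j = own_rank n2 L w j"
    and "own_rank n2 L w' i = k"
proof -
  obtain n ob where sh: "shifted w p n ob w'" and p0: "p ! 0 = i" and lab: "labelled w (p ! n)"
    and ob1: "ob 1 = a" and pS: "\<And>s. 1 \<le> s \<Longrightarrow> s \<le> n \<Longrightarrow> p ! s \<in> S"
    and wt: "\<And>s. s < n \<Longrightarrow> ob (Suc s) \<in> wanted L w i {a} (p ! s)"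
    using trade_shifted[OF p, of pr] unfolding w'_def by blast
  note shd = sh[unfolded shifted_def]
  have w'i: "w' i = {a}" using shd p0 ob1 by force
  then show ri: "own_rank n2 L w' i = k"
    using first_class_eq[OF i_pref, of "{a}" k] a by simp
  have setp: "set p \<subseteq> insert i S"
  proof
    fix x assume "x \<in> set p"
    then obtain s where "s \<le> n" "x = p ! s" using shd by (metis in_set_conv_nth less_Suc_eq_le)
    then show "x \<in> insert i S" using pS[of s] p0 by (cases s) auto
  qed
  have U: "(\<Union>j \<in> insert i S. w' j) = (\<Union>j \<in> S. w j)"
    using shifted_union[OF sh inv_disj setp] wi by simp
  have main: "w' j \<subseteq> nth_class (L j) (own_rank n2 L w j) \<and> (w j \<noteq> {} \<longrightarrow> w' j \<noteq> {}) \<and> (w j = {} \<longrightarrow> w' j = {})"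
    if j: "j \<in> S" for j
  proof (cases "j \<in> set p")
    case False
    then show ?thesis using shd inv_class by auto
  next
    case True
    then obtain s where s: "s \<le> n" "j = p ! s" using shd by (metis in_set_conv_nth less_Suc_eq_le)
    have s1: "1 \<le> s" using s j p0 i by (cases s) auto
    have ne: "w j \<noteq> {}" using shifted_old[OF sh s1 s(1)] s by auto
    show ?thesis
    proof (cases "s = n")
      case True
      \<comment> \<open>The last agent is labelled, so he owns at least two objects and does not
        lose his rank by giving one away.\<close>
      have "w j - {ob n} \<noteq> {}"
        using lab s True unfolding labelled_def
        by (metis Diff_eq_empty_iff card_mono finite.emptyI finite.insertI is_singletonI
            is_singleton_altdef linorder_not_le)
      then show ?thesis using shd s True inv_class ne by auto
    next
      case False
      then have "w' j = {ob (Suc s)}" "s < n" using shd s by auto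
      moreover have "j \<noteq> i" using i j by auto
      ultimately show ?thesis using wt[of s] wanted_other[OF j _ ne, of i] s ne by auto
    qed
  qed
  show rk: "own_rank n2 L w' j = own_rank n2 L w j" if "j \<in> S" for j
    using main[OF that] first_class_eq[OF inv_pref[OF that], of "w' j"] by (cases "w' j = {}") auto
  show "alloc_inv n1 n2 L (insert i S) w'"
    unfolding alloc_inv_def U
  proof (intro conjI ballI allI impI)
    show "insert i S \<subseteq> {..<n1}" using inv_S i by auto
    show "w' j = {}" if "j \<notin> insert i S" for j using that setp shd inv_out by auto
    show "w' x \<inter> w' y = {}" if "x \<noteq> y" for x y
      using shifted_disjoint[OF sh inv_disj that] .
    show "w' j \<subseteq> nth_class (L j) (own_rank n2 L w' j)" if "j \<in> insert i S" for j
      using that main[of j] rk[of j] ri w'i a by (cases "j = i") auto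
    show "nth_class (L j) (own_rank n2 L w' j) \<subseteq> (\<Union>j \<in> S. w j)" if "j \<in> insert i S" for j
      using that rk[of j] ri covered inv_covered[of j] by (cases "j = i") auto
  qed
qed

text \<open>Class \<open>k\<close> becomes covered because its objects were either allocated before
  or are free and now all taken by \<open>i\<close>. If no acceptable object is free, then
  \<open>k = n2 + 1\<close> and \<open>i\<close> takes the empty set.\<close>

lemma take_inv:
  defines "free \<equiv> {..<n2} - (\<Union>j \<in> S. w j)"
  defines "k \<equiv> first_class n2 (L i) free"
  defines "w' \<equiv> w(i := free \<inter> nth_class (L i) k)"
  shows "alloc_inv n1 n2 L (insert i S) w'"
    and "\<And>j. j \<in> S \<Longrightarrow> own_rank n2 L w' j = own_rank n2 L w j"
    and "own_rank n2 L w' i = k"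
proof -
  show rk: "own_rank n2 L w' j = own_rank n2 L w j" if "j \<in> S" for j
    using that i by (auto simp: w'_def)
  show ri: "own_rank n2 L w' i = k"
  proof (cases "free \<inter> acceptable (L i) = {}")
    case True
    then have "k = n2 + 1" unfolding k_def by (rule first_class_none)
    moreover from this have "w' i = {}" using nth_class_beyond[OF i_pref] by (simp add: w'_def)
    ultimately show ?thesis by (simp add: first_class_none)
  next
    case False
    then have "w' i \<noteq> {}" using first_class_witness[OF False, of n2] by (auto simp: w'_def k_def)
    then show ?thesis using first_class_eq[OF i_pref, of "w' i" k] by (simp add: w'_def)
  qed
  have wij: "w' i \<inter> w j = {}" for j
    using inv_out[of j] by (cases "j \<in> S") (auto simp: w'_def free_def)
  have U: "(\<Union>j \<in> insert i S. w' j) = (\<Union>j \<in> S. w j) \<union> w' i"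
    using i by (auto simp: w'_def split: if_splits)
  show "alloc_inv n1 n2 L (insert i S) w'"
    unfolding alloc_inv_def U
  proof (intro conjI ballI allI impI)
    show "insert i S \<subseteq> {..<n1}" using inv_S i by auto
    show "w' j = {}" if "j \<notin> insert i S" for j using that inv_out by (simp add: w'_def)
    show "w' x \<inter> w' y = {}" if "x \<noteq> y" for x y
    proof -
      have "x \<noteq> i \<Longrightarrow> w' x = w x" "y \<noteq> i \<Longrightarrow> w' y = w y" by (simp_all add: w'_def)
      then show ?thesis using wij[of x] wij[of y] inv_disj that
        by (cases "x = i"; cases "y = i") auto
    qed
    show "w' j \<subseteq> nth_class (L j) (own_rank n2 L w' j)" if "j \<in> insert i S" for j
      using that inv_class[of j] rk ri i by (cases "j = i") (auto simp: w'_def)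
    show "nth_class (L j) (own_rank n2 L w' j) \<subseteq> (\<Union>j \<in> S. w j) \<union> w' i"
      if "j \<in> insert i S" for j
    proof (cases "j = i")
      case True
      then show ?thesis using ri nth_class_bound[OF i_pref, of k] by (auto simp: w'_def free_def)
    next
      case False
      then show ?thesis using that rk inv_covered by auto
    qed
  qed
qed

end

end


section \<open>One step of the mechanism\<close>

lemma max_TG_cases:
  assumes "valid_pref n2 (L i)"
  shows "(max_TG n2 pr L w i S = None \<and> obtainable L w i S = {}) \<or>
    (\<exists>a k. max_TG n2 pr L w i S = Some a \<and> a \<in> obtainable L w i S \<and> a \<in> nth_class (L i) k \<and>
      k = first_class n2 (L i) (obtainable L w i S) \<and> rank n2 (L i) a = k)"
proof (cases "obtainable L w i S = {}")
  case False
  let ?H = "obtainable L w i S"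
  let ?k = "first_class n2 (L i) ?H"
  let ?a = "highest pr (?H \<inter> nth_class (L i) ?k)"
  have "?H \<subseteq> acceptable (L i)" by (auto simp: obtainable_def)
  then have "nth_class (L i) ?k \<inter> ?H \<noteq> {}" using False by (intro first_class_witness) auto
  then have "?a \<in> ?H \<inter> nth_class (L i) ?k" by (intro highest_in) auto
  then show ?thesis using False rank_eq[OF assms] by (auto simp: max_TG_def Let_def)
qed (simp add: max_TG_def)

text \<open>The smaller of the two indices compared by the mechanism; by \<open>step_inv\<close> it
  is the rank that \<open>i\<close> receives.\<close>

definition best_rank ::
    "nat \<Rightarrow> profile \<Rightarrow> ownership \<Rightarrow> nat \<Rightarrow> nat set \<Rightarrow> nat" where
  "best_rank n2 L w i S =
     min (first_class n2 (L i) ({..<n2} - (\<Union>j \<in> S. w j))) (first_class n2 (L i) (obtainable L w i S))"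

context
  fixes n1 n2 L S w i
  assumes L: "valid_profile n1 n2 L" and inv: "alloc_inv n1 n2 L S w"
    and i: "i \<notin> S" "i < n1"
begin

text \<open>In the trading case the first class with a free object lies beyond \<open>k\<close>, so
  every object of class \<open>k\<close> is allocated. This is the covering premise of
  \<open>trade_inv\<close>.\<close>

lemma step_cases:
  assumes "path_rule sel" "sdmt2_step n2 pr sel L i (S, w) = (S', w')"
  defines "free \<equiv> {..<n2} - (\<Union>j \<in> S. w j)"
  defines "k \<equiv> best_rank n2 L w i S"
  shows "S' = insert i S"
    and "(k = first_class n2 (L i) free \<and> w' = w(i := free \<inter> nth_class (L i) k)) \<or>
    (\<exists>a p. max_TG n2 pr L w i S = Some a \<and> a \<in> nth_class (L i) k \<and>
      nth_class (L i) k \<subseteq> (\<Union>j \<in> S. w j) \<and> p = sel w (trading_graph L w i {a} S) i \<and>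
      trading_path w (trading_graph L w i {a} S) i p \<and>
      w' = trade_along pr (wanted L w i {a}) w p)"
proof -
  let ?j1 = "first_class n2 (L i) free"
  let ?m = "max_TG n2 pr L w i S"
  define j2 where "j2 = (case ?m of None \<Rightarrow> n2 + 1 | Some a \<Rightarrow> rank n2 (L i) a)"
  note Li = i_pref[OF L inv i]
  have st: "S' = insert i S"
    "w' = (if ?j1 \<le> j2 then w(i := free \<inter> nth_class (L i) ?j1)
           else trading pr sel L w i (the ?m) S)"
    using assms(2) unfolding sdmt2_step_def free_def j2_def by (auto simp: Let_def)
  show "S' = insert i S" by (rule st)
  have j2: "j2 = first_class n2 (L i) (obtainable L w i S)"
    using max_TG_cases[of n2 L i pr w S, OF Li] by (auto simp: j2_def first_class_none)
  have k: "k = min ?j1 j2" by (simp add: k_def best_rank_def free_def j2)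
  show "(k = ?j1 \<and> w' = w(i := free \<inter> nth_class (L i) k)) \<or>
    (\<exists>a p. ?m = Some a \<and> a \<in> nth_class (L i) k \<and>
      nth_class (L i) k \<subseteq> (\<Union>j \<in> S. w j) \<and> p = sel w (trading_graph L w i {a} S) i \<and>
      trading_path w (trading_graph L w i {a} S) i p \<and>
      w' = trade_along pr (wanted L w i {a}) w p)"
  proof (cases "?j1 \<le> j2")
    case True then show ?thesis using st k by (simp add: min_def)
  next
    case False
    then have kj: "k = j2" "k < ?j1" using k by auto
    \<comment> \<open>The index \<open>?j1\<close> never exceeds \<open>n2 + 1\<close>, so in this
      branch \<open>j2\<close> is not the default value and \<open>max_TG\<close> is
      defined.\<close>
    have "j2 \<noteq> n2 + 1" using False first_class_bound[OF Li, of free] by linarith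
    then obtain a where a: "?m = Some a" "a \<in> obtainable L w i S" "a \<in> nth_class (L i) k"
      using max_TG_cases[of n2 L i pr w S, OF Li] kj j2 by (auto simp: j2_def)
    have "nth_class (L i) k \<subseteq> (\<Union>j \<in> S. w j)"
      using nth_class_bound[OF Li, of k] first_class_le[of _ free "L i" k n2] kj(2)
      by (fastforce simp: free_def)
    then show ?thesis
      using a obtainable_path[OF L inv i a(2) assms(1)] st False by (auto simp: trading_def)
  qed
qed

lemma step_inv:
  assumes "path_rule sel" "sdmt2_step n2 pr sel L i (S, w) = (S', w')"
  shows "S' = insert i S" "alloc_inv n1 n2 L S' w'"
    "\<And>j. j \<in> S \<Longrightarrow> own_rank n2 L w' j = own_rank n2 L w j"
    "own_rank n2 L w' i = best_rank n2 L w i S"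
proof -
  note c = step_cases[OF assms]
  show S': "S' = insert i S" by (rule c)
  from c(2) have "alloc_inv n1 n2 L S' w' \<and> (\<forall>j \<in> S. own_rank n2 L w' j = own_rank n2 L w j) \<and>
    own_rank n2 L w' i = best_rank n2 L w i S"
  proof (elim disjE exE conjE)
    assume *: "best_rank n2 L w i S = first_class n2 (L i) ({..<n2} - (\<Union>j \<in> S. w j))"
      "w' = w(i := ({..<n2} - (\<Union>j \<in> S. w j)) \<inter> nth_class (L i) (best_rank n2 L w i S))"
    show ?thesis unfolding S' using take_inv[OF L inv i] *(2) unfolding *(1) by simp
  next
    fix a p
    assume *: "a \<in> nth_class (L i) (best_rank n2 L w i S)"
      "nth_class (L i) (best_rank n2 L w i S) \<subseteq> (\<Union>j \<in> S. w j)"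
      "trading_path w (trading_graph L w i {a} S) i p"
      "w' = trade_along pr (wanted L w i {a}) w p"
    show ?thesis unfolding S' using trade_inv[OF L inv i *(1-3), where pr = pr] *(4) by simp
  qed
  then show "alloc_inv n1 n2 L S' w'" "\<And>j. j \<in> S \<Longrightarrow> own_rank n2 L w' j = own_rank n2 L w j"
    "own_rank n2 L w' i = best_rank n2 L w i S" by auto
qed

text \<open>
  If \<open>\<mu>\<close> gave \<open>i\<close> a better object while everybody in \<open>S\<close> keeps his rank, then \<open>\<mu>\<close> would map \<open>i\<close> and
  the agents reachable from \<open>i\<close> injectively to the objects owned by the latter. None of these agents
  being labelled, there are too few such objects.
\<close>

lemma best_rank_minimal:
  assumes mu: "matching n1 n2 L \<mu>"
    and eq: "\<And>j. j \<in> S \<Longrightarrow> outcome_rank n2 (L j) \<mu> j = own_rank n2 L w j"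
  shows "best_rank n2 L w i S \<le> outcome_rank n2 (L i) \<mu> i"
proof (rule ccontr)
  let ?free = "{..<n2} - (\<Union>j \<in> S. w j)"
  note Li = i_pref[OF L inv i]
  assume neg: "\<not> ?thesis"
  have "best_rank n2 L w i S \<le> n2 + 1"
    using first_class_bound[OF Li] unfolding best_rank_def by (meson min.coboundedI1)
  then obtain a where a: "(i, a) \<in> \<mu>"
    using neg outcome_rank_unmatched[of i \<mu> n2 "L i"] by (metis)
  have acc: "a < n2" "a \<in> acceptable (L i)" using mu a unfolding matching_def by auto
  then obtain k where k: "a \<in> nth_class (L i) k" using acceptable_iff by blast
  have lt: "k < first_class n2 (L i) ?free" "k < first_class n2 (L i) (obtainable L w i S)"
    using neg outcome_rank_eq[OF mu a] rank_eq[OF Li k] by (auto simp: best_rank_def)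
  \<comment> \<open>Being better than the best free class and the best obtainable class,
    \<open>a\<close> belongs to neither set; hence it is owned, but its owner leads to no labelled
    agent.\<close>
  have "a \<notin> ?free" "a \<notin> obtainable L w i S"
    using lt first_class_le[OF _ k, of _ n2] by (meson linorder_not_le)+
  then obtain y where y: "y \<in> S" "a \<in> w y" using acc by auto
  define E where "E = trading_graph L w i {a} S"
  define R where "R = {y. (i, y) \<in> E\<^sup>+}"
  have iy: "y \<in> R"
    unfolding R_def E_def using y
    by (auto intro!: r_into_trancl trading_graph.source simp: wanted_def)
  have R: "x \<in> S \<and> \<not> labelled w x \<and> w x \<noteq> {} \<and> (\<exists>u. (u, x) \<in> E)" if "x \<in> R" for x
  proof -
    have "(i, x) \<in> E\<^sup>+" using that by (simp add: R_def)
    then obtain u where u: "(u, x) \<in> E" by (meson tranclD2)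
    have "\<not> labelled w x"
      using \<open>a \<notin> obtainable L w i S\<close> acc(2) \<open>(i, x) \<in> E\<^sup>+\<close> unfolding obtainable_def E_def by auto
    then show ?thesis using u trading_graph_edge[OF L inv i, of u x] unfolding E_def by blast
  qed
  have finR: "finite R" using R inv_S[OF L inv] by (meson finite_lessThan finite_subset subsetI)
  define U where "U = (\<Union>j \<in> R. w j)"
  have "card U \<le> (\<Sum>j \<in> R. card (w j))" unfolding U_def by (rule card_UN_le[OF finR])
  also have "\<dots> \<le> (\<Sum>j \<in> R. 1)"
    by (intro sum_mono) (use R in \<open>auto simp: labelled_def not_less\<close>)
  finally have cU: "card U \<le> card R" by simp
  have finU: "finite U" unfolding U_def using finR inv_finite[OF L inv] by blast
  \<comment> \<open>Each agent in \<open>R\<close> owns objects, so he has a rank of at most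
    \<open>n2\<close>, and \<open>\<mu>\<close> must give him an object of the same class; that
    class is covered.\<close>
  have ex: "\<exists>c. (x, c) \<in> \<mu> \<and> c \<in> U" if "x \<in> insert i R" for x
  proof (cases "x = i")
    case True then show ?thesis using a y iy by (auto simp: U_def)
  next
    case False
    then have x: "x \<in> R" using that by simp
    note Rx = R[OF x]
    have Lx: "valid_pref n2 (L x)" using inv_pref[OF L inv] Rx by blast
    have "w x \<inter> acceptable (L x) \<noteq> {}"
      using Rx inv_class[OF L inv, of x] acceptable_iff by fastforce
    then have le: "own_rank n2 L w x \<le> n2" by (rule first_class_acceptable[OF Lx])
    then obtain c where c: "(x, c) \<in> \<mu>"
      using eq[of x] Rx outcome_rank_unmatched[of x \<mu> n2 "L x"] by fastforce
    have "rank n2 (L x) c = own_rank n2 L w x" using outcome_rank_eq[OF mu c, of "L x"] eq[of x] Rx by simp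
    then have cc: "c \<in> nth_class (L x) (own_rank n2 L w x)"
      using nth_class_rank[OF Lx, of c] le by simp
    then obtain z where z: "z \<in> S" "c \<in> w z" using inv_covered[OF L inv, of x] Rx by auto
    \<comment> \<open>Closure of \<open>R\<close>: an object in the class of \<open>x\<close> is his
      own or wanted by him, and \<open>x\<close> is unlabelled, so he points to its owner.\<close>
    have "z \<in> R"
    proof (cases "c \<in> w x")
      case True
      then show ?thesis using z x inv_disj[OF L inv] by (metis disjoint_iff)
    next
      case False
      then have "c \<in> wanted L w i {a} x"
        using wanted_other[OF L inv, of x i] Rx i cc by auto
      then have "(x, z) \<in> E"
        using Rx z unfolding E_def by (blast intro: trading_graph.forward)
      then show ?thesis using x unfolding R_def by auto
    qed
    then show ?thesis using c z by (auto simp: U_def)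
  qed
  define f where "f x = (SOME c. (x, c) \<in> \<mu> \<and> c \<in> U)" for x
  have f: "(x, f x) \<in> \<mu> \<and> f x \<in> U" if "x \<in> insert i R" for x
    unfolding f_def by (rule someI_ex[OF ex[OF that]])
  have "inj_on f (insert i R)"
  proof (rule inj_onI)
    fix x y assume "x \<in> insert i R" "y \<in> insert i R" "f x = f y"
    then show "x = y" using f[of x] f[of y] mu unfolding matching_def by metis
  qed
  then have "card (insert i R) \<le> card U"
    using f finU by (intro card_inj_on_le[of f]) auto
  moreover have "i \<notin> R" using R i by blast
  ultimately show False using cU finR by simp
qed

end


section \<open>Pareto optimality and truthfulness\<close>

abbreviation run_sdmt2 ::
    "nat \<Rightarrow> (nat \<Rightarrow> nat) \<Rightarrow> path_rule \<Rightarrow> profile \<Rightarrow> nat list \<Rightarrow> nat set \<times> ownership" where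
  "run_sdmt2 n2 pr sel L \<sigma> \<equiv> fold (sdmt2_step n2 pr sel L) \<sigma> ({}, \<lambda>_. {})"

context
  fixes n1 n2 :: nat and L :: profile and pr :: "nat \<Rightarrow> nat" and sel :: path_rule
  assumes L: "valid_profile n1 n2 L" and sel: "path_rule sel"
begin

lemma run_inv:
  assumes "distinct \<tau>" "set \<tau> \<subseteq> {..<n1}" "run_sdmt2 n2 pr sel L \<tau> = (S, w)"
  shows "S = set \<tau> \<and> alloc_inv n1 n2 L S w"
  using assms
proof (induction \<tau> arbitrary: S w rule: rev_induct)
  case Nil then show ?case by (auto simp: alloc_inv_def)
next
  case (snoc i \<tau>)
  obtain S0 w0 where r: "run_sdmt2 n2 pr sel L \<tau> = (S0, w0)" by fastforce
  then have "S0 = set \<tau>" "alloc_inv n1 n2 L S0 w0" using snoc by auto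
  then show ?case using step_inv(1,2)[OF L, of S0 w0 i sel pr S w] snoc.prems r sel by auto
qed

lemma run_rank_preserved:
  assumes "distinct (\<tau> @ \<tau>')" "set (\<tau> @ \<tau>') \<subseteq> {..<n1}"
    "run_sdmt2 n2 pr sel L \<tau> = (S, w)" "run_sdmt2 n2 pr sel L (\<tau> @ \<tau>') = (S', w')" "j \<in> S"
  shows "own_rank n2 L w' j = own_rank n2 L w j"
  using assms
proof (induction \<tau>' arbitrary: S' w' rule: rev_induct)
  case (snoc i \<tau>')
  obtain S0 w0 where r: "run_sdmt2 n2 pr sel L (\<tau> @ \<tau>') = (S0, w0)" by fastforce
  have *: "S0 = set (\<tau> @ \<tau>') \<and> alloc_inv n1 n2 L S0 w0" "S = set \<tau>"
    using run_inv[OF _ _ r] run_inv[OF _ _ snoc.prems(3)] snoc.prems by auto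
  have st: "sdmt2_step n2 pr sel L i (S0, w0) = (S', w')" using snoc.prems(4) r by simp
  have i: "i \<notin> S0" "i < n1" using snoc.prems * by auto
  have "own_rank n2 L w' j = own_rank n2 L w0 j"
    by (rule step_inv(3)[OF L conjunct2[OF *(1)] i sel st]) (use * snoc.prems in simp)
  then show ?case using snoc.IH[OF _ _ snoc.prems(3) r snoc.prems(5)] snoc.prems by auto
qed simp

text \<open>The predecessors of an agent keep their ranks exactly by the induction hypothesis; this
  is what \<open>best_rank_minimal\<close> requires to give the reverse inequality for the agent
  himself.\<close>

lemma run_optimal:
  assumes "distinct \<tau>" "set \<tau> \<subseteq> {..<n1}" "run_sdmt2 n2 pr sel L \<tau> = (S, w)"
    and "matching n1 n2 L \<mu>"
    and "\<And>j. j \<in> S \<Longrightarrow> outcome_rank n2 (L j) \<mu> j \<le> own_rank n2 L w j"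
    and "j \<in> S"
  shows "outcome_rank n2 (L j) \<mu> j = own_rank n2 L w j"
  using assms
proof (induction \<tau> arbitrary: S w j rule: rev_induct)
  case (snoc i \<tau>)
  obtain S0 w0 where r: "run_sdmt2 n2 pr sel L \<tau> = (S0, w0)" by fastforce
  then have inv: "S0 = set \<tau>" "alloc_inv n1 n2 L S0 w0" using run_inv[OF _ _ r] snoc.prems by auto
  have i: "i \<notin> S0" "i < n1" using snoc.prems inv by auto
  have st: "sdmt2_step n2 pr sel L i (S0, w0) = (S, w)" using snoc.prems(3) r by simp
  note step = step_inv[OF L inv(2) i sel st]
  have le: "outcome_rank n2 (L j) \<mu> j \<le> own_rank n2 L w0 j" if "j \<in> S0" for j
    using snoc.prems(5)[of j] step(1,3) that by simp
  then have eq: "outcome_rank n2 (L j) \<mu> j = own_rank n2 L w0 j" if "j \<in> S0" for j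
    using snoc.IH[OF _ _ r snoc.prems(4) le that] snoc.prems by simp
  show ?case
  proof (cases "j = i")
    case True
    then show ?thesis
      using best_rank_minimal[OF L inv(2) i snoc.prems(4) eq] step(1,4) snoc.prems(5)[of i]
      by (simp add: order_antisym)
  next
    case False
    then show ?thesis using eq[of j] step(1,3) snoc.prems(6) by simp
  qed
qed simp

context
  fixes \<sigma>
  assumes \<sigma>: "agent_order n1 \<sigma>"
begin

lemma final_inv: "alloc_inv n1 n2 L {..<n1} (sdmt2_ownership n2 pr sel L \<sigma>)"
  using run_inv[of \<sigma>] \<sigma> unfolding sdmt2_ownership_def agent_order_def
  by (metis order_refl prod.collapse)

lemma sdmt2_matching: "matching n1 n2 L (sdmt2 n1 n2 \<sigma> pr sel L)"
proof -
  define w where "w = sdmt2_ownership n2 pr sel L \<sigma>"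
  note inv = final_inv[folded w_def]
  have h: "highest pr (w j) \<in> w j" if "w j \<noteq> {}" for j using highest_in that by blast
  have "i = j" if "w i \<noteq> {}" "w j \<noteq> {}" "highest pr (w i) = highest pr (w j)" for i j
    using h[of i] h[of j] that inv_disj[OF L inv] by (metis disjoint_iff)
  moreover have "highest pr (w j) < n2" "highest pr (w j) \<in> acceptable (L j)"
    if "w j \<noteq> {}" for j
    using h[OF that] inv_bound[OF L inv, of j] inv_class[OF L inv, of j] acceptable_iff by blast+
  ultimately show ?thesis
    unfolding matching_def sdmt2_def w_def[symmetric] Let_def by auto
qed

text \<open>All objects owned by an agent lie in one class, so the final choice among them does not
  influence his rank.\<close>

lemma sdmt2_outcome:
  assumes "j < n1"
  shows "outcome_rank n2 (L j) (sdmt2 n1 n2 \<sigma> pr sel L) j =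
    own_rank n2 L (sdmt2_ownership n2 pr sel L \<sigma>) j"
proof -
  define w where "w = sdmt2_ownership n2 pr sel L \<sigma>"
  note inv = final_inv[folded w_def]
  let ?mu = "sdmt2 n1 n2 \<sigma> pr sel L"
  have mem: "(j, a) \<in> ?mu \<longleftrightarrow> w j \<noteq> {} \<and> a = highest pr (w j)" for a
    using assms by (simp add: sdmt2_def Let_def w_def)
  show ?thesis
  proof (cases "w j = {}")
    case True
    then show ?thesis
      using outcome_rank_unmatched[of j ?mu] mem by (simp add: w_def[symmetric] first_class_none)
  next
    case False
    have "highest pr (w j) \<in> nth_class (L j) (own_rank n2 L w j)"
      using highest_in[OF False] inv_class[OF L inv] by blast
    then show ?thesis
      using outcome_rank_eq[OF sdmt2_matching] mem False rank_eq inv_pref[OF L inv] assms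
      by (metis lessThan_iff w_def)
  qed
qed

lemma sdmt2_pareto_optimal: "pareto_optimal n1 n2 L (sdmt2 n1 n2 \<sigma> pr sel L)"
  unfolding pareto_optimal_def
proof (intro conjI notI; (elim exE conjE)?)
  show "matching n1 n2 L (sdmt2 n1 n2 \<sigma> pr sel L)" by (rule sdmt2_matching)
  fix \<mu> i
  assume mu: "matching n1 n2 L \<mu>"
    "\<forall>i < n1. outcome_rank n2 (L i) \<mu> i \<le> outcome_rank n2 (L i) (sdmt2 n1 n2 \<sigma> pr sel L) i"
    "i < n1" "outcome_rank n2 (L i) \<mu> i < outcome_rank n2 (L i) (sdmt2 n1 n2 \<sigma> pr sel L) i"
  define w where "w = sdmt2_ownership n2 pr sel L \<sigma>"
  obtain S where r: "run_sdmt2 n2 pr sel L \<sigma> = (S, w)"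
    unfolding w_def sdmt2_ownership_def by (metis prod.collapse)
  have S: "S = {..<n1}" using run_inv[OF _ _ r] \<sigma> by (auto simp: agent_order_def)
  have "outcome_rank n2 (L i) \<mu> i = own_rank n2 L w i"
    using run_optimal[OF _ _ r mu(1), of i] \<sigma> mu sdmt2_outcome unfolding S w_def
    by (auto simp: agent_order_def)
  then show False using mu sdmt2_outcome[of i] by (simp add: w_def)
qed

end

end

section \<open>Independence of a step from the lists of agents not yet processed\<close>

lemma trading_graph_cong:
  assumes "\<And>x. x \<in> insert i S \<Longrightarrow> L x = L' x"
  shows "trading_graph L w i B S = trading_graph L' w i B S"
proof -
  have sub: "trading_graph L w i B S \<subseteq> trading_graph L' w i B S"
    if eq: "\<And>x. x \<in> insert i S \<Longrightarrow> L x = L' x" for L L'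
  proof (rule subrelI)
    fix x y assume "(x, y) \<in> trading_graph L w i B S"
    \<comment> \<open>The conjunct \<open>y \<in> S\<close> is carried along so that in the case
      \<open>forward\<close> the vertex \<open>x\<close> is known to lie in \<open>S\<close>, where
      the profiles agree.\<close>
    then have "(x, y) \<in> trading_graph L' w i B S \<and> y \<in> S"
    proof induction
      case (source y)
      have "wanted L' w i B i = wanted L w i B i" by (simp add: wanted_def)
      then show ?case using source trading_graph.source[of y S w L' i B] by simp
    next
      case (forward u x y)
      then have "wanted L w i B x = wanted L' w i B x" using eq by (auto simp: wanted_def)
      then show ?case using forward by (auto intro: trading_graph.forward)
    qed
    then show "(x, y) \<in> trading_graph L' w i B S" by simp
  qed
  show ?thesis using sub[of L L'] sub[of L' L] assms by (metis subset_antisym)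
qed

text \<open>The trading graphs coincide, hence so do the paths chosen by \<open>sel\<close>. The
  functions \<open>wanted\<close> may still differ at unprocessed agents, but
  \<open>trade_along\<close> consults them only at the last but one agent of the path, who belongs
  to \<open>insert i S\<close>.\<close>

lemma sdmt2_step_cong:
  assumes L: "valid_profile n1 n2 L" and inv: "alloc_inv n1 n2 L S w" and i: "i \<notin> S" "i < n1"
    and sel: "path_rule sel" and eq: "\<And>x. x \<in> insert i S \<Longrightarrow> L x = L' x"
  shows "sdmt2_step n2 pr sel L i (S, w) = sdmt2_step n2 pr sel L' i (S, w)"
proof -
  have g: "trading_graph L' w i B S = trading_graph L w i B S" for B
    using trading_graph_cong[of i S L L' w B] eq by simp
  have Li: "L' i = L i" using eq by simp
  have o: "obtainable L' w i S = obtainable L w i S" by (simp add: obtainable_def g Li)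
  have m: "max_TG n2 pr L' w i S = max_TG n2 pr L w i S" by (simp add: max_TG_def o Li Let_def)
  have t: "trading pr sel L' w i a S = trading pr sel L w i a S" if "a \<in> obtainable L w i S" for a
  proof -
    let ?p = "sel w (trading_graph L w i {a} S) i"
    have p: "trading_path w (trading_graph L w i {a} S) i ?p"
      by (rule obtainable_path[OF L inv i that sel])
    obtain n where n: "length ?p = Suc (Suc n)"
      using p unfolding trading_path_def by (metis Suc_pred add_2_eq_Suc le_add_diff_inverse)
    have "(?p ! n, ?p ! Suc n) \<in> trading_graph L w i {a} S"
      using p n unfolding trading_path_def successively_conv_nth by simp
    then have "?p ! n \<in> insert i S" using trading_graph_edge[OF L inv i] by blast
    then have wt: "wanted L' w i {a} (?p ! n) = wanted L w i {a} (?p ! n)"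
      using eq[of "?p ! n"] by (simp add: wanted_def)
    have d: "distinct ?p" using p by (simp add: trading_path_def)
    have "trade_along pr (wanted L' w i {a}) w ?p j = trade_along pr (wanted L w i {a}) w ?p j" for j
    proof (cases "j \<in> set ?p")
      case False
      then show ?thesis
        using trade_along_nth[OF d n refl, of pr "wanted L w i {a}" w]
          trade_along_nth[OF d n refl, of pr "wanted L' w i {a}" w] by simp
    next
      case True
      then obtain s where "s < length ?p" "j = ?p ! s" by (metis in_set_conv_nth)
      then consider "j = ?p ! s" "s < n" | "j = ?p ! n" | "j = ?p ! Suc n"
        by (metis less_Suc_eq n)
      then show ?thesis
        using trade_along_nth[OF d n refl, of pr "wanted L w i {a}" w]
          trade_along_nth[OF d n refl, of pr "wanted L' w i {a}" w] wt by cases auto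
    qed
    then show ?thesis by (auto simp: trading_def g)
  qed
  have "trading pr sel L' w i (the (max_TG n2 pr L w i S)) S =
    trading pr sel L w i (the (max_TG n2 pr L w i S)) S" if "max_TG n2 pr L w i S \<noteq> None"
    using max_TG_cases[of n2 L i pr w S, OF i_pref[OF L inv i]] t that by auto
  \<comment> \<open>If \<open>max_TG\<close> is \<open>None\<close>, this bound makes the first
    branch of the step apply, so the unspecified value of \<open>the None\<close> is never traded
    for.\<close>
  moreover have "first_class n2 (L i) A \<le> n2 + 1" for A
    by (rule first_class_bound[OF i_pref[OF L inv i]])
  ultimately show ?thesis
    unfolding sdmt2_step_def by (auto simp: Let_def m Li split: option.split)
qed

lemma run_sdmt2_cong:
  assumes "valid_profile n1 n2 L" "path_rule sel" "distinct \<tau>" "set \<tau> \<subseteq> {..<n1}"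
    "\<And>x. x \<in> set \<tau> \<Longrightarrow> L x = L' x"
  shows "run_sdmt2 n2 pr sel L \<tau> = run_sdmt2 n2 pr sel L' \<tau>"
  using assms(3-5)
proof (induction \<tau> rule: rev_induct)
  case (snoc i \<tau>)
  obtain S w where r: "run_sdmt2 n2 pr sel L \<tau> = (S, w)" by fastforce
  then have S: "S = set \<tau>" "alloc_inv n1 n2 L S w" using run_inv[OF assms(1,2) _ _ r] snoc by auto
  have "sdmt2_step n2 pr sel L i (S, w) = sdmt2_step n2 pr sel L' i (S, w)"
    using snoc.prems S by (intro sdmt2_step_cong[OF assms(1) S(2) _ _ assms(2)]) auto
  then show ?case using snoc r by simp
qed simp

text \<open>Both runs reach the same state \<open>(S, w)\<close> before \<open>i\<close> is
  processed. The outcome of the misreport gives the agents in \<open>S\<close> the ranks they have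
  in \<open>w\<close>, so \<open>best_rank_minimal\<close>, applied with the true list, shows that
  it cannot beat the rank obtained by an honest report.\<close>

lemma sdmt2_truthful:
  assumes sel: "path_rule sel" and \<sigma>: "agent_order n1 \<sigma>"
  shows "truthful n1 n2 (sdmt2 n1 n2 \<sigma> pr sel)"
  unfolding truthful_def
proof (intro allI impI, elim conjE)
  fix L i l'
  assume L: "valid_profile n1 n2 L" and i: "i < n1" and l': "valid_pref n2 l'"
  define L' where "L' = L(i := l')"
  have L': "valid_profile n1 n2 L'" using L l' by (simp add: valid_profile_def L'_def)
  have "i \<in> set \<sigma>" using i \<sigma> by (simp add: agent_order_def)
  then obtain \<tau> \<tau>' where \<tau>: "\<sigma> = (\<tau> @ [i]) @ \<tau>'" by (metis append_Cons append_Nil append_assoc split_list)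
  have d: "distinct ((\<tau> @ [i]) @ \<tau>')" "set ((\<tau> @ [i]) @ \<tau>') \<subseteq> {..<n1}"
    using \<sigma> \<tau> by (auto simp: agent_order_def)
  obtain S w where r: "run_sdmt2 n2 pr sel L \<tau> = (S, w)" by fastforce
  have inv: "S = set \<tau>" "alloc_inv n1 n2 L S w" using run_inv[OF L sel _ _ r] d by auto
  have iS: "i \<notin> S" using inv d by simp
  have r': "run_sdmt2 n2 pr sel L' \<tau> = (S, w)"
    using run_sdmt2_cong[OF L sel, of \<tau> L' pr] d r by (force simp: L'_def)
  obtain S1 w1 where st: "sdmt2_step n2 pr sel L i (S, w) = (S1, w1)" by fastforce
  then have r1: "run_sdmt2 n2 pr sel L (\<tau> @ [i]) = (S1, w1)" using r by simp
  note step = step_inv[OF L inv(2) iS i sel st]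
  define wf where "wf = sdmt2_ownership n2 pr sel L \<sigma>"
  define wf' where "wf' = sdmt2_ownership n2 pr sel L' \<sigma>"
  obtain Sf where rf: "run_sdmt2 n2 pr sel L ((\<tau> @ [i]) @ \<tau>') = (Sf, wf)"
    unfolding wf_def sdmt2_ownership_def \<tau> by (metis prod.collapse)
  obtain Sf' where rf': "run_sdmt2 n2 pr sel L' (\<tau> @ ([i] @ \<tau>')) = (Sf', wf')"
    unfolding wf'_def sdmt2_ownership_def \<tau> by (metis append_assoc prod.collapse)
  have "own_rank n2 L wf i = best_rank n2 L w i S"
    using run_rank_preserved[OF L sel d r1 rf, of i] step by simp
  then have true: "outcome_rank n2 (L i) (sdmt2 n1 n2 \<sigma> pr sel L) i = best_rank n2 L w i S"
    using sdmt2_outcome[OF L sel \<sigma> i, of pr] by (simp add: wf_def)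
  define \<mu>' where "\<mu>' = sdmt2 n1 n2 \<sigma> pr sel L'"
  have mu': "matching n1 n2 L' \<mu>'" unfolding \<mu>'_def by (rule sdmt2_matching[OF L' sel \<sigma>])
  \<comment> \<open>The outcome of the misreport, cut down to a matching for the true profile.\<close>
  define \<mu> where "\<mu> = {(j, a) \<in> \<mu>'. j \<noteq> i \<or> a \<in> acceptable (L i)}"
  have mu: "matching n1 n2 L \<mu>"
    unfolding matching_def
  proof (intro conjI)
    show "\<forall>(j, a) \<in> \<mu>. j < n1 \<and> a < n2 \<and> a \<in> acceptable (L j)"
      using mu' unfolding matching_def \<mu>_def L'_def by (auto split: if_splits)
  qed (use mu' in \<open>unfold matching_def \<mu>_def, blast+\<close>)
  have "outcome_rank n2 (L j) \<mu> j = own_rank n2 L w j" if j: "j \<in> S" for j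
  proof -
    have ji: "j \<noteq> i" "j < n1" using j iS inv_S[OF L inv(2)] by auto
    have "own_rank n2 L' wf' j = own_rank n2 L' w j"
      using run_rank_preserved[OF L' sel _ _ r' rf' j] d by simp
    then have "outcome_rank n2 (L' j) \<mu>' j = own_rank n2 L' w j"
      using sdmt2_outcome[OF L' sel \<sigma> ji(2), of pr] by (simp add: wf'_def \<mu>'_def)
    moreover have "outcome_rank n2 (L j) \<mu> j = outcome_rank n2 (L j) \<mu>' j"
      unfolding outcome_rank_def \<mu>_def using ji by simp
    ultimately show ?thesis using ji by (simp add: L'_def)
  qed
  then have "best_rank n2 L w i S \<le> outcome_rank n2 (L i) \<mu> i"
    by (rule best_rank_minimal[OF L inv(2) iS i mu])
  \<comment> \<open>Cutting down loses nothing in rank: an unacceptable object and no object both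
    have rank \<open>n2 + 1\<close>.\<close>
  also have "outcome_rank n2 (L i) \<mu> i = outcome_rank n2 (L i) \<mu>' i"
  proof (cases "\<exists>a. (i, a) \<in> \<mu>'")
    case False
    then show ?thesis by (simp add: outcome_rank_def \<mu>_def)
  next
    case True
    then obtain a where a: "(i, a) \<in> \<mu>'" by blast
    have u: "b = a" if "(i, b) \<in> \<mu>'" for b using a that mu' unfolding matching_def by blast
    show ?thesis
    proof (cases "a \<in> acceptable (L i)")
      case True
      then have "(i, a) \<in> \<mu>" using a by (simp add: \<mu>_def)
      then show ?thesis using outcome_rank_eq[OF mu] outcome_rank_eq[OF mu' a] by simp
    next
      case False
      then have "(i, b) \<notin> \<mu>" for b using u by (auto simp: \<mu>_def)
      then show ?thesis
        using outcome_rank_unmatched[of i \<mu>] outcome_rank_eq[OF mu' a] rank_unacceptable[OF False]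
        by simp
    qed
  qed
  finally show "outcome_rank n2 (L i) (sdmt2 n1 n2 \<sigma> pr sel L) i
    \<le> outcome_rank n2 (L i) (sdmt2 n1 n2 \<sigma> pr sel (L(i := l'))) i"
    using true by (simp add: \<mu>'_def L'_def)
qed


section \<open>Cost calculus, program and running time\<close>

section \<open>Symbolic execution\<close>

text \<open>Total correctness with the running time handed to the postcondition. The existential
  form is the one that \<open>implements_sdmt2\<close> asks for, and the equivalences for the
  loop-free constructs let the simplifier execute programs symbolically.\<close>

definition run :: "com \<Rightarrow> store \<Rightarrow> (nat \<Rightarrow> store \<Rightarrow> bool) \<Rightarrow> bool" where
  "run c s Q \<longleftrightarrow> (\<exists>t s'. exec c s t s' \<and> Q t s')"

inductive_cases exec_elims:
  "exec Skip s t s'" "exec (Assign x e f) s t s'" "exec (Seq c d) s t s'" "exec (Cond b c d) s t s'"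

lemma run_Skip [simp]: "run Skip s Q \<longleftrightarrow> Q 1 s"
  unfolding run_def by (metis exec.Skip exec_elims(1))

lemma run_Assign [simp]: "run (Assign x e f) s Q \<longleftrightarrow> Q 1 (s(x := (s x)(aval e s := aval f s)))"
  unfolding run_def by (metis exec.Assign exec_elims(2))

lemma run_Seq [simp]: "run (Seq c d) s Q \<longleftrightarrow> run c s (\<lambda>t s'. run d s' (\<lambda>t'. Q (t + t')))"
  unfolding run_def by (blast elim: exec_elims intro: exec.intros)

lemma run_Cond [simp]:
  "run (Cond b c d) s Q \<longleftrightarrow>
     (if bval b s then run c s (\<lambda>t. Q (1 + t)) else run d s (\<lambda>t. Q (1 + t)))"
proof -
  have "exec (Cond b c d) s t s' \<longleftrightarrow>
      (\<exists>t'. t = 1 + t' \<and> (if bval b s then exec c s t' s' else exec d s t' s'))" for t s'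
    using exec.CondTrue[unfolded plus_1_eq_Suc] exec.CondFalse[unfolded plus_1_eq_Suc]
    by (cases "bval b s") (auto elim: exec_elims(4))
  then show ?thesis unfolding run_def by auto
qed

lemma run_mono: "run c s P \<Longrightarrow> (\<And>t s'. P t s' \<Longrightarrow> Q t s') \<Longrightarrow> run c s Q"
  unfolding run_def by blast

text \<open>The invariant has the elapsed time as an argument, and a bound on that time doubles as
  termination measure: every iteration costs at least the unit for its test, so
  \<open>N - \<tau>\<close> decreases. The \<open>Suc\<close> in the result pays for the final
  failing test.\<close>

lemma run_while:
  assumes init: "I 0 s"
    and bound: "\<And>\<tau> s. I \<tau> s \<Longrightarrow> \<tau> \<le> N"
    and step: "\<And>\<tau> s. I \<tau> s \<Longrightarrow> bval b s \<Longrightarrow> run c s (\<lambda>t s'. I (\<tau> + t + 1) s')"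
  shows "run (While b c) s (\<lambda>t s'. \<exists>\<tau>. t = Suc \<tau> \<and> I \<tau> s' \<and> \<not> bval b s')"
proof -
  have "\<exists>t s'. exec (While b c) s (Suc t) s' \<and> I (\<tau> + t) s' \<and> \<not> bval b s'" if "I \<tau> s" for \<tau> s
    using that
  proof (induction "N - \<tau>" arbitrary: \<tau> s rule: less_induct)
    case less
    show ?case
    proof (cases "bval b s")
      case False
      then show ?thesis using less.prems exec.WhileFalse by (intro exI[of _ 0] exI[of _ s]) auto
    next
      case True
      then obtain t s1 where 1: "exec c s t s1" "I (\<tau> + t + 1) s1"
        using step[OF less.prems] unfolding run_def by blast
      have "N - (\<tau> + t + 1) < N - \<tau>" using bound[OF 1(2)] by simp
      from less.hyps[OF this 1(2)] obtain t' s' where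
        "exec (While b c) s1 (Suc t') s'" "I (\<tau> + t + 1 + t') s'" "\<not> bval b s'" by blast
      then have "exec (While b c) s (Suc (t + 1 + t')) s'" "I (\<tau> + (t + 1 + t')) s'"
        using exec.WhileTrue[OF True 1(1), of "Suc t'" s'] by (simp_all add: add.assoc)
      then show ?thesis using \<open>\<not> bval b s'\<close> by blast
    qed
  qed
  from this[OF init] show ?thesis unfolding run_def by force
qed

text \<open>Serves as a name for frames such as \<open>unchanged (writes visit)\<close>; the frame
  conditions themselves are carried through the loop invariants.\<close>

fun writes :: "com \<Rightarrow> string set" where
  "writes Skip = {}"
| "writes (Assign x e f) = {x}"
| "writes (Seq c d) = writes c \<union> writes d"
| "writes (Cond b c d) = writes c \<union> writes d"
| "writes (While b c) = writes c"

section \<open>An implementation\<close>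

abbreviation var :: "string \<Rightarrow> aexp" where "var x \<equiv> Cell x (Const 0)"

abbreviation set_var :: "string \<Rightarrow> aexp \<Rightarrow> com" where "set_var x \<equiv> Assign x (Const 0)"

abbreviation seq :: "com \<Rightarrow> com \<Rightarrow> com" (infixr ";;" 60) where "c ;; d \<equiv> Seq c d"

abbreviation Equal :: "aexp \<Rightarrow> aexp \<Rightarrow> bexp" where
  "Equal e f \<equiv> Conj (Neg (Less e f)) (Neg (Less f e))"

abbreviation inc :: "string \<Rightarrow> com" where "inc x \<equiv> set_var x (Add (var x) (Const 1))"

text \<open>The value of \<open>best\<close> is meaningful only if \<open>n\<close> is positive.
  With \<open>Y\<close> equal to \<open>X\<close> the count decides whether an agent is labelled;
  with \<open>X\<close> pointing to \<open>Y\<close> the search finds the object that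
  \<open>Y\<close> hands over.\<close>

definition find_step :: "string \<Rightarrow> string \<Rightarrow> com" where
  "find_step X Y =
     Cond (Equal (Cell ''owner'' (Cell ''obj'' (var ''v''))) (Add (var Y) (Const 1)))
       (Cond (Conj (Less (Const 0) (var ''n''))
               (Neg (Less (Cell ''pos'' (Cell ''obj'' (var ''v''))) (Cell ''pos'' (var ''best'')))))
          Skip (set_var ''best'' (Cell ''obj'' (var ''v''))) ;;
        inc ''n'')
       Skip ;;
     inc ''v''"

text \<open>
  The arrays \<open>start\<close> and \<open>end\<close> delimit the positions of the class from which an agent owns objects.
  During a search the range of the current agent is the single position of the object being tried, so
  that he is treated like the other agents. The results are the count \<open>n\<close> and the object \<open>best\<close>.
\<close>

definition find_best :: "string \<Rightarrow> string \<Rightarrow> com" where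
  "find_best X Y =
     set_var ''n'' (Const 0) ;; set_var ''v'' (Cell ''start'' (var X)) ;;
     While (Less (var ''v'') (Cell ''end'' (var X))) (find_step X Y)"

text \<open>The inner branch makes the path canonical: an agent discovered one level below
  \<open>x\<close> adopts \<open>x\<close> if that is a smaller parent. It may also overwrite the
  parent of an agent marked by an earlier search; this is harmless, as such an agent lies on no path
  to a labelled one.\<close>

definition relax :: com where
  "relax =
     set_var ''y'' (Sub (Cell ''owner'' (Cell ''obj'' (var ''u''))) (Const 1)) ;;
     Cond (Less (Cell ''mark'' (var ''y'')) (Add (var ''k'') (Const 1)))
       (Assign ''mark'' (var ''y'') (Add (var ''k'') (Const 1)) ;;
        Assign ''dist'' (var ''y'') (Add (Cell ''dist'' (var ''x'')) (Const 1)) ;;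
        Assign ''par'' (var ''y'') (var ''x'') ;;
        Assign ''queue'' (var ''t'') (var ''y'') ;;
        inc ''t'')
       (Cond (Conj (Equal (Cell ''dist'' (var ''y'')) (Add (Cell ''dist'' (var ''x'')) (Const 1)))
                   (Less (var ''x'') (Cell ''par'' (var ''y''))))
          (Assign ''par'' (var ''y'') (var ''x''))
          Skip)"

text \<open>\<open>z\<close> holds the least labelled agent found so far, shifted by one, so the
  guard \<open>z < x + 2\<close> says that this agent is at most \<open>x\<close>. Labelled agents
  are not expanded because they point to nobody.\<close>

definition visit :: com where
  "visit =
     set_var ''x'' (Cell ''queue'' (var ''h'')) ;; inc ''h'' ;; find_best ''x'' ''x'' ;;
     Cond (Less (Const 1) (var ''n''))
       (Cond (Conj (Less (Const 0) (var ''z'')) (Less (var ''z'') (Add (var ''x'') (Const 2))))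
          Skip (set_var ''z'' (Add (var ''x'') (Const 1))))
       (set_var ''u'' (Cell ''start'' (var ''x'')) ;;
        While (Less (var ''u'') (Cell ''end'' (var ''x''))) (relax ;; inc ''u''))"

text \<open>
  Marks are stamps: \<open>y\<close> has been visited on behalf of the current agent iff \<open>mark y = k + 1\<close>, where
  \<open>k\<close> counts the agents processed before. Hence marks need no reset between agents, and they survive
  from one search of an agent to the next.
\<close>

definition search :: com where
  "search =
     Assign ''start'' (var ''i'') (Sub (var ''c'') (Const 1)) ;;
     Assign ''end'' (var ''i'') (var ''c'') ;;
     Assign ''queue'' (Const 0) (var ''i'') ;; Assign ''dist'' (var ''i'') (Const 0) ;;
     set_var ''h'' (Const 0) ;; set_var ''t'' (Const 1) ;; set_var ''z'' (Const 0) ;;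
     While (Less (var ''h'') (var ''t'')) visit"

text \<open>The path is walked backwards from the labelled end. \<open>o\<close> is the object that
  \<open>y\<close> hands over; the object owned by \<open>x\<close> is looked up before
  \<open>owner\<close> is overwritten, since afterwards \<open>x\<close> would appear to own two. At
  \<open>x = i\<close> nothing is found and \<open>best\<close> is stale, but then the loop
  stops.\<close>

definition trade :: com where
  "trade =
     set_var ''y'' (Sub (var ''z'') (Const 1)) ;; set_var ''x'' (Cell ''par'' (var ''y'')) ;;
     find_best ''x'' ''y'' ;; set_var ''o'' (var ''best'') ;;
     While (Neg (Equal (var ''y'') (var ''i'')))
       (set_var ''x'' (Cell ''par'' (var ''y'')) ;; find_best ''x'' ''x'' ;;
        Assign ''owner'' (var ''o'') (Add (var ''x'') (Const 1)) ;;
        set_var ''o'' (var ''best'') ;; set_var ''y'' (var ''x''))"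

definition scan_class :: com where
  "scan_class =
     set_var ''q'' (var ''p'') ;; set_var ''f'' (Const 0) ;;
     While (Conj (Less (var ''q'') (var ''e''))
                 (Equal (Cell ''cls'' (var ''q'')) (Cell ''cls'' (var ''p''))))
       (Cond (Less (Const 0) (Cell ''owner'' (Cell ''obj'' (var ''q''))))
          Skip (set_var ''f'' (Const 1)) ;;
        inc ''q'')"

definition take_free :: com where
  "take_free =
     set_var ''u'' (var ''p'') ;;
     While (Less (var ''u'') (var ''q''))
       (Cond (Less (Const 0) (Cell ''owner'' (Cell ''obj'' (var ''u''))))
          Skip (Assign ''owner'' (Cell ''obj'' (var ''u'')) (Add (var ''i'') (Const 1))) ;;
        inc ''u'')"

text \<open>Objects of marked owners are skipped, as no labelled agent can be reached through them.
  The program picks only in classes without free objects, so subtracting 1 from \<open>owner\<close>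
  yields a genuine agent. \<open>c\<close> stores a position plus one, with 0 for none.\<close>

definition pick :: com where
  "pick =
     set_var ''c'' (Const 0) ;; set_var ''u'' (var ''p'') ;;
     While (Less (var ''u'') (var ''q''))
       (Cond (Conj (Less (Cell ''mark'' (Sub (Cell ''owner'' (Cell ''obj'' (var ''u''))) (Const 1)))
                         (Add (var ''k'') (Const 1)))
               (Neg (Conj (Less (Const 0) (var ''c''))
                      (Neg (Less (Cell ''pos'' (Cell ''obj'' (var ''u'')))
                             (Cell ''pos'' (Cell ''obj'' (Sub (var ''c'') (Const 1)))))))))
          (set_var ''c'' (Add (var ''u'') (Const 1))) Skip ;;
        inc ''u'')"

definition set_range :: com where
  "set_range = Assign ''start'' (var ''i'') (var ''p'') ;; Assign ''end'' (var ''i'') (var ''q'')"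

text \<open>The loop ends with \<open>c = 0\<close> in two ways: nothing was left to pick, and
  \<open>g\<close> keeps the value 1, or a trade took place, recorded by
  \<open>g = 0\<close>.\<close>

definition try_class :: com where
  "try_class =
     set_var ''c'' (Const 1) ;;
     While (Less (Const 0) (var ''c''))
       (pick ;;
        Cond (Less (Const 0) (var ''c''))
          (search ;;
           Cond (Less (Const 0) (var ''z''))
             (trade ;; set_range ;; set_var ''c'' (Const 0) ;; set_var ''g'' (Const 0))
             Skip)
          Skip)"

definition process_class :: com where
  "process_class =
     scan_class ;;
     Cond (Less (Const 0) (var ''f''))
       (take_free ;; set_range ;; set_var ''g'' (Const 0))
       (try_class ;; set_var ''p'' (var ''q''))"

definition process_agent :: com where
  "process_agent =
     set_var ''i'' (Cell ''order'' (var ''k'')) ;;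
     set_var ''p'' (Cell ''off'' (var ''i'')) ;;
     set_var ''e'' (Cell ''off'' (Add (var ''i'') (Const 1))) ;;
     set_var ''g'' (Const 1) ;;
     While (Conj (Less (Const 0) (var ''g'')) (Less (var ''p'') (var ''e''))) process_class ;;
     inc ''k''"

definition assign_partners :: com where
  "assign_partners =
     set_var ''i'' (Const 0) ;;
     While (Less (var ''i'') (var ''n1''))
       (find_best ''i'' ''i'' ;;
        Cond (Less (Const 0) (var ''n''))
          (Assign ''partner'' (var ''i'') (Add (var ''best'') (Const 1))) Skip ;;
        inc ''i'')"

definition more_agents :: bexp where
  "more_agents = Less (var ''k'') (var ''n1'')"

abbreviation find_vars :: "string set" where "find_vars \<equiv> {''n'', ''v'', ''best''}"

abbreviation relax_vars :: "string set" where
  "relax_vars \<equiv> {''y'', ''mark'', ''dist'', ''par'', ''queue'', ''t''}"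

abbreviation scan_vars :: "string set" where
  "scan_vars \<equiv> {''y'', ''mark'', ''dist'', ''par'', ''queue'', ''t'', ''u''}"

abbreviation trade_vars :: "string set" where
  "trade_vars \<equiv> {''x'', ''y'', ''n'', ''v'', ''best'', ''o'', ''owner''}"

abbreviation unchanged :: "string set \<Rightarrow> store \<Rightarrow> store \<Rightarrow> bool" where
  "unchanged X s s' \<equiv> \<forall>v. v \<notin> X \<longrightarrow> s' v = s v"

lemma writes_find_best: "writes (find_best X Y) = find_vars"
  by (auto simp: find_best_def find_step_def)

lemma writes_visit: "writes visit =
    {''x'', ''h'', ''n'', ''v'', ''best'', ''z'', ''u'', ''y'', ''mark'', ''dist'', ''par'', ''queue'', ''t''}"
  by (auto simp: visit_def relax_def writes_find_best)


section \<open>Searching a range\<close>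

text \<open>Positions rather than objects are counted, as in the program; injectivity of
  \<open>obj\<close> on a range later identifies the two counts.\<close>

definition owned_positions :: "store \<Rightarrow> nat \<Rightarrow> nat \<Rightarrow> nat set" where
  "owned_positions s x y = {u \<in> {s ''start'' x..<s ''end'' x}. s ''owner'' (s ''obj'' u) = Suc y}"

definition range_length :: "store \<Rightarrow> nat \<Rightarrow> nat" where
  "range_length s x = s ''end'' x - s ''start'' x"

lemma run_find_best:
  fixes s :: store
  assumes XY: "X \<notin> find_vars" "Y \<notin> find_vars"
  defines "P \<equiv> owned_positions s (s X 0) (s Y 0)"
  shows "run (find_best X Y) s (\<lambda>t s'. t \<le> 6 * range_length s (s X 0) + 3 \<and>
     s' ''n'' 0 = card P \<and>
     (P \<noteq> {} \<longrightarrow> s' ''best'' 0 \<in> s ''obj'' ` P \<and>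
        (\<forall>u \<in> P. s ''pos'' (s' ''best'' 0) \<le> s ''pos'' (s ''obj'' u))) \<and>
     unchanged find_vars s s')"
proof -
  define lo hi where "lo = s ''start'' (s X 0)" and "hi = s ''end'' (s X 0)"
  define Q where "Q m = {u \<in> {lo..<m}. s ''owner'' (s ''obj'' u) = Suc (s Y 0)}" for m
  have QP: "P = Q hi" by (auto simp: P_def Q_def owned_positions_def lo_def hi_def)
  \<comment> \<open>Six units per position: at most five for the body and one for the test of the
    loop.\<close>
  define I where "I \<tau> s' \<longleftrightarrow>
     lo \<le> s' ''v'' 0 \<and> s' ''v'' 0 \<le> max lo hi \<and> \<tau> \<le> 6 * (s' ''v'' 0 - lo) \<and>
     s' ''n'' 0 = card (Q (s' ''v'' 0)) \<and>
     (Q (s' ''v'' 0) \<noteq> {} \<longrightarrow> s' ''best'' 0 \<in> s ''obj'' ` Q (s' ''v'' 0) \<and>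
        (\<forall>u \<in> Q (s' ''v'' 0). s ''pos'' (s' ''best'' 0) \<le> s ''pos'' (s ''obj'' u))) \<and>
     unchanged find_vars s s'" for \<tau> s'
  have XY': "X \<noteq> ''n''" "X \<noteq> ''v''" "X \<noteq> ''best''" "Y \<noteq> ''n''" "Y \<noteq> ''v''" "Y \<noteq> ''best''"
    using XY by auto
  have fin: "finite (Q m)" for m by (simp add: Q_def)
  have Qc: "card (Q m) = 0 \<longleftrightarrow> Q m = {}" for m using fin by simp
  have QS: "Q (Suc m) = (if s ''owner'' (s ''obj'' m) = Suc (s Y 0) then insert m (Q m) else Q m)"
    if "lo \<le> m" for m
    using that by (auto simp: Q_def less_Suc_eq)
  have notin: "m \<notin> Q m" for m by (simp add: Q_def)
  show ?thesis
    unfolding find_best_def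
    apply (simp add: XY')
    apply (rule run_mono)
     apply (rule run_while[where I = I and N = "6 * (max lo hi - lo)"])
    subgoal using XY' by (auto simp: I_def lo_def Q_def)
    subgoal unfolding I_def by (meson diff_le_mono le_trans mult_le_mono2)
    subgoal premises p for \<tau> s1
    proof -
      note I = p(1)[unfolded I_def]
      define m where "m = s1 ''v'' 0"
      have fr: "s1 x = s x" if "x \<notin> find_vars" for x using I that by blast
      have m: "lo \<le> m" "m < hi" using p(2) I fr XY by (simp_all add: m_def hi_def)
      have body: "run (find_step X Y) s1 (\<lambda>t s'. t \<le> 5 \<and> s' ''v'' 0 = Suc m \<and>
          s' ''n'' 0 = card (Q (Suc m)) \<and>
          (Q (Suc m) \<noteq> {} \<longrightarrow> s' ''best'' 0 \<in> s ''obj'' ` Q (Suc m) \<and>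
            (\<forall>u \<in> Q (Suc m). s ''pos'' (s' ''best'' 0) \<le> s ''pos'' (s ''obj'' u))) \<and>
          unchanged find_vars s s')"
      proof (cases "s ''owner'' (s ''obj'' m) = Suc (s Y 0)")
        case False
        then show ?thesis
          using I m by (auto simp: find_step_def fr XY' m_def[symmetric] QS)
      next
        case True
        have n: "s1 ''n'' 0 = card (Q m)" using I m_def by simp
        show ?thesis
        proof (cases "Q m = {}")
          case True
          then show ?thesis
            using I m n \<open>s ''owner'' (s ''obj'' m) = Suc (s Y 0)\<close>
            by (auto simp: find_step_def fr XY' m_def[symmetric] QS)
        next
          case False
          then have "0 < card (Q m)" using fin by (simp add: card_gt_0_iff)
          moreover have "s1 ''best'' 0 \<in> s ''obj'' ` Q m"
            "\<forall>u \<in> Q m. s ''pos'' (s1 ''best'' 0) \<le> s ''pos'' (s ''obj'' u)"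
            using I False by (simp_all add: m_def)
          moreover from this have "\<forall>u \<in> Q m. s ''pos'' (s ''obj'' m) \<le> s ''pos'' (s ''obj'' u)"
            if "s ''pos'' (s ''obj'' m) < s ''pos'' (s1 ''best'' 0)"
            using that by (meson le_trans less_imp_le)
          ultimately show ?thesis
            using m n \<open>s ''owner'' (s ''obj'' m) = Suc (s Y 0)\<close>
            by (simp add: find_step_def fr XY' m_def[symmetric] QS fin notin)
        qed
      qed
      show ?thesis
        by (rule run_mono[OF body]) (use I m in \<open>auto simp: I_def m_def[symmetric] Suc_diff_le\<close>)
    qed
    subgoal premises p for t s1
    proof -
      obtain \<tau> where \<tau>: "t = Suc \<tau>" "I \<tau> s1" "\<not> s1 ''v'' 0 < s1 ''end'' (s1 X 0)"
        using p by auto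
      note I = \<tau>(2)[unfolded I_def]
      have fr: "s1 X = s X" "s1 ''end'' = s ''end''" using I XY' by auto
      have "lo \<le> s1 ''v'' 0" "s1 ''v'' 0 \<le> max lo hi" "\<not> s1 ''v'' 0 < hi"
        using \<tau>(3) I unfolding fr hi_def by blast+
      then have m: "s1 ''v'' 0 = max lo hi" by linarith
      have "Q (max lo hi) = P" by (auto simp: Q_def QP max_def)
      moreover have "max lo hi - lo = range_length s (s X 0)"
        by (simp add: range_length_def lo_def hi_def)
      ultimately show ?thesis using I \<tau>(1) unfolding m by simp
    qed
    done
qed


section \<open>Breadth-first search\<close>

text \<open>
  \<open>Q\<close> is the queue including the nodes already removed from it, \<open>M\<close> a set of nodes excluded from the
  search, \<open>Pe\<close> the set of scanned edges, and \<open>m\<close> the distance of the node being visited.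
\<close>

definition bfs_core ::
    "(nat \<times> nat) set \<Rightarrow> nat \<Rightarrow> nat set \<Rightarrow> (nat \<times> nat) set \<Rightarrow> nat list \<Rightarrow>
     (nat \<Rightarrow> nat) \<Rightarrow> (nat \<Rightarrow> nat) \<Rightarrow> nat \<Rightarrow> bool" where
  "bfs_core F i M Pe Q d par m \<longleftrightarrow>
     distinct Q \<and> i \<in> set Q \<and> set Q \<inter> M = {} \<and> d i = 0 \<and> sorted (map d Q) \<and>
     (\<forall>y \<in> set Q. (i, y) \<in> F ^^ d y \<and> d y \<le> Suc m) \<and>
     (\<forall>x y. (x, y) \<in> Pe \<longrightarrow> x \<in> set Q \<and> (y \<in> M \<or> y \<in> set Q \<and> d y \<le> Suc (d x))) \<and>
     (\<forall>y \<in> set Q - {i}. (par y, y) \<in> Pe \<and> Suc (d (par y)) = d y \<and>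
        (\<forall>x. (x, y) \<in> Pe \<and> Suc (d x) = d y \<longrightarrow> par y \<le> x))"

lemma bfs_coreD:
  assumes "bfs_core F i M Pe Q d par m"
  shows "distinct Q" "i \<in> set Q" "set Q \<inter> M = {}" "d i = 0" "sorted (map d Q)"
    and "\<And>y. y \<in> set Q \<Longrightarrow> (i, y) \<in> F ^^ d y" "\<And>y. y \<in> set Q \<Longrightarrow> d y \<le> Suc m"
    and "\<And>x y. (x, y) \<in> Pe \<Longrightarrow> x \<in> set Q" "\<And>x y. (x, y) \<in> Pe \<Longrightarrow> y \<in> M \<or> y \<in> set Q"
    and "\<And>x y. (x, y) \<in> Pe \<Longrightarrow> y \<notin> M \<Longrightarrow> d y \<le> Suc (d x)"
    and "\<And>y. y \<in> set Q \<Longrightarrow> y \<noteq> i \<Longrightarrow> (par y, y) \<in> Pe"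
    and "\<And>y. y \<in> set Q \<Longrightarrow> y \<noteq> i \<Longrightarrow> Suc (d (par y)) = d y"
    and "\<And>x y. y \<in> set Q \<Longrightarrow> y \<noteq> i \<Longrightarrow> (x, y) \<in> Pe \<Longrightarrow> Suc (d x) = d y \<Longrightarrow> par y \<le> x"
  using assms unfolding bfs_core_def by (simp_all only: Diff_iff singleton_iff Ball_def) blast+

lemma bfs_coreI:
  assumes "distinct Q" "i \<in> set Q" "set Q \<inter> M = {}" "d i = 0" "sorted (map d Q)"
    and "\<And>y. y \<in> set Q \<Longrightarrow> (i, y) \<in> F ^^ d y" "\<And>y. y \<in> set Q \<Longrightarrow> d y \<le> Suc m"
    and "\<And>x y. (x, y) \<in> Pe \<Longrightarrow> x \<in> set Q" "\<And>x y. (x, y) \<in> Pe \<Longrightarrow> y \<in> M \<or> y \<in> set Q"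
    and "\<And>x y. (x, y) \<in> Pe \<Longrightarrow> y \<in> set Q \<Longrightarrow> d y \<le> Suc (d x)"
    and "\<And>y. y \<in> set Q \<Longrightarrow> y \<noteq> i \<Longrightarrow> (par y, y) \<in> Pe"
    and "\<And>y. y \<in> set Q \<Longrightarrow> y \<noteq> i \<Longrightarrow> Suc (d (par y)) = d y"
    and "\<And>x y. y \<in> set Q \<Longrightarrow> y \<noteq> i \<Longrightarrow> (x, y) \<in> Pe \<Longrightarrow> Suc (d x) = d y \<Longrightarrow> par y \<le> x"
  shows "bfs_core F i M Pe Q d par m"
  unfolding bfs_core_def
proof (intro conjI ballI allI impI)
  fix x y assume "(x, y) \<in> Pe"
  then show "y \<in> M \<or> y \<in> set Q \<and> d y \<le> Suc (d x)" using assms(9,10) by blast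
next
  fix x y assume "y \<in> set Q - {i}" "(x, y) \<in> Pe \<and> Suc (d x) = d y"
  then show "par y \<le> x" using assms(13) by blast
qed (fact assms | blast intro: assms)+

text \<open>No queued node is farther than \<open>Suc m\<close>, so appending \<open>y\<close> with
  that distance keeps the queue sorted. No scanned edge ended in \<open>y\<close> before, so
  \<open>x\<close> is trivially its least parent.\<close>

lemma bfs_core_discover:
  assumes core: "bfs_core F i M Pe Q d par m"
    and x: "x \<in> set Q" "d x = m" and e: "(x, y) \<in> F" and y: "y \<notin> M" "y \<notin> set Q"
  shows "bfs_core F i M (insert (x, y) Pe) (Q @ [y]) (d(y := Suc m)) (par(y := x)) m"
proof -
  note c = bfs_coreD[OF core]
  have xy: "x \<noteq> y" and iy: "i \<noteq> y" using x y c(2) by auto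
  have d: "(d(y := Suc m)) v = d v" if "v \<in> set Q" for v using that y by auto
  have map: "map (d(y := Suc m)) Q = map d Q" using d by simp
  have Pe: "u \<in> set Q" "v \<noteq> y" if "(u, v) \<in> Pe" for u v using that c(8,9) y by auto
  show ?thesis
  proof (rule bfs_coreI)
    show "sorted (map (d(y := Suc m)) (Q @ [y]))"
      unfolding map_append map sorted_append using c(5,7) by auto
    show "(i, v) \<in> F ^^ (d(y := Suc m)) v" if "v \<in> set (Q @ [y])" for v
    proof (cases "v = y")
      case True
      then show ?thesis using c(6)[OF x(1)] x e by auto
    next
      case False
      then show ?thesis using that c(6)[of v] by simp
    qed
    show "(d(y := Suc m)) v \<le> Suc ((d(y := Suc m)) u)"
      if "(u, v) \<in> insert (x, y) Pe" "v \<in> set (Q @ [y])" for u v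
    proof (cases "(u, v) = (x, y)")
      case True then show ?thesis using x xy by simp
    next
      case False
      then have "(u, v) \<in> Pe" using that by blast
      moreover from this have "v \<in> set Q" "v \<notin> M" using that Pe(2) c(3) by auto
      ultimately show ?thesis using c(10)[of u v] d Pe by simp
    qed
    fix v assume v: "v \<in> set (Q @ [y])" "v \<noteq> i"
    show "((par(y := x)) v, v) \<in> insert (x, y) Pe" using v c(11)[of v] by auto
    show "Suc ((d(y := Suc m)) ((par(y := x)) v)) = (d(y := Suc m)) v"
    proof (cases "v = y")
      case True then show ?thesis using x xy by simp
    next
      case False
      then have vQ: "v \<in> set Q" using v by auto
      then show ?thesis using c(12)[OF vQ v(2)] Pe(1)[OF c(11)[OF vQ v(2)]] d False by simp
    qed
    fix u assume u: "(u, v) \<in> insert (x, y) Pe" "Suc ((d(y := Suc m)) u) = (d(y := Suc m)) v"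
    show "(par(y := x)) v \<le> u"
    proof (cases "v = y")
      case True then show ?thesis using u Pe(2) by auto
    next
      case False
      then have "v \<in> set Q" "(u, v) \<in> Pe" using u v by auto
      then show ?thesis using c(13)[of v u] u(2) v(2) d Pe(1) False by simp
    qed
  next
    show "v \<in> M \<or> v \<in> set (Q @ [y])" if "(u, v) \<in> insert (x, y) Pe" for u v
      using that c(9)[of u v] by auto
  qed (use c(1-4,7,8) x y iy in auto)
qed

text \<open>The new edge matters only if it runs from level \<open>m\<close> to level
  \<open>Suc m\<close>, and then the parent becomes the minimum of the old one and \<open>x\<close>.
  For \<open>y \<in> M\<close> the invariant says nothing about \<open>par y\<close>.\<close>

lemma bfs_core_rescan:
  assumes core: "bfs_core F i M Pe Q d par m"
    and x: "x \<in> set Q" "d x = m" and y: "y \<in> M \<or> y \<in> set Q" "y \<noteq> i"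
    and par': "par' = (if d y = Suc m \<and> x < par y then par(y := x) else par)"
  shows "bfs_core F i M (insert (x, y) Pe) Q d par' m"
proof -
  note c = bfs_coreD[OF core]
  show ?thesis
  proof (rule bfs_coreI)
    show "d v \<le> Suc (d u)" if "(u, v) \<in> insert (x, y) Pe" "v \<in> set Q" for u v
      using that c(3,7,10) x by blast
    fix v assume v: "v \<in> set Q" "v \<noteq> i"
    show "(par' v, v) \<in> insert (x, y) Pe" using c(11)[OF v] by (auto simp: par')
    show "Suc (d (par' v)) = d v" using c(12)[OF v] x by (auto simp: par')
    fix u assume u: "(u, v) \<in> insert (x, y) Pe" "Suc (d u) = d v"
    show "par' v \<le> u"
    proof (cases "(u, v) \<in> Pe")
      case True
      then show ?thesis using c(13)[OF v True u(2)] by (auto simp: par')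
    next
      case False
      then show ?thesis using u x by (auto simp: par')
    qed
  next
    show "v \<in> M \<or> v \<in> set Q" if "(u, v) \<in> insert (x, y) Pe" for u v
      using that c(9)[of u v] y(1) by auto
  qed (use c(1-8) x in auto)
qed

lemma bfs_core_mono:
  assumes "bfs_core F i M Pe Q d par m" "m \<le> m'"
  shows "bfs_core F i M Pe Q d par m'"
proof -
  note c = bfs_coreD[OF assms(1)]
  show ?thesis
  proof (rule bfs_coreI)
    show "d y \<le> Suc m'" if "y \<in> set Q" for y using c(7)[OF that] assms(2) by simp
    show "d y \<le> Suc (d x)" if "(x, y) \<in> Pe" "y \<in> set Q" for x y
      using c(3,10) that by blast
  qed (fact c)+
qed

text \<open>A walk that ends outside \<open>M\<close> never meets \<open>M\<close>, because
  \<open>M\<close> cannot be left. So a search ignoring \<open>M\<close> finds the true distances of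
  all other nodes in the whole graph \<open>F\<close>, and hence also their least parents.\<close>

lemma bfs_core_final:
  assumes core: "bfs_core F i M {(x, y) \<in> F. x \<in> set Q} Q d par m"
    and closed: "\<And>x y. (x, y) \<in> F \<Longrightarrow> x \<in> M \<Longrightarrow> y \<in> M"
  shows "set Q = {y. (i, y) \<in> F\<^sup>*} - M"
    and "y \<in> set Q \<Longrightarrow> y \<noteq> i \<Longrightarrow> par y = bfs_parent F i y"
proof -
  note c = bfs_coreD[OF core]
  have low: "y \<in> set Q \<and> d y \<le> n" if "(i, y) \<in> F ^^ n" "y \<notin> M" for n y
    using that
  proof (induction n arbitrary: y)
    case 0 then show ?case using c(2,4) by auto
  next
    case (Suc n)
    then obtain x where x: "(i, x) \<in> F ^^ n" "(x, y) \<in> F" by auto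
    then have "x \<notin> M" using closed Suc.prems by blast
    then have xQ: "x \<in> set Q" "d x \<le> n" using Suc.IH x by auto
    then have "y \<in> set Q" using c(9)[of x y] x Suc.prems by simp
    then show ?case using c(10)[of x y] x xQ Suc.prems by simp
  qed
  show Q: "set Q = {y. (i, y) \<in> F\<^sup>*} - M"
  proof (intro equalityI subsetI)
    fix y assume "y \<in> set Q"
    then have "(i, y) \<in> F\<^sup>*" "y \<notin> M" using c(6)[of y] c(3) relpow_imp_rtrancl by blast+
    then show "y \<in> {y. (i, y) \<in> F\<^sup>*} - M" by simp
  next
    fix y assume y: "y \<in> {y. (i, y) \<in> F\<^sup>*} - M"
    then obtain n where "(i, y) \<in> F ^^ n" using rtrancl_imp_relpow[of "(i, y)" F] by auto
    then show "y \<in> set Q" using low y by blast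
  qed
  have dist: "bfs_dist F i y = d y" if "y \<in> set Q" for y
  proof (rule order_antisym)
    show "bfs_dist F i y \<le> d y" by (rule bfs_dist_le[OF c(6)[OF that]])
    have "(i, y) \<in> F\<^sup>*" "y \<notin> M" using that Q by auto
    then show "d y \<le> bfs_dist F i y" using low[OF bfs_dist_reach] by blast
  qed
  assume y: "y \<in> set Q" "y \<noteq> i"
  note p = c(11)[OF y] c(12,13)[OF y]
  have p1: "(par y, y) \<in> F" "par y \<in> set Q" using p(1) by auto
  have yM: "y \<notin> M" using y Q by blast
  show "par y = bfs_parent F i y"
    unfolding bfs_parent_def dist[OF y(1)]
  proof (rule Least_equality[symmetric])
    show "(i, par y) \<in> F ^^ (d y - 1) \<and> (par y, y) \<in> F"
      using c(6)[OF p1(2)] p1(1) p(2) by (metis diff_Suc_1)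
    \<comment> \<open>A competitor for the parent is outside \<open>M\<close> as well, hence it was
      queued and its edge to \<open>y\<close> was scanned; minimality among scanned edges then
      applies.\<close>
    fix x assume x: "(i, x) \<in> F ^^ (d y - 1) \<and> (x, y) \<in> F"
    then have "x \<notin> M" using closed yM by blast
    then have xQ: "x \<in> set Q" "d x \<le> d y - 1" using low x by blast+
    then have Pe: "(x, y) \<in> {(x, y) \<in> F. x \<in> set Q}" using x by simp
    have "d y \<le> Suc (d x)" by (rule c(10)[OF Pe yM])
    then have "Suc (d x) = d y" using xQ(2) p(2) by simp
    then show "par y \<le> x" by (rule p(3)[OF Pe])
  qed
qed

section \<open>The breadth-first search invariant as a property of the store\<close>

definition queued :: "store \<Rightarrow> nat list" where
  "queued s = map (s ''queue'') [0..<s ''t'' 0]"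

text \<open>The source is queued without being marked; it owns nothing, so no edge leads back to
  it.\<close>

definition bfs_store :: "(nat \<times> nat) set \<Rightarrow> nat \<Rightarrow> nat set \<Rightarrow> (nat \<times> nat) set \<Rightarrow> nat \<Rightarrow> store \<Rightarrow> bool" where
  "bfs_store F i M Pe m s \<longleftrightarrow>
     bfs_core F i M Pe (queued s) (s ''dist'') (s ''par'') m \<and>
     (\<forall>y. s ''mark'' y \<le> Suc (s ''k'' 0)) \<and>
     (\<forall>y. s ''mark'' y = Suc (s ''k'' 0) \<longleftrightarrow> y \<in> M \<or> y \<in> set (queued s) - {i})"

text \<open>The range of an agent also contains objects he owns himself, whence the case
  \<open>y = x\<close>, in which no edge is recorded. The parent is untouched then, since a distance
  never equals its own successor.\<close>

lemma run_relax:
  assumes st: "bfs_store F i M Pe m s"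
    and x: "s ''x'' 0 \<in> set (queued s)" "s ''dist'' (s ''x'' 0) = m"
    and y: "s ''owner'' (s ''obj'' (s ''u'' 0)) = Suc y" "y \<noteq> i" "(s ''x'' 0, y) \<in> F \<or> y = s ''x'' 0"
  shows "run relax s (\<lambda>t s'. t \<le> 7 \<and>
    bfs_store F i M (if y = s ''x'' 0 then Pe else insert (s ''x'' 0, y) Pe) m s' \<and>
    s' ''dist'' (s ''x'' 0) = m \<and> (\<exists>ys. queued s' = queued s @ ys) \<and>
    unchanged relax_vars s s')"
proof -
  define x0 where "x0 = s ''x'' 0"
  note core = st[unfolded bfs_store_def, THEN conjunct1]
  have mark: "s ''mark'' y \<le> Suc (s ''k'' 0)"
    "s ''mark'' y = Suc (s ''k'' 0) \<longleftrightarrow> y \<in> M \<or> y \<in> set (queued s)"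
    using st y(2) unfolding bfs_store_def by auto
  show ?thesis
  proof (cases "s ''mark'' y = Suc (s ''k'' 0)")
    case False
    then have new: "y \<notin> M" "y \<notin> set (queued s)" using mark by auto
    then have yx: "y \<noteq> x0" using x by (auto simp: x0_def)
    then have e: "(x0, y) \<in> F" using y by (simp add: x0_def)
    have lt: "s ''mark'' y < Suc (s ''k'' 0)" using mark False by simp
    note core' = bfs_core_discover[OF core, of x0 y, folded x0_def, OF _ _ e new]
    let ?s = "s(''y'' := (s ''y'')(0 := y), ''mark'' := (s ''mark'')(y := Suc (s ''k'' 0)),
      ''dist'' := (s ''dist'')(y := Suc m), ''par'' := (s ''par'')(y := x0),
      ''queue'' := (s ''queue'')(s ''t'' 0 := y), ''t'' := (s ''t'')(0 := Suc (s ''t'' 0)))"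
    have q: "queued ?s = queued s @ [y]" by (simp add: queued_def)
    have "bfs_store F i M (insert (x0, y) Pe) m ?s"
      unfolding bfs_store_def q
      using core' x st new y(2) by (auto simp: x0_def bfs_store_def)
    then show ?thesis
      unfolding relax_def using y lt yx q x by (simp add: x0_def[symmetric])
  next
    case True
    then have old: "y \<in> M \<or> y \<in> set (queued s)" using mark by simp
    define par' where
      "par' = (if s ''dist'' y = Suc m \<and> x0 < s ''par'' y then (s ''par'')(y := x0) else s ''par'')"
    let ?s = "s(''y'' := (s ''y'')(0 := y), ''par'' := par')"
    have q: "queued ?s = queued s" by (simp add: queued_def)
    have self: "par' = s ''par''" if "y = x0" using that x by (auto simp: par'_def x0_def)
    have "bfs_core F i M (insert (x0, y) Pe) (queued s) (s ''dist'') par' m"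
      by (rule bfs_core_rescan[OF core _ _ old y(2) par'_def]) (use x in \<open>simp_all add: x0_def\<close>)
    then have "bfs_store F i M (if y = x0 then Pe else insert (x0, y) Pe) m ?s"
      unfolding bfs_store_def q using st self by (auto simp: bfs_store_def)
    moreover have "run relax s (\<lambda>t s'. t \<le> 7 \<and> s' = ?s)"
      unfolding relax_def using y True x
      by (auto simp: x0_def[symmetric] par'_def not_less fun_eq_iff)
    ultimately show ?thesis
      using q x by (auto elim!: run_mono simp: x0_def)
  qed
qed

text \<open>Interface between the graph and the arrays: the correctness of the search relies on this
  alone and not on profiles or allocations.\<close>

definition search_graph ::
    "(nat \<times> nat) set \<Rightarrow> (nat \<Rightarrow> bool) \<Rightarrow> nat set \<Rightarrow> nat \<Rightarrow> store \<Rightarrow> bool" where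
  "search_graph F lab N i s \<longleftrightarrow> finite N \<and> i \<notin> N \<and> F \<subseteq> insert i N \<times> N \<and>
     (\<forall>x \<in> insert i N.
        (lab x \<longleftrightarrow> 1 < card (owned_positions s x x)) \<and>
        (lab x \<longrightarrow> (\<forall>y. (x, y) \<notin> F)) \<and>
        (\<not> lab x \<longrightarrow> (\<forall>u \<in> {s ''start'' x..<s ''end'' x}. \<exists>y \<in> N. s ''owner'' (s ''obj'' u) = Suc y) \<and>
          (\<forall>y. (x, y) \<in> F \<longleftrightarrow>
             y \<noteq> x \<and> (\<exists>u \<in> {s ''start'' x..<s ''end'' x}. s ''owner'' (s ''obj'' u) = Suc y))))"

text \<open>As in the store, \<open>Suc x\<close> encodes the agent \<open>x\<close> and \<open>0\<close> encodes that there is none.\<close>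

definition least_labelled :: "(nat \<Rightarrow> bool) \<Rightarrow> nat set \<Rightarrow> nat \<Rightarrow> bool" where
  "least_labelled lab A z \<longleftrightarrow> (z = 0 \<and> (\<forall>x \<in> A. \<not> lab x)) \<or>
     (\<exists>x \<in> A. z = Suc x \<and> lab x \<and> (\<forall>y \<in> A. lab y \<longrightarrow> x \<le> y))"

lemma run_scan_edges:
  fixes s :: store
  assumes g: "search_graph F lab N i s"
    and st: "bfs_store F i M Pe m s"
    and x: "s ''x'' 0 \<in> set (queued s)" "s ''x'' 0 \<in> insert i N" "s ''dist'' (s ''x'' 0) = m"
    and unlab: "\<not> lab (s ''x'' 0)" and u: "s ''u'' 0 = s ''start'' (s ''x'' 0)"
  shows "run (While (Less (var ''u'') (Cell ''end'' (var ''x''))) (relax ;; inc ''u'')) s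
    (\<lambda>t s'. t \<le> 9 * range_length s (s ''x'' 0) + 1 \<and>
      bfs_store F i M (Pe \<union> {(x, y) \<in> F. x = s ''x'' 0}) m s' \<and>
      s' ''dist'' (s ''x'' 0) = m \<and> (\<exists>ys. queued s' = queued s @ ys) \<and>
      unchanged scan_vars s s')"
proof -
  define x0 lo hi where "x0 = s ''x'' 0" and "lo = s ''start'' x0" and "hi = s ''end'' x0"
  \<comment> \<open>The edges found at positions before \<open>n\<close>. One position costs nine
    units: seven for \<open>relax\<close>, one for the increment and one for the test.\<close>
  define Pu where "Pu n = Pe \<union> {(x, y). x = x0 \<and> y \<noteq> x0 \<and>
    (\<exists>u \<in> {lo..<n}. s ''owner'' (s ''obj'' u) = Suc y)}" for n
  have gx: "\<forall>u \<in> {lo..<hi}. \<exists>y \<in> N. s ''owner'' (s ''obj'' u) = Suc y"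
    "\<And>y. (x0, y) \<in> F \<longleftrightarrow> y \<noteq> x0 \<and> (\<exists>u \<in> {lo..<hi}. s ''owner'' (s ''obj'' u) = Suc y)"
    using g x unlab unfolding search_graph_def x0_def lo_def hi_def by blast+
  define I where "I \<tau> s' \<longleftrightarrow>
     lo \<le> s' ''u'' 0 \<and> s' ''u'' 0 \<le> max lo hi \<and> \<tau> \<le> 9 * (s' ''u'' 0 - lo) \<and>
     bfs_store F i M (Pu (s' ''u'' 0)) m s' \<and>
     s' ''dist'' x0 = m \<and> (\<exists>ys. queued s' = queued s @ ys) \<and>
     unchanged scan_vars s s'" for \<tau> s'
  show ?thesis
    apply (rule run_mono)
     apply (rule run_while[where I = I and N = "9 * (max lo hi - lo)"])
    subgoal using st u x by (simp add: I_def x0_def lo_def Pu_def)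
    subgoal unfolding I_def by (meson diff_le_mono le_trans mult_le_mono2)
    subgoal premises p for \<tau> s1
    proof -
      note I = p(1)[unfolded I_def]
      define n where "n = s1 ''u'' 0"
      have fr: "s1 v = s v" if "v \<notin> scan_vars" for v
        using I that by (elim conjE) simp
      have n: "lo \<le> n" "n < hi" using p(2) I by (simp_all add: n_def hi_def fr x0_def)
      then obtain y where y: "y \<in> N" "s ''owner'' (s ''obj'' n) = Suc y" using bspec[OF gx(1), of n] by auto
      have x1: "s1 ''x'' 0 = x0" by (simp add: fr x0_def)
      have Pu': "Pu (Suc n) = (if y = x0 then Pu n else insert (x0, y) (Pu n))"
        using y(2) n(1) by (auto simp: Pu_def atLeastLessThanSuc)
      have r: "run relax s1 (\<lambda>t s'. t \<le> 7 \<and>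
          bfs_store F i M (if y = s1 ''x'' 0 then Pu n else insert (s1 ''x'' 0, y) (Pu n)) m s' \<and>
          s' ''dist'' (s1 ''x'' 0) = m \<and> (\<exists>ys. queued s' = queued s1 @ ys) \<and>
          unchanged relax_vars s1 s')"
      proof (rule run_relax)
        show "bfs_store F i M (Pu n) m s1" using I n_def by simp
        obtain ys where "queued s1 = queued s @ ys" using I by blast
        then show "s1 ''x'' 0 \<in> set (queued s1)" using x(1) by (simp add: x1 x0_def)
        show "s1 ''dist'' (s1 ''x'' 0) = m" unfolding x1 using I by blast
        show "s1 ''owner'' (s1 ''obj'' (s1 ''u'' 0)) = Suc y" using y by (simp add: fr n_def[symmetric])
        show "y \<noteq> i" using y g by (auto simp: search_graph_def)
        show "(s1 ''x'' 0, y) \<in> F \<or> y = s1 ''x'' 0" using gx(2)[of y] y n x1 by auto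
      qed
      show ?thesis
        unfolding run_Seq
      proof (rule run_mono[OF r], elim conjE exE)
        fix t :: nat and s2 ys
        assume t: "t \<le> 7"
          and b: "bfs_store F i M (if y = s1 ''x'' 0 then Pu n else insert (s1 ''x'' 0, y) (Pu n)) m s2"
          and d: "s2 ''dist'' (s1 ''x'' 0) = m" and q: "queued s2 = queued s1 @ ys"
          and fr2: "unchanged relax_vars s1 s2"
        have u2: "s2 ''u'' 0 = n" using fr2 by (simp add: n_def)
        let ?s = "s2(''u'' := (s2 ''u'')(0 := Suc n))"
        have "bfs_store F i M (Pu (Suc n)) m ?s"
          using b unfolding bfs_store_def queued_def Pu' x1 by simp
        moreover have "queued ?s = queued s2" by (simp add: queued_def)
        moreover obtain xs where "queued s1 = queued s @ xs" using I by blast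
        then have "\<exists>zs. queued s2 = queued s @ zs" using q by simp
        moreover have "?s ''dist'' x0 = m" using d x1 by simp
        moreover have "?s v = s v"
          if "v \<notin> scan_vars" for v
          using that fr[OF that] fr2 by simp
        moreover have "\<tau> + (t + 1) + 1 \<le> 9 * (Suc n - lo)"
          using t n I by (simp add: n_def[symmetric] Suc_diff_le)
        ultimately have "I (\<tau> + (t + 1) + 1) ?s"
          using n unfolding I_def by simp
        then show "run (inc ''u'') s2 (\<lambda>t' s'. I (\<tau> + (t + t') + 1) s')"
          by (simp add: u2)
      qed
    qed
    subgoal premises p for t s1
    proof -
      obtain \<tau> where \<tau>: "t = Suc \<tau>" "I \<tau> s1" "\<not> s1 ''u'' 0 < s1 ''end'' (s1 ''x'' 0)"
        using p by auto
      note I = \<tau>(2)[unfolded I_def]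
      have frI: "unchanged scan_vars s s1"
        using I by argo
      then have fr: "s1 ''x'' = s ''x''" "s1 ''end'' = s ''end''" by simp_all
      have "lo \<le> s1 ''u'' 0" "s1 ''u'' 0 \<le> max lo hi" "\<not> s1 ''u'' 0 < hi"
        using \<tau>(3) I unfolding fr hi_def x0_def by blast+
      then have n: "s1 ''u'' 0 = max lo hi" by linarith
      have "Pu (max lo hi) = Pe \<union> {(x, y) \<in> F. x = x0}"
      proof -
        have "{lo..<max lo hi} = {lo..<hi}" by (auto simp: max_def)
        moreover have "{(x, y) \<in> F. x = x0} = {(x, y). x = x0 \<and> (x0, y) \<in> F}" by auto
        ultimately show ?thesis by (simp add: Pu_def gx(2))
      qed
      moreover have "max lo hi - lo = range_length s x0"
        by (simp add: range_length_def lo_def hi_def)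
      moreover have "\<tau> \<le> 9 * (max lo hi - lo)" "bfs_store F i M (Pu (max lo hi)) m s1"
        using I n by metis+
      moreover have "s1 ''dist'' x0 = m \<and> (\<exists>ys. queued s1 = queued s @ ys)" using I by argo
      ultimately show ?thesis using frI \<tau>(1) unfolding x0_def[symmetric] by simp
    qed
    done
qed

lemma search_graph_cong:
  assumes "s' ''start'' = s ''start''" "s' ''end'' = s ''end''"
    "s' ''owner'' = s ''owner''" "s' ''obj'' = s ''obj''"
  shows "search_graph F lab N i s' = search_graph F lab N i s"
  unfolding search_graph_def owned_positions_def assms ..

lemma least_labelled_step:
  assumes "least_labelled lab A z"
  shows "least_labelled lab (insert x A)
    (if lab x then (if 0 < z \<and> z < Suc (Suc x) then z else Suc x) else z)"
proof (cases "z = 0")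
  case True
  then show ?thesis using assms by (auto simp: least_labelled_def)
next
  case False
  then obtain v where v: "v \<in> A" "z = Suc v" "lab v" "\<forall>y \<in> A. lab y \<longrightarrow> v \<le> y"
    using assms by (auto simp: least_labelled_def)
  show ?thesis
  proof (cases "lab x")
    case False
    then show ?thesis using v by (auto simp: least_labelled_def)
  next
    case True
    then show ?thesis using v by (auto simp: least_labelled_def not_less)
  qed
qed

text \<open>The scanned edges are those leaving the first \<open>h\<close> entries of the queue. The
  level \<open>m\<close> is tied to the next entry as long as there is one and unspecified once the
  queue is exhausted.\<close>

definition search_inv ::
    "(nat \<times> nat) set \<Rightarrow> (nat \<Rightarrow> bool) \<Rightarrow> nat \<Rightarrow> nat set \<Rightarrow> store \<Rightarrow> store \<Rightarrow> bool" where
  "search_inv F lab i M s s' \<longleftrightarrow>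
     s' ''h'' 0 \<le> s' ''t'' 0 \<and>
     (\<exists>m. bfs_store F i M {(x, y) \<in> F. x \<in> set (take (s' ''h'' 0) (queued s'))} m s' \<and>
       (s' ''h'' 0 < s' ''t'' 0 \<longrightarrow> m = s' ''dist'' (queued s' ! s' ''h'' 0))) \<and>
     least_labelled lab (set (take (s' ''h'' 0) (queued s'))) (s' ''z'' 0) \<and>
     unchanged (writes visit) s s'"

lemma length_queued: "length (queued s) = s ''t'' 0"
  by (simp add: queued_def)

lemma bfs_store_queue_subset:
  assumes "bfs_store F i M Pe m s" "F \<subseteq> insert i N \<times> N"
  shows "set (queued s) \<subseteq> insert i N"
proof
  fix y assume "y \<in> set (queued s)"
  then have "(i, y) \<in> F ^^ s ''dist'' y"
    using assms(1) bfs_coreD(6) unfolding bfs_store_def by blast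
  then show "y \<in> insert i N" using assms(2) by (cases "s ''dist'' y") auto
qed

text \<open>The factor 15 stems from two passes over the range: six units per position to count the
  objects owned by the agent and nine to relax the edges.\<close>

lemma run_visit:
  assumes g: "search_graph F lab N i s" and G: "\<And>x. x \<in> insert i N \<Longrightarrow> range_length s x \<le> G"
    and inv: "search_inv F lab i M s s1" and h: "s1 ''h'' 0 < s1 ''t'' 0"
  shows "run visit s1 (\<lambda>t s'. t \<le> 15 * G + 11 \<and> s' ''h'' 0 = Suc (s1 ''h'' 0) \<and>
    search_inv F lab i M s s')"
proof -
  define h0 Q where "h0 = s1 ''h'' 0" and "Q = queued s1"
  define x0 where "x0 = Q ! h0"
  define Pe where "Pe = {(x, y) \<in> F. x \<in> set (take h0 Q)}"
  define m where "m = s1 ''dist'' x0"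
  have fr: "s1 v = s v" if "v \<notin> writes visit" for v
    using inv that unfolding search_inv_def by blast
  have st: "bfs_store F i M Pe m s1"
    using inv h unfolding search_inv_def Pe_def m_def x0_def h0_def Q_def by blast
  have z: "least_labelled lab (set (take h0 Q)) (s1 ''z'' 0)"
    using inv unfolding search_inv_def Q_def h0_def by blast
  have hl: "h0 < length Q" using h by (simp add: Q_def h0_def length_queued)
  have x0Q: "x0 \<in> set Q" using hl by (simp add: x0_def)
  have FN: "F \<subseteq> insert i N \<times> N" using g by (simp add: search_graph_def)
  have x0N: "x0 \<in> insert i N" using bfs_store_queue_subset[OF st FN] x0Q Q_def by blast
  have qh: "s1 ''queue'' h0 = x0" using hl by (simp add: x0_def Q_def queued_def length_queued)
  define s2 where "s2 = s1(''x'' := (s1 ''x'')(0 := x0), ''h'' := (s1 ''h'')(0 := Suc h0))"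
  have s2: "s2 ''x'' 0 = x0" "s2 ''h'' 0 = Suc h0"
    "\<And>v. v \<notin> {''x'', ''h''} \<Longrightarrow> s2 v = s1 v" by (auto simp: s2_def)
  have static: "s1 ''start'' = s ''start''" "s1 ''end'' = s ''end''" "s1 ''owner'' = s ''owner''"
    "s1 ''obj'' = s ''obj''"
    by (rule fr, simp add: writes_visit)+
  have rl: "range_length s2 x0 = range_length s x0" and op: "owned_positions s2 x0 x0 = owned_positions s x0 x0"
    by (simp_all add: range_length_def owned_positions_def s2 static)
  have lab: "lab x0 \<longleftrightarrow> 1 < card (owned_positions s x0 x0)"
    and labF: "lab x0 \<Longrightarrow> (x0, y) \<notin> F" for y
    using g x0N unfolding search_graph_def by blast+
  define z' where "z' = (if lab x0 then (if 0 < s1 ''z'' 0 \<and> s1 ''z'' 0 < Suc (Suc x0) then s1 ''z'' 0 else Suc x0) else s1 ''z'' 0)"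
  have fin: "search_inv F lab i M s s'"
    if s': "s' ''h'' 0 = Suc h0" "s' ''z'' 0 = z'" "queued s' = Q @ ys" "s' ''dist'' x0 = m"
      "bfs_store F i M (Pe \<union> {(x, y) \<in> F. x = x0}) m s'"
      "\<And>v. v \<notin> writes visit \<Longrightarrow> s' v = s v" for s' ys
  proof -
    have hl': "h0 < length (queued s')" using hl s'(3) by simp
    have tk: "take (Suc h0) (queued s') = take h0 Q @ [x0]"
      using hl s'(3) by (simp add: take_Suc_conv_app_nth x0_def)
    have Pe': "{(x, y) \<in> F. x \<in> set (take (Suc h0) (queued s'))} = Pe \<union> {(x, y) \<in> F. x = x0}"
      unfolding tk by (auto simp: Pe_def)
    have "\<exists>m. bfs_store F i M (Pe \<union> {(x, y) \<in> F. x = x0}) m s' \<and>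
       (Suc h0 < s' ''t'' 0 \<longrightarrow> m = s' ''dist'' (queued s' ! Suc h0))"
    proof (cases "Suc h0 < s' ''t'' 0")
      case False then show ?thesis using s'(5) by blast
    next
      case True
      let ?m = "s' ''dist'' (queued s' ! Suc h0)"
      have core: "bfs_core F i M (Pe \<union> {(x, y) \<in> F. x = x0}) (queued s') (s' ''dist'') (s' ''par'') m"
        using s'(5) by (simp add: bfs_store_def)
      have "queued s' ! h0 = x0" using hl s'(3) by (simp add: nth_append x0_def)
      \<comment> \<open>The queue is sorted by distance, so passing to its next entry can only raise
        the level, which \<open>bfs_core_mono\<close> permits.\<close>
      then have "m \<le> ?m"
        using sorted_nth_mono[OF bfs_coreD(5)[OF core], of h0 "Suc h0"] True s'(4)
        by (simp add: length_queued)
      then have "bfs_store F i M (Pe \<union> {(x, y) \<in> F. x = x0}) ?m s'"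
        using bfs_core_mono[OF core] s'(5) by (simp add: bfs_store_def)
      then show ?thesis by blast
    qed
    moreover have "least_labelled lab (set (take (Suc h0) (queued s'))) (s' ''z'' 0)"
      using least_labelled_step[OF z, of x0] unfolding tk s'(2) z'_def by simp
    moreover have "Suc h0 \<le> s' ''t'' 0" using hl' by (simp add: length_queued)
    ultimately show ?thesis
      using s'(6) unfolding search_inv_def s'(1) Pe' by blast
  qed
  note fb = run_find_best[of "''x''" "''x''" s2, unfolded s2(1) rl op]
  show ?thesis
    unfolding visit_def
    apply (simp add: h0_def[symmetric] qh split del: if_split)
    apply (simp only: fun_upd_same fun_upd_other s2_def[symmetric])
    apply (rule run_mono[OF fb])
      apply simp
     apply simp
    subgoal premises p for t3 s3
    proof -
      have t3: "t3 \<le> 6 * G + 3" using p G[OF x0N] by fastforce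
      have n3: "s3 ''n'' 0 = card (owned_positions s x0 x0)" using p by blast
      have fr3: "s3 v = s2 v" if "v \<notin> find_vars" for v using p that by (elim conjE) simp
      have q3: "queued s3 = Q" by (simp add: queued_def Q_def fr3 s2)
      have st3: "bfs_store F i M Pe m s3"
        using st unfolding bfs_store_def q3 Q_def[symmetric] by (simp add: fr3 s2)
      have fr3': "s3 v = s v" if "v \<notin> writes visit" for v
        using that fr[OF that] fr3[of v] s2(3)[of v] by (simp add: writes_visit)
      have x3: "s3 ''x'' 0 = x0" "s3 ''h'' 0 = Suc h0" "s3 ''z'' 0 = s1 ''z'' 0" "s3 ''dist'' x0 = m"
        by (simp_all add: fr3 s2 m_def)
      show ?thesis
      proof (cases "lab x0")
        case True
        have Pe1: "Pe \<union> {(x, y) \<in> F. x = x0} = Pe" using labF[OF True] by auto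
        have "search_inv F lab i M s s3" if "s3 ''z'' 0 = z'"
          by (rule fin[of _ "[]"]) (use x3 that q3 st3 fr3' Pe1 in simp_all)
        moreover have "search_inv F lab i M s (s3(''z'' := (s3 ''z'')(0 := Suc x0)))" if "Suc x0 = z'"
        proof (rule fin[of _ "[]"])
          show "bfs_store F i M (Pe \<union> {(x, y) \<in> F. x = x0}) m (s3(''z'' := (s3 ''z'')(0 := Suc x0)))"
            using st3 unfolding Pe1 by (simp add: bfs_store_def queued_def)
          show "(s3(''z'' := (s3 ''z'')(0 := Suc x0))) v = s v" if "v \<notin> writes visit" for v
            using that fr3'[OF that] by (simp add: writes_visit)
        qed (use x3 that q3 in \<open>simp_all add: queued_def\<close>)
        ultimately show ?thesis
          using True lab n3 x3 t3 by (auto simp: z'_def)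
      next
        case False
        define s4 where "s4 = s3(''u'' := (s3 ''u'')(0 := s3 ''start'' x0))"
        have s4: "s4 ''u'' 0 = s3 ''start'' x0" "\<And>v. v \<noteq> ''u'' \<Longrightarrow> s4 v = s3 v"
          by (auto simp: s4_def)
        have static4: "s4 ''start'' = s ''start''" "s4 ''end'' = s ''end''" "s4 ''owner'' = s ''owner''"
          "s4 ''obj'' = s ''obj''" by (simp_all add: s4 fr3 s2 static)
        have q4: "queued s4 = Q" by (simp add: queued_def s4 q3[unfolded queued_def])
        have g4: "search_graph F lab N i s4" using g search_graph_cong[OF static4] by blast
        have st4: "bfs_store F i M Pe m s4"
          using st3 unfolding bfs_store_def q4 q3 by (simp add: s4)
        note sc = run_scan_edges[OF g4 st4, unfolded s4(1) q4]
        have r4: "range_length s4 x0 \<le> G" using G[OF x0N] by (simp add: range_length_def static4)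
        have x4: "s4 ''x'' 0 = x0" "s4 ''dist'' x0 = m" "s4 ''start'' x0 = s3 ''start'' x0"
          by (simp_all add: s4 x3)
        note sc' = sc[unfolded x4, OF x0Q x0N refl False refl]
        have "\<not> Suc 0 < s3 ''n'' 0" using False lab n3 by simp
        then show ?thesis
          apply (simp add: x3(1) s4_def[symmetric] split del: if_split)
          apply (rule run_mono[OF sc'[unfolded One_nat_def]])
          subgoal premises p4 for t5 s5
          proof -
            have t5: "t5 \<le> 9 * G + 1" using p4 r4 by fastforce
            have fr5: "s5 v = s4 v"
              if "v \<notin> scan_vars" for v
              using p4(2) that by (elim conjE) simp
            obtain ys where "queued s5 = Q @ ys" using p4(2) by blast
            then have "search_inv F lab i M s s5"
            proof (rule fin[rotated 2])
              show "bfs_store F i M (Pe \<union> {(x, y) \<in> F. x = x0}) m s5" using p4(2) by blast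
              show "s5 ''dist'' x0 = m" using p4(2) by blast
              show "s5 v = s v" if "v \<notin> writes visit" for v
                using fr3'[OF that] that fr5[of v] s4(2)[of v] by (simp add: writes_visit)
            qed (use False in \<open>simp_all add: fr5 s4 x3 z'_def\<close>)
            then show ?thesis using t3 t5 by (simp add: fr5 s4 x3)
          qed
          done
      qed
    qed
    done
qed


text \<open>Time is charged to newly marked agents: each of them is visited once, and the
  \<open>Suc\<close> accounts for the source, which is visited without a mark.\<close>

lemma run_search_loop:
  assumes g: "search_graph F lab N i s" and G: "\<And>x. x \<in> insert i N \<Longrightarrow> range_length s x \<le> G"
    and M: "M = {y. s ''mark'' y = Suc (s ''k'' 0)}" "\<And>y. s ''mark'' y \<le> Suc (s ''k'' 0)"
    and iM: "i \<notin> M" and Mlab: "\<And>x. x \<in> M \<Longrightarrow> \<not> lab x"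
    and closed: "\<And>x y. (x, y) \<in> F \<Longrightarrow> x \<in> M \<Longrightarrow> y \<in> M"
    and init: "s ''queue'' 0 = i" "s ''dist'' i = 0" "s ''h'' 0 = 0" "s ''t'' 0 = 1" "s ''z'' 0 = 0"
  shows "run (While (Less (var ''h'') (var ''t'')) visit) s (\<lambda>t s'.
    t \<le> (15 * G + 12) * Suc (card ({y. s' ''mark'' y = Suc (s ''k'' 0)} - M)) + 1 \<and>
    {y. s' ''mark'' y = Suc (s ''k'' 0)} = M \<union> ({y. (i, y) \<in> F\<^sup>*} - {i}) \<and>
    (\<forall>y. s' ''mark'' y \<le> Suc (s ''k'' 0)) \<and>
    least_labelled lab {y. (i, y) \<in> F\<^sup>*} (s' ''z'' 0) \<and>
    (\<forall>y. (i, y) \<in> F\<^sup>* \<and> y \<notin> M \<and> y \<noteq> i \<longrightarrow> s' ''par'' y = bfs_parent F i y) \<and>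
    unchanged (writes visit) s s')"
proof -
  have FN: "F \<subseteq> insert i N \<times> N" and finN: "finite N" and iN: "i \<notin> N"
    using g by (simp_all add: search_graph_def)
  define I where "I \<tau> s' \<longleftrightarrow> search_inv F lab i M s s' \<and> \<tau> \<le> (15 * G + 12) * s' ''h'' 0" for \<tau> s'
  \<comment> \<open>The queue is a duplicate-free list of vertices; this bounds the number of visits
    and thus the termination measure.\<close>
  have h_le: "s' ''h'' 0 \<le> Suc (card N)" if inv: "search_inv F lab i M s s'" for s'
  proof -
    obtain Pe m where st: "bfs_store F i M Pe m s'" using inv unfolding search_inv_def by blast
    have "distinct (queued s')" using st bfs_coreD(1) unfolding bfs_store_def by blast
    then have "s' ''t'' 0 = card (set (queued s'))"
      using distinct_card[of "queued s'"] by (simp add: length_queued)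
    also have "\<dots> \<le> card (insert i N)"
      by (rule card_mono) (use bfs_store_queue_subset[OF st FN] finN in auto)
    also have "\<dots> = Suc (card N)" using finN iN by simp
    finally show ?thesis using inv unfolding search_inv_def by linarith
  qed
  have q: "queued s = [i]" by (simp add: queued_def init)
  have "bfs_core F i M {} [i] (s ''dist'') (s ''par'') 0"
    by (rule bfs_coreI) (use iM init in auto)
  then have st: "bfs_store F i M {} 0 s" unfolding bfs_store_def q using M by auto
  have init_inv: "search_inv F lab i M s s"
    unfolding search_inv_def q init using st by (auto simp: least_labelled_def init)
  show ?thesis
    apply (rule run_mono)
     apply (rule run_while[where I = I and N = "(15 * G + 12) * Suc (card N)"])
    subgoal using init_inv by (simp add: I_def)
    subgoal unfolding I_def using h_le by (meson le_trans mult_le_mono2)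
    subgoal premises p for \<tau> s1
    proof -
      have inv: "search_inv F lab i M s s1" "\<tau> \<le> (15 * G + 12) * s1 ''h'' 0" "s1 ''h'' 0 < s1 ''t'' 0"
        using p by (simp_all add: I_def)
      show ?thesis
        by (rule run_mono[OF run_visit[OF g G inv(1,3)]]) (use inv(2) in \<open>auto simp: I_def\<close>)
    qed
    subgoal premises p for t s1
    proof -
      obtain \<tau> where \<tau>: "t = Suc \<tau>" "I \<tau> s1" "\<not> s1 ''h'' 0 < s1 ''t'' 0" using p by auto
      have inv: "search_inv F lab i M s s1" and time: "\<tau> \<le> (15 * G + 12) * s1 ''h'' 0"
        using \<tau>(2) by (simp_all add: I_def)
      define Q where "Q = queued s1"
      have h: "s1 ''h'' 0 = length Q"
        using inv \<tau>(3) unfolding search_inv_def Q_def length_queued by linarith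
      have fr: "unchanged (writes visit) s s1" using inv unfolding search_inv_def by blast
      then have k: "s1 ''k'' = s ''k''" by (simp add: writes_visit)
      obtain m where st: "bfs_store F i M {(x, y) \<in> F. x \<in> set Q} m s1"
        using inv unfolding search_inv_def h Q_def by auto
      have core: "bfs_core F i M {(x, y) \<in> F. x \<in> set Q} Q (s1 ''dist'') (s1 ''par'') m"
        using st by (simp add: bfs_store_def Q_def)
      have setQ: "set Q = {y. (i, y) \<in> F\<^sup>*} - M" by (rule bfs_core_final(1)[OF core closed])
      have marks: "{y. s1 ''mark'' y = Suc (s ''k'' 0)} = M \<union> (set Q - {i})"
        "\<forall>y. s1 ''mark'' y \<le> Suc (s ''k'' 0)"
        using st unfolding bfs_store_def k Q_def by blast+
      have iQ: "i \<in> set Q" by (rule bfs_coreD(2)[OF core])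
      have "{y. s1 ''mark'' y = Suc (s ''k'' 0)} - M = set Q - {i}"
        unfolding marks setQ by auto
      then have "Suc (card ({y. s1 ''mark'' y = Suc (s ''k'' 0)} - M)) = card (set Q)"
        using iQ by (simp add: card_Suc_Diff1 del: card_Diff_insert)
      also have "\<dots> = length Q" using bfs_coreD(1)[OF core] distinct_card by blast
      finally have cQ: "Suc (card ({y. s1 ''mark'' y = Suc (s ''k'' 0)} - M)) = length Q" .
      have "least_labelled lab (set Q) (s1 ''z'' 0)"
        using inv unfolding search_inv_def h Q_def by simp
      \<comment> \<open>Agents in \<open>M\<close> are unlabelled, so the least labelled agent of
        the queue is also the least among all reachable agents.\<close>
      then have ll: "least_labelled lab {y. (i, y) \<in> F\<^sup>*} (s1 ''z'' 0)"
        using Mlab unfolding setQ least_labelled_def by blast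
      have par: "\<forall>y. (i, y) \<in> F\<^sup>* \<and> y \<notin> M \<and> y \<noteq> i \<longrightarrow> s1 ''par'' y = bfs_parent F i y"
      proof (intro allI impI)
        fix y assume "(i, y) \<in> F\<^sup>* \<and> y \<notin> M \<and> y \<noteq> i"
        then have y: "y \<in> set Q" "y \<noteq> i" using setQ by auto
        show "s1 ''par'' y = bfs_parent F i y"
          by (rule bfs_core_final(2)[OF core closed y])
      qed
      have m: "M \<union> (set Q - {i}) = M \<union> ({y. (i, y) \<in> F\<^sup>*} - {i})" unfolding setQ by blast
      show ?thesis
        unfolding cQ
        using time \<tau>(1) marks(2) ll par fr unfolding h marks(1) m by simp
    qed
    done
qed


section \<open>Running a trade\<close>

text \<open>Invariant of the walk at \<open>y = p ! j\<close>: the objects \<open>ob t\<close> with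
  \<open>t > j\<close> have changed hands and all other owners are as before the trade. One step
  costs \<open>6 * G + 8\<close>, of which \<open>6 * G + 3\<close> are for the search in a
  range.\<close>

lemma run_trade:
  fixes st :: store
  assumes sh: "shifted w p n ob w'" and disj: "\<forall>i j. i \<noteq> j \<longrightarrow> w i \<inter> w j = {}"
    and own: "\<And>a j. a \<in> w j \<longleftrightarrow> st ''owner'' a = Suc j"
    and range: "\<And>s. 1 \<le> s \<Longrightarrow> s < n \<Longrightarrow> ob s \<in> st ''obj'' ` {st ''start'' (p ! s)..<st ''end'' (p ! s)}"
    and last: "owned_positions st (p ! (n - 1)) (p ! n) \<noteq> {}"
      "\<And>b. b \<in> st ''obj'' ` owned_positions st (p ! (n - 1)) (p ! n) \<Longrightarrow>
         \<forall>u \<in> owned_positions st (p ! (n - 1)) (p ! n). st ''pos'' b \<le> st ''pos'' (st ''obj'' u) \<Longrightarrow>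
         b = ob n"
    and par: "\<And>s. s < n \<Longrightarrow> st ''par'' (p ! Suc s) = p ! s"
    and zi: "st ''z'' 0 = Suc (p ! n)" "st ''i'' 0 = p ! 0"
    and G: "\<And>s. s < n \<Longrightarrow> range_length st (p ! s) \<le> G"
  shows "run trade st (\<lambda>t s'. t \<le> (6 * G + 8) * Suc n \<and>
    (\<forall>a j. a \<in> w' j \<longleftrightarrow> s' ''owner'' a = Suc j) \<and>
    unchanged trade_vars st s')"
proof -
  let ?fr = "trade_vars"
  note shd = sh[unfolded shifted_def]
  have n1: "1 \<le> n" using shd by blast
  have inj: "s = t" if "1 \<le> s" "s \<le> n" "1 \<le> t" "t \<le> n" "ob s = ob t" for s t
    by (rule shifted_inj[OF sh disj that])
  have pinj: "p ! s = p ! t \<longleftrightarrow> s = t" if "s \<le> n" "t \<le> n" for s t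
    using shd that by (simp add: nth_eq_iff_index_eq)
  define I where "I \<tau> s' \<longleftrightarrow> (\<exists>j \<le> n. s' ''y'' 0 = p ! j \<and> (1 \<le> j \<longrightarrow> s' ''o'' 0 = ob j) \<and>
      \<tau> \<le> (6 * G + 8) * (n - j) \<and>
      (\<forall>t. j < t \<and> t \<le> n \<longrightarrow> s' ''owner'' (ob t) = Suc (p ! (t - 1))) \<and>
      (\<forall>a. a \<notin> ob ` {j<..n} \<longrightarrow> s' ''owner'' a = st ''owner'' a)) \<and>
    unchanged ?fr st s'" for \<tau> s'
  define s1 where "s1 = st(''y'' := (st ''y'')(0 := p ! n), ''x'' := (st ''x'')(0 := p ! (n - 1)))"
  have s1: "s1 ''y'' 0 = p ! n" "s1 ''x'' 0 = p ! (n - 1)"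
    "\<And>v. v \<notin> {''x'', ''y''} \<Longrightarrow> s1 v = st v" by (auto simp: s1_def)
  have op1: "owned_positions s1 x y = owned_positions st x y" and rl1: "range_length s1 x = range_length st x" for x y
    by (simp_all add: owned_positions_def range_length_def s1)
  note fb = run_find_best[of "''x''" "''y''" s1, unfolded s1(1,2) op1 rl1]
  have parn: "st ''par'' (p ! n) = p ! (n - 1)" using par[of "n - 1"] n1 by simp
  show ?thesis
    unfolding trade_def
    apply (simp add: zi(1) parn split del: if_split)
    apply (simp only: s1_def[symmetric] One_nat_def[symmetric])
    apply (rule run_mono[OF fb])
      apply simp
     apply simp
    subgoal premises p3 for t3 s3
    proof -
      have fr3: "s3 v = s1 v" if "v \<notin> find_vars" for v using p3 that by (elim conjE) simp
      have t3: "t3 \<le> 6 * G + 3" using p3 G[of "n - 1"] n1 by fastforce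
      have p3': "owned_positions st (p ! (n - 1)) (p ! n) \<noteq> {} \<longrightarrow>
          s3 ''best'' 0 \<in> s1 ''obj'' ` owned_positions st (p ! (n - 1)) (p ! n) \<and>
          (\<forall>u \<in> owned_positions st (p ! (n - 1)) (p ! n).
            s1 ''pos'' (s3 ''best'' 0) \<le> s1 ''pos'' (s1 ''obj'' u))"
        using p3 by argo
      have b3: "s3 ''best'' 0 \<in> s1 ''obj'' ` owned_positions st (p ! (n - 1)) (p ! n)"
        "\<forall>u \<in> owned_positions st (p ! (n - 1)) (p ! n). s1 ''pos'' (s3 ''best'' 0) \<le> s1 ''pos'' (s1 ''obj'' u)"
        using mp[OF p3' last(1)] by simp_all
      then have best: "s3 ''best'' 0 = ob n" using last(2) by (simp add: s1)
      define s4 where "s4 = s3(''o'' := (s3 ''o'')(0 := ob n))"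
      have s4: "s4 ''y'' 0 = p ! n" "s4 ''o'' 0 = ob n" "\<And>v. v \<notin> ?fr \<Longrightarrow> s4 v = st v"
        "s4 ''owner'' = st ''owner''" by (auto simp: s4_def fr3 s1)
      have I4: "I 0 s4"
        unfolding I_def
      proof (intro conjI exI[of _ n])
        show "unchanged ?fr st s4" using s4(3) by blast
      qed (use s4(1,2,4) in simp_all)
      show ?thesis
        apply (simp add: best s4_def[symmetric])
        apply (rule run_mono)
         apply (rule run_while[where I = I and N = "(6 * G + 8) * n", OF I4])
        subgoal premises q for \<tau> s5
        proof -
          obtain j where "\<tau> \<le> (6 * G + 8) * (n - j)" using q unfolding I_def by blast
          also have "\<dots> \<le> (6 * G + 8) * n" by (intro mult_le_mono2) simp
          finally show ?thesis .
        qed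
        subgoal premises q for \<tau> s5
        proof -
          have fr5: "s5 v = st v" if "v \<notin> ?fr" for v using q(1) that unfolding I_def by (elim conjE) simp
          obtain j where j: "j \<le> n" "s5 ''y'' 0 = p ! j" "1 \<le> j \<longrightarrow> s5 ''o'' 0 = ob j"
            "\<tau> \<le> (6 * G + 8) * (n - j)"
            "\<And>t. j < t \<Longrightarrow> t \<le> n \<Longrightarrow> s5 ''owner'' (ob t) = Suc (p ! (t - 1))"
            "\<And>a. a \<notin> ob ` {j<..n} \<Longrightarrow> s5 ''owner'' a = st ''owner'' a"
            using q(1) unfolding I_def by blast
          have "j \<noteq> 0"
          proof
            assume "j = 0"
            then show False using q(2) j(2) zi(2) by (simp add: fr5)
          qed
          then obtain j' where j': "j = Suc j'" by (cases j) auto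
          have o5: "s5 ''o'' 0 = ob j" using j(3) j' by simp
          have p5: "s5 ''par'' (p ! j) = p ! j'" using par[of j'] j(1) j' by (simp add: fr5)
          define s6 where "s6 = s5(''x'' := (s5 ''x'')(0 := p ! j'))"
          have s6: "s6 ''x'' 0 = p ! j'" "\<And>v. v \<noteq> ''x'' \<Longrightarrow> s6 v = s5 v" by (auto simp: s6_def)
          have rl6: "range_length s6 (p ! j') = range_length st (p ! j')"
            by (simp add: range_length_def s6 fr5)
          note fb6 = run_find_best[of "''x''" "''x''" s6, unfolded s6(1) rl6]
          \<comment> \<open>Objects moved so far went to agents at position \<open>j\<close> or
            later, so the agent at \<open>j'\<close> still owns exactly what he owned before the
            trade.\<close>
          have ownj: "s5 ''owner'' a = Suc (p ! j') \<longleftrightarrow> a = ob j'" if "1 \<le> j'" for a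
          proof (cases "a \<in> ob ` {j<..n}")
            case True
            then obtain t where t: "j < t" "t \<le> n" "a = ob t" by auto
            then have "s5 ''owner'' a \<noteq> Suc (p ! j')"
              using j(5)[of t] pinj[of "t - 1" j'] j' by auto
            moreover have "a \<noteq> ob j'" using inj[of j' t] t j' that by auto
            ultimately show ?thesis by simp
          next
            case False
            have "w (p ! j') = {ob j'}" using shd that j(1) j' by auto
            then show ?thesis using j(6)[OF False] own[of a "p ! j'"] by auto
          qed
          show ?thesis
            apply (simp add: j(2) p5 split del: if_split)
            apply (simp only: s6_def[symmetric] One_nat_def[symmetric])
            apply (rule run_mono[OF fb6])
              apply simp
             apply simp
            subgoal premises q7 for t7 s7
            proof -
              have fr7: "s7 v = s6 v" if "v \<notin> find_vars" for v using q7 that by (elim conjE) simp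
              have t7: "t7 \<le> 6 * G + 3" using q7 G[of j'] j(1) j' by fastforce
              have best7: "s7 ''best'' 0 = ob j'" if j1: "1 \<le> j'"
              proof -
                obtain u where u: "u \<in> {st ''start'' (p ! j')..<st ''end'' (p ! j')}"
                  "ob j' = st ''obj'' u" using range[OF j1] j(1) j' by auto
                then have "u \<in> owned_positions s6 (p ! j') (p ! j')"
                  using ownj[OF j1] by (simp add: owned_positions_def s6 fr5)
                then have "s7 ''best'' 0 \<in> s6 ''obj'' ` owned_positions s6 (p ! j') (p ! j')"
                  using q7 by blast
                then show ?thesis using ownj[OF j1] by (auto simp: owned_positions_def s6)
              qed
              have x7: "s7 ''o'' 0 = ob j" "s7 ''x'' 0 = p ! j'" "s7 ''owner'' = s5 ''owner''"
                by (simp_all add: fr7 s6 o5)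
              define s8 where "s8 = s7(''owner'' := (s7 ''owner'')(ob j := Suc (p ! j')),
                ''o'' := (s7 ''o'')(0 := s7 ''best'' 0), ''y'' := (s7 ''y'')(0 := p ! j'))"
              have "I (\<tau> + (t7 + 5)) s8"
                unfolding I_def
              proof (intro conjI exI[of _ j'])
                show "j' \<le> n" "s8 ''y'' 0 = p ! j'" using j(1) j' by (simp_all add: s8_def)
                show "1 \<le> j' \<longrightarrow> s8 ''o'' 0 = ob j'" using best7 by (simp add: s8_def)
                have "n - j' = Suc (n - j)" using j(1) j' by simp
                then show "\<tau> + (t7 + 5) \<le> (6 * G + 8) * (n - j')" using j(4) t7 by simp
                show "\<forall>t. j' < t \<and> t \<le> n \<longrightarrow> s8 ''owner'' (ob t) = Suc (p ! (t - 1))"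
                proof (intro allI impI, elim conjE)
                  fix t assume t: "j' < t" "t \<le> n"
                  show "s8 ''owner'' (ob t) = Suc (p ! (t - 1))"
                  proof (cases "t = j")
                    case True then show ?thesis using j' by (simp add: s8_def)
                  next
                    case False
                    then have "ob t \<noteq> ob j" using inj[of t j] t j(1) j' by auto
                    then show ?thesis using False t j' j(5)[of t] x7 by (simp add: s8_def)
                  qed
                qed
                show "\<forall>a. a \<notin> ob ` {j'<..n} \<longrightarrow> s8 ''owner'' a = st ''owner'' a"
                proof (intro allI impI)
                  fix a assume a: "a \<notin> ob ` {j'<..n}"
                  then have "a \<noteq> ob j" "a \<notin> ob ` {j<..n}" using j(1) j' by auto
                  then show "s8 ''owner'' a = st ''owner'' a" using j(6) x7 by (simp add: s8_def)
                qed
                show "unchanged ?fr st s8"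
                proof (intro allI impI)
                  fix v assume v: "v \<notin> ?fr"
                  then show "s8 v = st v" using fr7[of v] s6(2)[of v] fr5[OF v] by (simp add: s8_def)
                qed
              qed
              then show ?thesis
                by (simp add: x7 s8_def fun_upd_twist eval_nat_numeral)
            qed
            done
        qed
        subgoal premises q for t s5
        proof -
          obtain \<tau> where \<tau>: "t = Suc \<tau>" "I \<tau> s5" "s5 ''y'' 0 = s5 ''i'' 0" using q by auto
          have fr5: "unchanged ?fr st s5" using \<tau>(2) unfolding I_def by argo
          obtain j where j: "j \<le> n" "s5 ''y'' 0 = p ! j" "\<tau> \<le> (6 * G + 8) * (n - j)"
            "\<And>t. j < t \<Longrightarrow> t \<le> n \<Longrightarrow> s5 ''owner'' (ob t) = Suc (p ! (t - 1))"
            "\<And>a. a \<notin> ob ` {j<..n} \<Longrightarrow> s5 ''owner'' a = st ''owner'' a"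
            using \<tau>(2) unfolding I_def by blast
          have "s5 ''i'' 0 = p ! 0" using fr5 zi(2) by simp
          then have "p ! j = p ! 0" using j(2) \<tau>(3) by metis
          then have j0: "j = 0" using j(1) pinj[of j 0] by blast
          have "a \<in> w' q \<longleftrightarrow> s5 ''owner'' a = Suc q" for a q
          proof (cases "a \<in> ob ` {1..n}")
            case True
            then obtain t where t: "1 \<le> t" "t \<le> n" "a = ob t" by auto
            have "(\<exists>s < n. q = p ! s \<and> a = ob (Suc s)) \<longleftrightarrow> q = p ! (t - 1)"
            proof
              assume "\<exists>s < n. q = p ! s \<and> a = ob (Suc s)"
              then obtain s where "s < n" "q = p ! s" "ob (Suc s) = ob t" using t by auto
              then show "q = p ! (t - 1)" using inj[of "Suc s" t] t by auto
            next
              assume "q = p ! (t - 1)"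
              then show "\<exists>s < n. q = p ! s \<and> a = ob (Suc s)"
                using t by (intro exI[of _ "t - 1"]) simp
            qed
            moreover have "s5 ''owner'' a = Suc (p ! (t - 1))" using j(4)[of t] j0 t by simp
            ultimately show ?thesis using shifted_iff[OF sh disj, of a q] True by auto
          next
            case False
            then have "a \<notin> ob ` {0<..n}" by auto
            then have "s5 ''owner'' a = st ''owner'' a" using j(5) j0 by simp
            moreover have "a \<in> w' q \<longleftrightarrow> a \<in> w q"
              using shifted_iff[OF sh disj, of a q] False by auto
            ultimately show ?thesis using own by simp
          qed
          moreover have "\<tau> \<le> (6 * G + 8) * n" using j(3) j0 by simp
          ultimately show ?thesis using \<tau>(1) t3 fr5 by simp
        qed
        done
    qed
    done
qed


section \<open>The trading graph without the reachability condition\<close>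

text \<open>The trading graph for different objects contains different edges merely because
  different vertices are reached. Admitting every edge makes those away from \<open>i\<close> the
  same for all objects (\<open>full_graph_other\<close>), so knowledge gained in one search can be
  reused in the next.\<close>

definition full_graph ::
    "profile \<Rightarrow> ownership \<Rightarrow> nat \<Rightarrow> nat set \<Rightarrow> nat set \<Rightarrow> (nat \<times> nat) set" where
  "full_graph L w i B S =
     {(x, y). (x = i \<or> x \<in> S \<and> w x \<noteq> {}) \<and> \<not> labelled w x \<and> y \<in> S \<and>
              w y \<inter> wanted L w i B x \<noteq> {}}"

lemma full_graph_other: "x \<noteq> i \<Longrightarrow> (x, y) \<in> full_graph L w i B S \<longleftrightarrow> (x, y) \<in> full_graph L w i B' S"
  by (simp add: full_graph_def wanted_def)

context
  fixes n1 n2 L S w i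
  assumes L: "valid_profile n1 n2 L" and inv: "alloc_inv n1 n2 L S w"
    and i: "i \<notin> S" "i < n1"
begin

lemma trading_graph_full: "trading_graph L w i B S \<subseteq> full_graph L w i B S"
  using trading_graph_edge[OF L inv i] unfolding full_graph_def by blast

lemma full_graph_trading:
  assumes "(i, x) \<in> (full_graph L w i B S)\<^sup>*" "(x, y) \<in> full_graph L w i B S"
  shows "(x, y) \<in> trading_graph L w i B S"
  using assms
proof (induction arbitrary: y rule: rtrancl_induct)
  case base
  then show ?case by (auto simp: full_graph_def intro: trading_graph.source)
next
  case (step x z)
  then show ?case by (auto simp: full_graph_def intro: trading_graph.forward)
qed

lemma full_graph_relpow:
  "(i, y) \<in> (trading_graph L w i B S) ^^ n \<longleftrightarrow> (i, y) \<in> (full_graph L w i B S) ^^ n"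
proof (induction n arbitrary: y)
  case (Suc n)
  then show ?case
    using trading_graph_full[of B] full_graph_trading[OF relpow_imp_rtrancl] by (auto 4 3)
qed simp

lemma full_graph_edge:
  assumes "(i, x) \<in> (full_graph L w i B S) ^^ n"
  shows "(x, y) \<in> trading_graph L w i B S \<longleftrightarrow> (x, y) \<in> full_graph L w i B S"
  using trading_graph_full[of B] full_graph_trading[OF relpow_imp_rtrancl[OF assms]] by blast

lemma full_graph_rtrancl:
  "(i, y) \<in> (trading_graph L w i B S)\<^sup>* \<longleftrightarrow> (i, y) \<in> (full_graph L w i B S)\<^sup>*"
  unfolding rtrancl_is_UN_relpow using full_graph_relpow by simp

text \<open>Distances and parents inspect only edges that leave vertices reached from
  \<open>i\<close>, and there the two graphs agree.\<close>

lemma full_graph_bfs_path: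
  "bfs_path (trading_graph L w i B S) i z = bfs_path (full_graph L w i B S) i z"
proof -
  have d: "bfs_dist (trading_graph L w i B S) i y = bfs_dist (full_graph L w i B S) i y" for y
    by (simp add: bfs_dist_def full_graph_relpow)
  have "(i, x) \<in> trading_graph L w i B S ^^ m \<and> (x, y) \<in> trading_graph L w i B S \<longleftrightarrow>
      (i, x) \<in> full_graph L w i B S ^^ m \<and> (x, y) \<in> full_graph L w i B S" for x y m
    using full_graph_relpow full_graph_edge by metis
  then have "bfs_parent (trading_graph L w i B S) i = bfs_parent (full_graph L w i B S) i"
    unfolding bfs_parent_def d by simp
  then show ?thesis by (simp add: bfs_path_def d)
qed

lemma bfs_rule_full:
  "bfs_rule w (trading_graph L w i B S) i =
     bfs_path (full_graph L w i B S) i (LEAST z. labelled w z \<and> (i, z) \<in> (full_graph L w i B S)\<^sup>*)"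
  by (simp add: bfs_rule_def Let_def trading_graph_unlabelled[OF L inv i] full_graph_bfs_path
      full_graph_rtrancl)

lemma obtainable_iff:
  "a \<in> obtainable L w i S \<longleftrightarrow>
     a \<in> acceptable (L i) \<and> (\<exists>z. labelled w z \<and> (i, z) \<in> (full_graph L w i {a} S)\<^sup>*)"
proof -
  have "(i, z) \<in> (trading_graph L w i {a} S)\<^sup>+ \<longleftrightarrow> (i, z) \<in> (trading_graph L w i {a} S)\<^sup>*"
    if "labelled w z" for z
  proof -
    have "z \<noteq> i" using that i_unlabelled[OF L inv i] by blast
    then show ?thesis by (auto simp: rtrancl_eq_or_trancl)
  qed
  then show ?thesis unfolding obtainable_def full_graph_rtrancl[symmetric] by blast
qed

text \<open>By disjointness of the allocation the only edge leaving \<open>i\<close> goes to the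
  owner \<open>j\<close> of \<open>a\<close>, who is in \<open>M\<close>; from there
  \<open>M\<close> is never left.\<close>

lemma dead_not_obtainable:
  assumes M: "\<And>x. x \<in> M \<Longrightarrow> \<not> labelled w x" "i \<notin> M"
    and closed: "\<And>x y. x \<in> M \<Longrightarrow> (x, y) \<in> full_graph L w i {} S \<Longrightarrow> y \<in> M"
    and a: "a \<in> w j" "j \<in> M"
  shows "a \<notin> obtainable L w i S"
proof
  assume "a \<in> obtainable L w i S"
  then obtain z where z: "labelled w z" "(i, z) \<in> (full_graph L w i {a} S)\<^sup>*"
    using obtainable_iff by blast
  from z(2) have "z = i \<or> z \<in> M"
  proof induction
    case (step x y)
    show ?case
    proof (cases "x = i")
      case True
      then have "a \<in> w y" using step(2) by (auto simp: full_graph_def wanted_def)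
      then show ?thesis using a inv_disj[OF L inv] by (metis disjoint_iff)
    next
      case False
      then show ?thesis using step closed full_graph_other[OF False] by blast
    qed
  qed simp
  then show False using z(1) M(1) i_unlabelled[OF L inv i] by blast
qed

end


section \<open>Searching and trading for one agent\<close>

text \<open>\<open>s0\<close> is the store before \<open>i\<close> is processed, and
  \<open>bd j c\<close> is the position where the class with zero-based index \<open>c\<close> of
  agent \<open>j\<close> begins. \<open>len\<close> bounds also the ranges of agents without
  objects, which may be leftovers of unsuccessful searches.\<close>

locale agent_step =
  fixes n1 n2 :: nat and L :: profile and pr :: "nat \<Rightarrow> nat" and S :: "nat set" and w :: ownership
    and i k G :: nat and bd :: "nat \<Rightarrow> nat \<Rightarrow> nat" and s0 :: store
  assumes L: "valid_profile n1 n2 L" and inv: "alloc_inv n1 n2 L S w" and i: "i \<notin> S" "i < n1"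
    and pr: "common_order n2 pr"
    and bd_less: "\<And>j c. j < n1 \<Longrightarrow> c < length (L j) \<Longrightarrow> bd j c < bd j (Suc c)"
    and bd_G: "\<And>j c. j < n1 \<Longrightarrow> c < length (L j) \<Longrightarrow> bd j (Suc c) - bd j c \<le> G"
    and bd_obj: "\<And>j c. j < n1 \<Longrightarrow> c < length (L j) \<Longrightarrow> s0 ''obj'' ` {bd j c..<bd j (Suc c)} = L j ! c"
    and bd_inj: "\<And>j c. j < n1 \<Longrightarrow> c < length (L j) \<Longrightarrow> inj_on (s0 ''obj'') {bd j c..<bd j (Suc c)}"
    and bd_cls: "\<And>j c u. j < n1 \<Longrightarrow> c < length (L j) \<Longrightarrow> u \<in> {bd j c..<bd j (Suc c)} \<Longrightarrow> s0 ''cls'' u = Suc c"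
    and bd_start: "bd i 0 = s0 ''off'' i" and bd_end: "bd i (length (L i)) = s0 ''off'' (Suc i)"
    and pos: "\<And>a. a < n2 \<Longrightarrow> s0 ''pos'' a = pr a"
    and own: "\<And>a j. a \<in> w j \<longleftrightarrow> s0 ''owner'' a = Suc j"
    and ranges: "\<And>j. j \<in> S \<Longrightarrow> w j \<noteq> {} \<Longrightarrow> \<exists>c < length (L j). own_rank n2 L w j = Suc c \<and>
      s0 ''start'' j = bd j c \<and> s0 ''end'' j = bd j (Suc c)"
    and len: "\<And>j. range_length s0 j \<le> G"
    and k: "s0 ''k'' 0 = k"
begin

definition "owners = {j \<in> S. w j \<noteq> {}}"

definition static :: "store \<Rightarrow> bool" where
  "static s \<longleftrightarrow>
     (\<forall>v \<in> {''obj'', ''cls'', ''pos'', ''off'', ''order'', ''n1'', ''k'', ''partner''}. s v = s0 v) \<and>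
     s ''i'' 0 = i \<and> s ''e'' 0 = s0 ''off'' (Suc i) \<and>
     (\<forall>j. j \<noteq> i \<longrightarrow> s ''start'' j = s0 ''start'' j \<and> s ''end'' j = s0 ''end'' j) \<and>
     (\<forall>j. range_length s j \<le> G)"

definition marked :: "store \<Rightarrow> nat set" where
  "marked s = {y. s ''mark'' y = Suc k}"

text \<open>Marked agents are owners and so differ from \<open>i\<close>; by
  \<open>full_graph_other\<close> their edges are the same for every object tried, and
  \<open>{}\<close> stands for all of these choices.\<close>

definition dead_marks :: "store \<Rightarrow> bool" where
  "dead_marks s \<longleftrightarrow> (\<forall>y. s ''mark'' y \<le> Suc k) \<and> marked s \<subseteq> owners \<and>
     (\<forall>x \<in> marked s. \<not> labelled w x \<and> (\<forall>y. (x, y) \<in> full_graph L w i {} S \<longrightarrow> y \<in> marked s))"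

lemma staticD:
  assumes "static s"
  shows "s ''obj'' = s0 ''obj''" "s ''cls'' = s0 ''cls''" "s ''pos'' = s0 ''pos''" "s ''off'' = s0 ''off''"
    "s ''order'' = s0 ''order''" "s ''n1'' = s0 ''n1''" "s ''k'' = s0 ''k''" "s ''partner'' = s0 ''partner''"
    "s ''i'' 0 = i" "s ''e'' 0 = s0 ''off'' (Suc i)"
    and "\<And>j. j \<noteq> i \<Longrightarrow> s ''start'' j = s0 ''start'' j" "\<And>j. j \<noteq> i \<Longrightarrow> s ''end'' j = s0 ''end'' j"
    and "\<And>j. range_length s j \<le> G"
  using assms unfolding static_def by simp_all

lemma i_owners: "i \<notin> owners" and finite_owners: "finite owners"
  and owners_n1: "owners \<subseteq> {..<n1}"
  using i inv_S[OF L inv] finite_subset[of owners "{..<n1}"] by (auto simp: owners_def)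

lemma disj: "\<forall>i j. i \<noteq> j \<longrightarrow> w i \<inter> w j = {}" by (rule inv_disj[OF L inv])

lemma owner_range:
  assumes "static s" "x \<in> owners"
  shows "s ''obj'' ` {s ''start'' x..<s ''end'' x} = nth_class (L x) (own_rank n2 L w x)"
    and "inj_on (s ''obj'') {s ''start'' x..<s ''end'' x}"
proof -
  have x: "x \<in> S" "w x \<noteq> {}" "x < n1" "x \<noteq> i" using assms(2) owners_n1 i by (auto simp: owners_def)
  obtain c where c: "c < length (L x)" "own_rank n2 L w x = Suc c"
    "s0 ''start'' x = bd x c" "s0 ''end'' x = bd x (Suc c)" using ranges[OF x(1,2)] by blast
  show "s ''obj'' ` {s ''start'' x..<s ''end'' x} = nth_class (L x) (own_rank n2 L w x)"
    "inj_on (s ''obj'') {s ''start'' x..<s ''end'' x}"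
    using bd_obj[OF x(3) c(1)] bd_inj[OF x(3) c(1)] c
    by (simp_all add: staticD[OF assms(1)] x(4) nth_class_Suc)
qed

text \<open>The program scans the whole class of \<open>x\<close>, including what \<open>x\<close>
  owns, whereas \<open>wanted\<close> omits it; for \<open>y \<noteq> x\<close> disjointness removes
  the difference.\<close>

lemma owned_wanted:
  assumes s: "static s" "s ''owner'' = s0 ''owner''" and x: "x \<in> insert i owners"
    and y: "y \<noteq> x" and ri: "x = i \<Longrightarrow> s ''obj'' ` {s ''start'' i..<s ''end'' i} = {a}"
  shows "s ''obj'' ` owned_positions s x y = w y \<inter> wanted L w i {a} x"
proof -
  have "s ''obj'' ` owned_positions s x y = s ''obj'' ` {s ''start'' x..<s ''end'' x} \<inter> w y"
    unfolding owned_positions_def using own s(2) by auto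
  moreover have "w y \<inter> wanted L w i {a} x = w y \<inter> s ''obj'' ` {s ''start'' x..<s ''end'' x}"
  proof (cases "x = i")
    case True then show ?thesis using ri by (simp add: wanted_def)
  next
    case False
    then have "x \<in> owners" using x by simp
    then have "wanted L w i {a} x = s ''obj'' ` {s ''start'' x..<s ''end'' x} - w x"
      using wanted_other[OF L inv, of x i "{a}"] owner_range(1)[OF s(1)] False
      by (simp add: owners_def)
    then show ?thesis using disj y by auto
  qed
  ultimately show ?thesis by blast
qed

text \<open>Since \<open>alloc_inv\<close> covers whole classes, the range of an owner contains no
  free object, and every position scanned leads to a genuine agent.\<close>

lemma search_graph_static:
  assumes s: "static s" "s ''owner'' = s0 ''owner''"
    and ri: "s ''obj'' ` {s ''start'' i..<s ''end'' i} = {a}" and a: "a \<in> w y0"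
  shows "search_graph (full_graph L w i {a} S) (labelled w) owners i s"
proof -
  let ?F = "full_graph L w i {a} S"
  have F: "?F \<subseteq> insert i owners \<times> owners" by (auto simp: full_graph_def owners_def)
  have y0: "y0 \<in> owners" using a inv_out[OF L inv, of y0] by (auto simp: owners_def)
  have "(labelled w x \<longleftrightarrow> 1 < card (owned_positions s x x)) \<and>
        (labelled w x \<longrightarrow> (\<forall>y. (x, y) \<notin> ?F)) \<and>
        (\<not> labelled w x \<longrightarrow>
          (\<forall>u \<in> {s ''start'' x..<s ''end'' x}. \<exists>y \<in> owners. s ''owner'' (s ''obj'' u) = Suc y) \<and>
          (\<forall>y. (x, y) \<in> ?F \<longleftrightarrow>
             y \<noteq> x \<and> (\<exists>u \<in> {s ''start'' x..<s ''end'' x}. s ''owner'' (s ''obj'' u) = Suc y)))"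
    if x: "x \<in> insert i owners" for x
  proof -
    have lab: "labelled w x \<longleftrightarrow> 1 < card (owned_positions s x x)"
    proof (cases "x = i")
      case True
      have "owned_positions s i i = {}"
        using own[of _ i] wi[OF L inv i] s(2) by (auto simp: owned_positions_def)
      then show ?thesis using True i_unlabelled[OF L inv i] by simp
    next
      case False
      then have xo: "x \<in> owners" using x by simp
      have "s ''obj'' ` owned_positions s x x = s ''obj'' ` {s ''start'' x..<s ''end'' x} \<inter> w x"
        unfolding owned_positions_def using own s(2) by auto
      also have "\<dots> = w x"
        unfolding owner_range(1)[OF s(1) xo] using inv_class[OF L inv, of x] by auto
      finally have im: "s ''obj'' ` owned_positions s x x = w x" .
      have "owned_positions s x x \<subseteq> {s ''start'' x..<s ''end'' x}"
        by (auto simp: owned_positions_def)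
      then have "inj_on (s ''obj'') (owned_positions s x x)"
        by (rule inj_on_subset[OF owner_range(2)[OF s(1) xo]])
      then have "card (w x) = card (owned_positions s x x)"
        using card_image im by metis
      then show ?thesis by (simp add: labelled_def)
    qed
    have R: "\<exists>y \<in> owners. s ''owner'' (s ''obj'' u) = Suc y"
      if u: "u \<in> {s ''start'' x..<s ''end'' x}" for u
    proof (cases "x = i")
      case True
      then have "s ''obj'' u = a" using ri u by auto
      then show ?thesis using y0 own a s(2) by auto
    next
      case False
      then have xo: "x \<in> owners" using x by simp
      have "s ''obj'' u \<in> s ''obj'' ` {s ''start'' x..<s ''end'' x}" using u by (rule imageI)
      then have "s ''obj'' u \<in> (\<Union>j \<in> S. w j)"
        using inv_covered[OF L inv, of x] xo unfolding owner_range(1)[OF s(1) xo] owners_def by blast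
      then show ?thesis using own s(2) by (auto simp: owners_def)
    qed
    have E: "(x, y) \<in> ?F \<longleftrightarrow>
        y \<noteq> x \<and> (\<exists>u \<in> {s ''start'' x..<s ''end'' x}. s ''owner'' (s ''obj'' u) = Suc y)"
      if ul: "\<not> labelled w x" for y
    proof (cases "y = x")
      case True
      have "w x \<inter> wanted L w i {a} x = {} \<or> x = i" by (auto simp: wanted_def)
      then have "(x, x) \<notin> ?F" using i by (auto simp: full_graph_def)
      then show ?thesis using True by simp
    next
      case False
      have ow: "s ''obj'' ` owned_positions s x y = w y \<inter> wanted L w i {a} x"
        by (rule owned_wanted[OF s x False ri])
      have "(x, y) \<in> ?F \<longleftrightarrow> w y \<inter> wanted L w i {a} x \<noteq> {}"
        using x ul inv_out[OF L inv, of y] by (auto simp: full_graph_def owners_def)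
      also have "\<dots> \<longleftrightarrow> owned_positions s x y \<noteq> {}" unfolding ow[symmetric] by simp
      finally show ?thesis using False by (auto simp: owned_positions_def)
    qed
    show ?thesis
    proof (intro conjI impI allI ballI)
      show "(x, y) \<notin> ?F" if "labelled w x" for y using that by (simp add: full_graph_def)
    qed (use lab R E in blast)+
  qed
  then show ?thesis
    unfolding search_graph_def using finite_owners i_owners F by blast
qed

lemma dead_marks_not_obtainable:
  assumes "dead_marks s" "a \<in> w j" "j \<in> marked s"
  shows "a \<notin> obtainable L w i S"
  using assms(1) i_owners unfolding dead_marks_def
  by (intro dead_not_obtainable[OF L inv i _ _ _ assms(2,3)]) blast+

text \<open>Parents are known to be canonical only outside \<open>M\<close>. This suffices because
  the path to the labelled target avoids \<open>M\<close> altogether.\<close>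

lemma run_trade_static:
  assumes s: "static s" "s ''owner'' = s0 ''owner''"
    and ri: "s ''obj'' ` {s ''start'' i..<s ''end'' i} = {a}"
    and F: "F = full_graph L w i {a} S"
    and M: "\<And>x. x \<in> M \<Longrightarrow> \<not> labelled w x" "\<And>x y. (x, y) \<in> F \<Longrightarrow> x \<in> M \<Longrightarrow> y \<in> M"
    and z: "least_labelled (labelled w) {y. (i, y) \<in> F\<^sup>*} (s ''z'' 0)" "0 < s ''z'' 0"
    and par: "\<And>y. (i, y) \<in> F\<^sup>* \<Longrightarrow> y \<notin> M \<Longrightarrow> y \<noteq> i \<Longrightarrow> s ''par'' y = bfs_parent F i y"
    and G: "\<And>j. range_length s j \<le> G"
  shows "run trade s (\<lambda>t s'. t \<le> (6 * G + 8) * n1 \<and>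
    (\<forall>b j. b \<in> trading pr bfs_rule L w i a S j \<longleftrightarrow> s' ''owner'' b = Suc j) \<and>
    unchanged trade_vars s s')"
proof -
  let ?E = "trading_graph L w i {a} S" and ?wt = "wanted L w i {a}"
  obtain zt where zt: "s ''z'' 0 = Suc zt" "labelled w zt" "(i, zt) \<in> F\<^sup>*"
    "\<And>y. (i, y) \<in> F\<^sup>* \<Longrightarrow> labelled w y \<Longrightarrow> zt \<le> y"
    using z by (auto simp: least_labelled_def)
  have zL: "(LEAST z. labelled w z \<and> (i, z) \<in> F\<^sup>*) = zt"
    by (rule Least_equality) (use zt in auto)
  define p where "p = bfs_path F i zt"
  have rule: "bfs_rule w ?E i = p" using bfs_rule_full[OF L inv i, of "{a}"] zL by (simp add: F p_def)
  have tp: "trading_path w ?E i p"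
    unfolding rule[symmetric]
    by (rule trading_path_bfs_rule[OF zt(2)])
      (use zt(3) F in \<open>simp_all add: trading_graph_unlabelled[OF L inv i] full_graph_rtrancl[OF L inv i]
        i_unlabelled[OF L inv i]\<close>)
  obtain n ob where sh: "shifted w p n ob (trade_along pr ?wt w p)" and p0: "p ! 0 = i"
    and obn: "ob n = highest pr (w (p ! n) \<inter> ?wt (p ! (n - 1)))"
    and pS: "\<And>s. 1 \<le> s \<Longrightarrow> s \<le> n \<Longrightarrow> p ! s \<in> S"
    and wt: "\<And>s. s < n \<Longrightarrow> ob (Suc s) \<in> ?wt (p ! s)"
    using trade_shifted[OF L inv i tp, of pr] by blast
  note shd = sh[unfolded shifted_def]
  have n: "bfs_dist F i zt = n" using shd bfs_path_length[of F i zt] by (simp add: p_def)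
  have n1: "1 \<le> n" using shd by blast
  have own_p: "p ! s \<in> owners" if "1 \<le> s" "s \<le> n" for s
    using pS[OF that] shifted_old[OF sh that] by (auto simp: owners_def)
  have pinj: "p ! s = p ! t \<longleftrightarrow> s = t" if "s \<le> n" "t \<le> n" for s t
    using shd that by (simp add: nth_eq_iff_index_eq)
  have ins: "p ! s \<in> insert i owners" if "s \<le> n" for s
    using that own_p[of s] p0 by (cases s) auto
  \<comment> \<open>The path is duplicate-free and consists of agents, so its \<open>Suc n\<close>
    vertices number at most \<open>n1\<close>.\<close>
  have np: "Suc n \<le> n1"
  proof -
    have "set p \<subseteq> {..<n1}"
    proof
      fix x assume "x \<in> set p"
      then obtain s where "s \<le> n" "x = p ! s" using shd by (metis in_set_conv_nth less_Suc_eq_le)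
      then show "x \<in> {..<n1}" using ins[of s] owners_n1 i by auto
    qed
    then have "card (set p) \<le> n1" using card_mono[of "{..<n1}"] by fastforce
    then show ?thesis using shd distinct_card[of p] by simp
  qed
  \<comment> \<open>Backwards along the path: the target is labelled and so not in \<open>M\<close>,
    and a predecessor in \<open>M\<close> would drag its successor into the closed set
    \<open>M\<close>.\<close>
  have notM: "p ! s \<notin> M" if "s \<le> n" for s
    using that
  proof (induction rule: inc_induct)
    case base
    have "p ! n = zt" using bfs_path_last[of F i zt] by (simp add: p_def n)
    then show ?case using M(1) zt(2) by blast
  next
    case (step s)
    have "(p ! s, p ! Suc s) \<in> F"
      using bfs_path_edge[OF zt(3), of s] step by (simp add: p_def n)
    then show ?case using M(2) step.IH by blast
  qed
  let ?P = "owned_positions s (p ! (n - 1)) (p ! n)"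
  let ?W = "w (p ! n) \<inter> ?wt (p ! (n - 1))"
  have imP: "s ''obj'' ` ?P = ?W"
    using ins[of "n - 1"] pinj[of "n - 1" n] n1 by (intro owned_wanted[OF s _ _ ri]) auto
  have obW: "ob n \<in> ?W" using wt[of "n - 1"] n1 shd by auto
  have "run trade s (\<lambda>t s'. t \<le> (6 * G + 8) * Suc n \<and>
    (\<forall>b j. b \<in> trade_along pr ?wt w p j \<longleftrightarrow> s' ''owner'' b = Suc j) \<and>
    unchanged trade_vars s s')"
  proof (rule run_trade[OF sh disj])
    show "b \<in> w j \<longleftrightarrow> s ''owner'' b = Suc j" for b j using own s(2) by simp
    show "ob m \<in> s ''obj'' ` {s ''start'' (p ! m)..<s ''end'' (p ! m)}" if m: "1 \<le> m" "m < n" for m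
    proof -
      have mo: "p ! m \<in> owners" using own_p m by simp
      have "ob m \<in> w (p ! m)" using shifted_old[OF sh] m by simp
      then show ?thesis unfolding owner_range(1)[OF s(1) mo] using inv_class[OF L inv] by blast
    qed
    show "?P \<noteq> {}" using imP obW by blast
    fix b assume b: "b \<in> s ''obj'' ` ?P"
      and le: "\<forall>u \<in> ?P. s ''pos'' b \<le> s ''pos'' (s ''obj'' u)"
    have W: "?W \<subseteq> {..<n2}" using inv_bound[OF L inv, of "p ! n"] by blast
    have "highest pr ?W = b"
    proof (rule highest_eq[OF common_order_inj[OF pr W]])
      show "b \<in> ?W" using b imP by simp
      fix b' assume b': "b' \<in> ?W"
      then have "b' \<in> s ''obj'' ` ?P" using imP by simp
      then have "s ''pos'' b \<le> s ''pos'' b'" using le by (elim imageE) simp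
      moreover have "b < n2" "b' < n2" using W b' \<open>b \<in> ?W\<close> by blast+
      ultimately show "pr b \<le> pr b'" by (simp add: pos staticD(3)[OF s(1)])
    qed
    then show "b = ob n" using obn by simp
  next
    show "s ''par'' (p ! Suc m) = p ! m" if m: "m < n" for m
    proof -
      have "(i, p ! Suc m) \<in> F\<^sup>*" using bfs_path_facts(1)[OF zt(3), of "Suc m"] m by (simp add: p_def n)
      moreover have "p ! Suc m \<noteq> i" using pinj[of "Suc m" 0] p0 m by simp
      ultimately have "s ''par'' (p ! Suc m) = bfs_parent F i (p ! Suc m)"
        using par notM m by simp
      then show ?thesis using bfs_path_parent[of m F i zt] m by (simp add: p_def n)
    qed
    have "p ! n = zt" using bfs_path_last[of F i zt] by (simp add: p_def n)
    then show "s ''z'' 0 = Suc (p ! n)" using zt(1) by simp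
    show "s ''i'' 0 = p ! 0" using staticD(9)[OF s(1)] p0 by simp
    show "range_length s (p ! m) \<le> G" for m by (rule G)
  qed
  then show ?thesis
  proof (rule run_mono)
    fix t s' assume *: "t \<le> (6 * G + 8) * Suc n \<and>
      (\<forall>b j. b \<in> trade_along pr ?wt w p j \<longleftrightarrow> s' ''owner'' b = Suc j) \<and>
      unchanged trade_vars s s'"
    have "(6 * G + 8) * Suc n \<le> (6 * G + 8) * n1" by (rule mult_le_mono2[OF np])
    then have "t \<le> (6 * G + 8) * n1" using * by linarith
    then show "t \<le> (6 * G + 8) * n1 \<and>
      (\<forall>b j. b \<in> trading pr bfs_rule L w i a S j \<longleftrightarrow> s' ''owner'' b = Suc j) \<and>
      unchanged trade_vars s s'"
      using * unfolding trading_def rule by argo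
  qed
qed

section \<open>One search on behalf of the current agent\<close>

definition searched :: "store \<Rightarrow> bool" where
  "searched s \<longleftrightarrow> static s \<and> dead_marks s \<and> s ''owner'' = s0 ''owner''"

definition untouched :: "store \<Rightarrow> store \<Rightarrow> bool" where
  "untouched s s' \<longleftrightarrow> (\<forall>v \<in> {''p'', ''q'', ''g'', ''c''}. s' v = s v)"

text \<open>The owner \<open>y0\<close> of the object tried is unmarked before and marked
  afterwards, so the constant overhead can be charged to new marks. Only a failed search yields
  \<open>dead_marks\<close>: after a success some marked agents do reach a labelled one.\<close>

lemma run_search:
  assumes s: "searched s" and G: "1 \<le> G"
    and c: "s ''c'' 0 = Suc u" "s0 ''obj'' u = a" and a: "a \<in> w y0" "y0 \<notin> marked s"
    and acc: "a \<in> acceptable (L i)"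
  shows "run search s (\<lambda>t s'. t \<le> 35 * (G + 1) * card (marked s' - marked s) \<and>
    static s' \<and> s' ''owner'' = s0 ''owner'' \<and> untouched s s' \<and>
    (\<forall>y. s' ''mark'' y \<le> Suc k) \<and> marked s \<subseteq> marked s' \<and> y0 \<in> marked s' \<and> marked s' \<subseteq> owners \<and>
    (s' ''z'' 0 = 0 \<longrightarrow> dead_marks s' \<and> a \<notin> obtainable L w i S) \<and>
    (0 < s' ''z'' 0 \<longrightarrow> a \<in> obtainable L w i S \<and>
       run trade s' (\<lambda>t s''. t \<le> (6 * G + 8) * n1 \<and>
        (\<forall>b j. b \<in> trading pr bfs_rule L w i a S j \<longleftrightarrow> s'' ''owner'' b = Suc j) \<and>
        unchanged trade_vars s' s'')))"
proof -
  define F where "F = full_graph L w i {a} S"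
  have st: "static s" and dm: "dead_marks s" and so: "s ''owner'' = s0 ''owner''"
    using s by (simp_all add: searched_def)
  have i0: "s ''i'' 0 = i" by (rule staticD(9)[OF st])
  define s1 where "s1 = s(''start'' := (s ''start'')(i := u), ''end'' := (s ''end'')(i := Suc u),
    ''queue'' := (s ''queue'')(0 := i), ''dist'' := (s ''dist'')(i := 0),
    ''h'' := (s ''h'')(0 := 0), ''t'' := (s ''t'')(0 := 1), ''z'' := (s ''z'')(0 := 0))"
  have s1: "s1 ''start'' = (s ''start'')(i := u)" "s1 ''end'' = (s ''end'')(i := Suc u)"
    "s1 ''queue'' 0 = i" "s1 ''dist'' i = 0" "s1 ''h'' 0 = 0" "s1 ''t'' 0 = 1" "s1 ''z'' 0 = 0"
    "\<And>v. v \<notin> {''start'', ''end'', ''queue'', ''dist'', ''h'', ''t'', ''z''} \<Longrightarrow> s1 v = s v"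
    by (auto simp: s1_def)
  have "range_length s1 j \<le> G" for j
    using staticD(13)[OF st, of j] G by (simp add: s1 range_length_def)
  then have st1: "static s1"
    using st unfolding static_def by (simp add: s1)
  have ri1: "s1 ''obj'' ` {s1 ''start'' i..<s1 ''end'' i} = {a}"
    using c(2) staticD(1)[OF st1] by (simp add: s1)
  have so1: "s1 ''owner'' = s0 ''owner''" using so by (simp add: s1)
  have g: "search_graph F (labelled w) owners i s1"
    unfolding F_def by (rule search_graph_static[OF st1 so1 ri1 a(1)])
  have k1: "s1 ''k'' 0 = k" using staticD(7)[OF st1] k by simp
  have m1: "s1 ''mark'' = s ''mark''" by (simp add: s1)
  define M where "M = marked s"
  have M: "\<And>x. x \<in> M \<Longrightarrow> \<not> labelled w x" "i \<notin> M"
    using dm i_owners unfolding dead_marks_def M_def by blast+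
  have closed: "y \<in> M" if "(x, y) \<in> F" "x \<in> M" for x y
  proof -
    have "x \<noteq> i" using that M by blast
    then show ?thesis
      using that dm full_graph_other[of x i y L w "{a}" S "{}"] unfolding F_def dead_marks_def M_def by blast
  qed
  have loop: "run (While (Less (var ''h'') (var ''t'')) visit) s1 (\<lambda>t s'.
    t \<le> (15 * G + 12) * Suc (card ({y. s' ''mark'' y = Suc (s1 ''k'' 0)} - M)) + 1 \<and>
    {y. s' ''mark'' y = Suc (s1 ''k'' 0)} = M \<union> ({y. (i, y) \<in> F\<^sup>*} - {i}) \<and>
    (\<forall>y. s' ''mark'' y \<le> Suc (s1 ''k'' 0)) \<and>
    least_labelled (labelled w) {y. (i, y) \<in> F\<^sup>*} (s' ''z'' 0) \<and>
    (\<forall>y. (i, y) \<in> F\<^sup>* \<and> y \<notin> M \<and> y \<noteq> i \<longrightarrow> s' ''par'' y = bfs_parent F i y) \<and>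
    unchanged (writes visit) s1 s')"
  proof (rule run_search_loop[OF g])
    show "range_length s1 x \<le> G" for x by (rule staticD(13)[OF st1])
    show "M = {y. s1 ''mark'' y = Suc (s1 ''k'' 0)}" by (simp add: k1 m1 M_def marked_def)
    show "s1 ''mark'' y \<le> Suc (s1 ''k'' 0)" for y using dm by (simp add: k1 m1 dead_marks_def)
  qed (fact M closed s1)+
  have reach: "x = i \<or> x \<in> owners" if "(i, x) \<in> F\<^sup>*" for x
    using that by (induction) (auto simp: F_def full_graph_def owners_def)
  show ?thesis
    unfolding search_def
    apply (simp add: i0 c(1) split del: if_split)
    apply (simp only: s1_def[symmetric, unfolded One_nat_def])
    apply (rule run_mono[OF loop])
    subgoal premises p for t2 s2
    proof -
      have fr: "s2 v = s1 v" if "v \<notin> writes visit" for v using p that by blast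
      have mk: "marked s2 = M \<union> ({y. (i, y) \<in> F\<^sup>*} - {i})" "\<forall>y. s2 ''mark'' y \<le> Suc k"
        and t2: "t2 \<le> (15 * G + 12) * Suc (card (marked s2 - M)) + 1"
        and z2: "least_labelled (labelled w) {y. (i, y) \<in> F\<^sup>*} (s2 ''z'' 0)"
        and par: "\<And>y. (i, y) \<in> F\<^sup>* \<Longrightarrow> y \<notin> M \<Longrightarrow> y \<noteq> i \<Longrightarrow> s2 ''par'' y = bfs_parent F i y"
        using p unfolding k1 marked_def by blast+
      have fr2: "s2 ''obj'' = s1 ''obj''" "s2 ''cls'' = s1 ''cls''" "s2 ''pos'' = s1 ''pos''"
        "s2 ''off'' = s1 ''off''" "s2 ''order'' = s1 ''order''" "s2 ''n1'' = s1 ''n1''"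
        "s2 ''k'' = s1 ''k''" "s2 ''partner'' = s1 ''partner''" "s2 ''i'' = s1 ''i''"
        "s2 ''e'' = s1 ''e''" "s2 ''start'' = s1 ''start''" "s2 ''end'' = s1 ''end''"
        "s2 ''owner'' = s1 ''owner''" "s2 ''p'' = s1 ''p''" "s2 ''q'' = s1 ''q''" "s2 ''g'' = s1 ''g''"
        "s2 ''c'' = s1 ''c''"
        by (rule fr, simp add: writes_visit)+
      have st2: "static s2" using st1 unfolding static_def range_length_def by (simp add: fr2)
      have so2: "s2 ''owner'' = s0 ''owner''" using so1 fr2 by simp
      have un: "untouched s s2" unfolding untouched_def by (simp add: fr2 s1)
      have y0o: "y0 \<in> owners" using a(1) inv_out[OF L inv, of y0] by (auto simp: owners_def)
      have "(i, y0) \<in> F"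
        using a(1) y0o i_unlabelled[OF L inv i] by (auto simp: F_def full_graph_def owners_def wanted_def)
      then have y0: "y0 \<in> marked s2" unfolding mk using y0o i_owners by auto
      have mo: "marked s2 \<subseteq> owners" using dm reach unfolding mk M_def dead_marks_def by blast
      have fin: "finite (marked s2)" using mo finite_owners finite_subset by blast
      have "y0 \<in> marked s2 - M" using y0 a(2) by (simp add: M_def)
      then have c1: "1 \<le> card (marked s2 - M)"
        using fin card_gt_0_iff[of "marked s2 - M"] by (metis One_nat_def Suc_leI empty_iff finite_Diff)
      \<comment> \<open>With at least one new mark, \<open>Suc m\<close> is at most
        \<open>2 * m\<close>; this turns the bound into \<open>30 * G + 32\<close> units per mark,
        rounded up to \<open>35 * (G + 1)\<close>.\<close>
      have "(15 * G + 12) * Suc (card (marked s2 - M)) + 8 \<le> 35 * (G + 1) * card (marked s2 - M)"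
      proof -
        define m where "m = card (marked s2 - M)"
        have "Suc m \<le> 2 * m" "8 \<le> 8 * m" using c1 by (simp_all add: m_def)
        then have "(15 * G + 12) * Suc m + 8 \<le> (15 * G + 12) * (2 * m) + 8 * m"
          by (intro add_mono mult_le_mono2)
        also have "\<dots> \<le> 35 * (G + 1) * m" by (simp add: algebra_simps)
        finally show ?thesis by (simp add: m_def)
      qed
      then have time: "t2 + 7 \<le> 35 * (G + 1) * card (marked s2 - marked s)" using t2 by (simp add: M_def)
      have dead: "dead_marks s2 \<and> a \<notin> obtainable L w i S" if z: "s2 ''z'' 0 = 0"
      proof -
        have nl: "\<not> labelled w x" if "(i, x) \<in> F\<^sup>*" for x
          using z2 z that by (auto simp: least_labelled_def)
        have "y \<in> marked s2" if x: "x \<in> marked s2" and e: "(x, y) \<in> full_graph L w i {} S" for x y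
        proof -
          have "x \<noteq> i" using x mo i_owners by blast
          then have e': "(x, y) \<in> F" using e full_graph_other unfolding F_def by blast
          have "y \<noteq> i" using e i by (auto simp: full_graph_def)
          then show ?thesis using x e' closed unfolding mk by (auto intro: rtrancl_into_rtrancl)
        qed
        then have "dead_marks s2"
          unfolding dead_marks_def using mk(2) mo M(1) nl unfolding mk(1) by blast
        moreover have "a \<notin> obtainable L w i S"
          using nl unfolding obtainable_iff[OF L inv i] F_def by blast
        ultimately show ?thesis by blast
      qed
      have alive: "a \<in> obtainable L w i S" if z: "0 < s2 ''z'' 0"
        using z2 z acc unfolding obtainable_iff[OF L inv i] least_labelled_def F_def[symmetric] by auto
      have ri2: "s2 ''obj'' ` {s2 ''start'' i..<s2 ''end'' i} = {a}" using ri1 by (simp add: fr2)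
      note tr = run_trade_static[OF st2 so2 ri2 F_def M(1) closed z2 _ par staticD(13)[OF st2]]
      have "run trade s2 (\<lambda>t s''. t \<le> (6 * G + 8) * n1 \<and>
        (\<forall>b j. b \<in> trading pr bfs_rule L w i a S j \<longleftrightarrow> s'' ''owner'' b = Suc j) \<and>
        unchanged trade_vars s2 s'')"
        if z: "0 < s2 ''z'' 0"
        by (rule tr) (use z in auto)
      then show ?thesis
        using time st2 so2 un mk(2) y0 mo dead alive mk(1) M_def by simp
    qed
    done
qed

end


section \<open>Trying an indifference class\<close>

lemma run_pick:
  fixes s :: store
  defines "U \<equiv> {u \<in> {s ''p'' 0..<s ''q'' 0}. s ''mark'' (s ''owner'' (s ''obj'' u) - 1) \<le> s ''k'' 0}"
  shows "run pick s (\<lambda>t s'. t \<le> 5 * (s ''q'' 0 - s ''p'' 0) + 3 \<and>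
    (U = {} \<longrightarrow> s' ''c'' 0 = 0) \<and>
    (U \<noteq> {} \<longrightarrow> (\<exists>u \<in> U. s' ''c'' 0 = Suc u \<and> (\<forall>v \<in> U. s ''pos'' (s ''obj'' u) \<le> s ''pos'' (s ''obj'' v)))) \<and>
    unchanged {''c'', ''u''} s s')"
proof -
  define lo hi where "lo = s ''p'' 0" and "hi = s ''q'' 0"
  define ok where "ok u \<longleftrightarrow> s ''mark'' (s ''owner'' (s ''obj'' u) - Suc 0) \<le> s ''k'' 0" for u
  define V where "V m = {u \<in> {lo..<m}. ok u}" for m
  define best where "best A n \<longleftrightarrow> (A = {} \<longrightarrow> n = 0) \<and>
    (A \<noteq> {} \<longrightarrow> (\<exists>u \<in> A. n = Suc u \<and> (\<forall>v \<in> A. s ''pos'' (s ''obj'' u) \<le> s ''pos'' (s ''obj'' v))))"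
    for A and n :: nat
  have UV: "U = V hi" by (simp add: U_def V_def lo_def hi_def ok_def)
  define I where "I \<tau> s' \<longleftrightarrow> lo \<le> s' ''u'' 0 \<and> s' ''u'' 0 \<le> max lo hi \<and> \<tau> \<le> 5 * (s' ''u'' 0 - lo) \<and>
    best (V (s' ''u'' 0)) (s' ''c'' 0) \<and> unchanged {''c'', ''u''} s s'" for \<tau> s'
  have VS: "V (Suc m) = (if ok m then insert m (V m) else V m)" if "lo \<le> m" for m
    using that by (auto simp: V_def less_Suc_eq)
  have bestI: "best (insert m A) (if n = 0 \<or> s ''pos'' (s ''obj'' m) < s ''pos'' (s ''obj'' (n - Suc 0)) then Suc m else n)"
    if b: "best A n" for A m n
  proof (cases "A = {}")
    case True then show ?thesis using b by (auto simp: best_def)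
  next
    case False
    then obtain u where u: "u \<in> A" "n = Suc u" "\<forall>v \<in> A. s ''pos'' (s ''obj'' u) \<le> s ''pos'' (s ''obj'' v)"
      using b unfolding best_def by blast
    show ?thesis
    proof (cases "s ''pos'' (s ''obj'' m) < s ''pos'' (s ''obj'' u)")
      case True
      then have "\<forall>v \<in> A. s ''pos'' (s ''obj'' m) \<le> s ''pos'' (s ''obj'' v)"
        using u(3) by (meson le_trans less_imp_le)
      then show ?thesis using True u(2) by (simp add: best_def)
    next
      case False
      then show ?thesis using u by (auto simp: best_def)
    qed
  qed
  show ?thesis
    unfolding pick_def
    apply (simp split del: if_split)
    apply (rule run_mono)
     apply (rule run_while[where I = I and N = "5 * (max lo hi - lo)"])
    subgoal by (simp add: I_def lo_def V_def best_def)
    subgoal unfolding I_def by (meson diff_le_mono le_trans mult_le_mono2)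
    subgoal premises p for \<tau> s1
    proof -
      note I = p(1)[unfolded I_def]
      have fr: "s1 v = s v" if "v \<notin> {''c'', ''u''}" for v using I that by (elim conjE) simp
      define m n where "m = s1 ''u'' 0" and "n = s1 ''c'' 0"
      have m: "lo \<le> m" "m < hi" using p(2) I by (simp_all add: m_def hi_def fr)
      have b: "best (V m) n" and t: "\<tau> \<le> 5 * (m - lo)" using I unfolding m_def n_def by blast+
      define n' where "n' = (if ok m then
        if n = 0 \<or> s ''pos'' (s ''obj'' m) < s ''pos'' (s ''obj'' (n - Suc 0)) then Suc m else n else n)"
      have b': "best (V (Suc m)) n'"
        by (cases "ok m") (simp_all only: n'_def VS[OF m(1)] if_True if_False b bestI)
      have fin: "I (\<tau> + t' + 1) s'"
        if "t' \<le> 4" "s' ''u'' 0 = Suc m" "s' ''c'' 0 = n'" "unchanged {''c'', ''u''} s s'" for t' s'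
        unfolding I_def that(2,3) using that(1,4) b' m t by (simp add: Suc_diff_le)
      have A: "I (\<tau> + 3 + 1) (s1(''c'' := (s1 ''c'')(0 := Suc m), ''u'' := (s1 ''u'')(0 := Suc m)))"
        if "ok m" "n = 0 \<or> s ''pos'' (s ''obj'' m) < s ''pos'' (s ''obj'' (n - Suc 0))"
        by (rule fin) (use that fr in \<open>simp_all add: n'_def\<close>)
      have um: "s1 ''u'' 0 = m" "s1 ''c'' 0 = n" by (simp_all add: m_def n_def)
      have B: "I (\<tau> + 3 + 1) (s1(''u'' := (s1 ''u'')(0 := Suc m)))"
        if "\<not> (ok m \<and> (n = 0 \<or> s ''pos'' (s ''obj'' m) < s ''pos'' (s ''obj'' (n - Suc 0))))"
      proof -
        have "n' = n" using that by (auto simp: n'_def)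
        then show ?thesis by (intro fin) (simp_all add: fr um)
      qed
      show ?thesis
      proof (cases "ok m \<and> (n = 0 \<or> s ''pos'' (s ''obj'' m) < s ''pos'' (s ''obj'' (n - Suc 0)))")
        case True
        then show ?thesis
          using A[OF conjunct1[OF True] conjunct2[OF True]]
          by (simp add: fr um less_Suc_eq_le ok_def eval_nat_numeral)
      next
        case False
        then show ?thesis
          using B[OF False] by (auto simp: fr um less_Suc_eq_le ok_def eval_nat_numeral)
      qed
    qed
    subgoal premises p for t s1
    proof -
      obtain \<tau> where \<tau>: "t = Suc \<tau>" "I \<tau> s1" "\<not> s1 ''u'' 0 < s1 ''q'' 0" using p by auto
      note I = \<tau>(2)[unfolded I_def]
      have fr: "unchanged {''c'', ''u''} s s1" using I by argo
      then have "s1 ''q'' 0 = hi" by (simp add: hi_def)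
      then have m: "s1 ''u'' 0 = max lo hi" using \<tau>(3) I by linarith
      have "V (max lo hi) = U" unfolding UV by (auto simp: V_def max_def)
      then have "best U (s1 ''c'' 0)" using I m by metis
      moreover have "\<tau> \<le> 5 * (hi - lo)" using I unfolding m by (simp add: max_def split: if_splits)
      ultimately show ?thesis using \<tau>(1) fr by (simp add: best_def lo_def hi_def)
    qed
    done
qed

context agent_step
begin

definition traded :: "nat \<Rightarrow> store \<Rightarrow> bool" where
  "traded c s \<longleftrightarrow> static s \<and> (\<forall>y. s ''mark'' y \<le> Suc k) \<and>
     s ''start'' i = bd i c \<and> s ''end'' i = bd i (Suc c) \<and>
     (\<exists>a \<in> L i ! c. a \<in> obtainable L w i S \<and>
        (\<forall>b \<in> L i ! c. b \<in> obtainable L w i S \<longrightarrow> pr a \<le> pr b) \<and>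
        (\<forall>b j. b \<in> trading pr bfs_rule L w i a S j \<longleftrightarrow> s ''owner'' b = Suc j))"

lemma card_marked:
  assumes "marked s \<subseteq> marked s1" "marked s1 \<subseteq> marked s2" "marked s2 \<subseteq> owners"
  shows "card (marked s2 - marked s) = card (marked s2 - marked s1) + card (marked s1 - marked s)"
proof -
  have "finite (marked s2)" using assms(3) finite_owners finite_subset by blast
  moreover from this have "finite (marked s1)" using assms(2) finite_subset by blast
  moreover have "marked s2 - marked s = (marked s2 - marked s1) \<union> (marked s1 - marked s)"
    using assms by blast
  ultimately show ?thesis by (simp add: card_Un_disjoint Diff_Int_distrib2 Int_Diff disjoint_iff)
qed

lemma card_marked_le: "marked s1 \<subseteq> owners \<Longrightarrow> card (marked s1 - marked s) \<le> n1"
  using owners_n1 card_mono[of "{..<n1}" "marked s1 - marked s"] by fastforce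

text \<open>During a search the range of \<open>i\<close> is a single position, so it respects the
  bound on ranges only if \<open>G\<close> is at least 1.\<close>

lemma class_G: "c < length (L i) \<Longrightarrow> 1 \<le> G"
  using bd_less[OF i(2), of c] bd_G[OF i(2), of c] by linarith

text \<open>Each failed search pays, through its new marks, also for the preceding pick. Beyond that
  a class costs one final fruitless pick, linear in its length, or one trade.\<close>

lemma run_try_class:
  assumes c: "c < length (L i)" and s: "searched s"
    and pq: "s ''p'' 0 = bd i c" "s ''q'' 0 = bd i (Suc c)" "s ''g'' 0 = 1"
    and owned: "L i ! c \<subseteq> (\<Union>j \<in> S. w j)"
  shows "run try_class s (\<lambda>t s'. t \<le> 60 * (G + 1) * card (marked s' - marked s) + 20 * (bd i (Suc c) - bd i c)
      + (if s' ''g'' 0 = 0 then (6 * G + 8) * n1 else 0) \<and>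
    marked s \<subseteq> marked s' \<and> marked s' \<subseteq> owners \<and> s' ''q'' 0 = bd i (Suc c) \<and>
    (s' ''g'' 0 = 1 \<and> searched s' \<and> (\<forall>a \<in> L i ! c. a \<notin> obtainable L w i S) \<or>
     s' ''g'' 0 = 0 \<and> traded c s'))"
proof -
  define lo hi where "lo = bd i c" and "hi = bd i (Suc c)"
  have lohi: "lo < hi" "hi - lo \<le> G" using bd_less[OF i(2) c] bd_G[OF i(2) c] by (simp_all add: lo_def hi_def)
  have G1: "1 \<le> G" by (rule class_G[OF c])
  have Cimg: "s0 ''obj'' ` {lo..<hi} = L i ! c" using bd_obj[OF i(2) c] by (simp add: lo_def hi_def)
  have Cn2: "L i ! c \<subseteq> {..<n2}" using nth_class_bound[OF i_pref[OF L inv i], of "Suc c"] c by (simp add: nth_class_Suc)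
  define I where "I \<tau> s' \<longleftrightarrow> marked s \<subseteq> marked s' \<and> marked s' \<subseteq> owners \<and>
     s' ''p'' 0 = lo \<and> s' ''q'' 0 = hi \<and>
     (0 < s' ''c'' 0 \<and> s' ''g'' 0 = 1 \<and> searched s' \<and> \<tau> \<le> 60 * (G + 1) * card (marked s' - marked s) \<or>
      s' ''c'' 0 = 0 \<and> s' ''g'' 0 = 1 \<and> searched s' \<and> (\<forall>a \<in> L i ! c. a \<notin> obtainable L w i S) \<and>
        \<tau> \<le> 60 * (G + 1) * card (marked s' - marked s) + 12 * (hi - lo) \<or>
      s' ''c'' 0 = 0 \<and> s' ''g'' 0 = 0 \<and> traded c s' \<and>
        \<tau> \<le> 60 * (G + 1) * card (marked s' - marked s) + (6 * G + 8) * n1)" for \<tau> s'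
  define s1 where "s1 = s(''c'' := (s ''c'')(0 := 1))"
  have mo: "marked s \<subseteq> owners" using s by (simp add: searched_def dead_marks_def)
  have s1s: "searched s1" "marked s1 = marked s"
    using s by (simp_all add: searched_def static_def dead_marks_def marked_def range_length_def s1_def)
  have I1: "I 0 s1"
    unfolding I_def s1s(2) using mo s1s pq by (simp add: s1_def lo_def hi_def)
  show ?thesis
    unfolding try_class_def
    apply (simp split del: if_split)
    apply (simp only: s1_def[symmetric, unfolded One_nat_def])
    apply (rule run_mono)
     apply (rule run_while[where I = I and N = "60 * (G + 1) * n1 + 12 * (hi - lo) + (6 * G + 8) * n1", OF I1])
    subgoal premises p for \<tau> s2
    proof -
      have "card (marked s2 - marked s) \<le> n1" using p card_marked_le unfolding I_def by blast
      then have "60 * (G + 1) * card (marked s2 - marked s) \<le> 60 * (G + 1) * n1" by (rule mult_le_mono2)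
      then show ?thesis using p unfolding I_def by linarith
    qed
    subgoal premises p for \<tau> s2
    proof -
      have s2: "marked s \<subseteq> marked s2" "marked s2 \<subseteq> owners" "s2 ''p'' 0 = lo" "s2 ''q'' 0 = hi"
        "s2 ''g'' 0 = 1" "searched s2" "\<tau> \<le> 60 * (G + 1) * card (marked s2 - marked s)"
        using p unfolding I_def by auto
      have st2: "static s2" "dead_marks s2" "s2 ''owner'' = s0 ''owner''"
        using s2(6) by (simp_all add: searched_def)
      have k2: "s2 ''k'' 0 = k" using staticD(7)[OF st2(1)] k by simp
      define U where "U = {u \<in> {lo..<hi}. s2 ''mark'' (s2 ''owner'' (s2 ''obj'' u) - 1) \<le> k}"
      note pick = run_pick[of s2, unfolded s2(3,4) k2, folded U_def]
      have own_at: "\<exists>j \<in> owners. s0 ''owner'' (s0 ''obj'' u) = Suc j \<and> s0 ''obj'' u \<in> w j \<and> s0 ''obj'' u \<in> L i ! c"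
        if "u \<in> {lo..<hi}" for u
      proof -
        have C: "s0 ''obj'' u \<in> L i ! c" using that Cimg by blast
        then obtain j where "j \<in> S" "s0 ''obj'' u \<in> w j" using owned by blast
        then show ?thesis using own C by (auto simp: owners_def)
      qed
      have U_iff: "u \<in> U \<longleftrightarrow> u \<in> {lo..<hi} \<and> j \<notin> marked s2" if "s0 ''obj'' u \<in> w j" for u j
      proof -
        have "s2 ''mark'' j \<le> Suc k" using st2(2) by (simp add: dead_marks_def)
        moreover have "s0 ''owner'' (s0 ''obj'' u) = Suc j" using own that by blast
        ultimately show ?thesis
          by (auto simp: U_def marked_def st2(3) staticD(1)[OF st2(1)])
      qed
      \<comment> \<open>An object no longer eligible has a marked owner, and marked owners cannot
        reach a labelled agent.\<close>
      have dead: "a \<notin> obtainable L w i S" if a: "a \<in> L i ! c" "\<And>u. u \<in> {lo..<hi} \<Longrightarrow> a = s0 ''obj'' u \<Longrightarrow> u \<notin> U" for a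
      proof -
        obtain u where u: "u \<in> {lo..<hi}" "a = s0 ''obj'' u" using a(1) Cimg by blast
        obtain j where j: "a \<in> w j" using own_at[OF u(1)] u(2) by blast
        then have "j \<in> marked s2" using U_iff[of u j] u a(2) by blast
        then show ?thesis using dead_marks_not_obtainable[OF st2(2) j] by blast
      qed
      show ?thesis
        unfolding run_Seq
      proof (rule run_mono[OF pick], elim conjE)
        fix t3 s3
        assume t3: "t3 \<le> 5 * (hi - lo) + 3" and c3: "U = {} \<longrightarrow> s3 ''c'' 0 = 0"
          "U \<noteq> {} \<longrightarrow> (\<exists>u \<in> U. s3 ''c'' 0 = Suc u \<and> (\<forall>v \<in> U. s2 ''pos'' (s2 ''obj'' u) \<le> s2 ''pos'' (s2 ''obj'' v)))"
          and frA: "unchanged {''c'', ''u''} s2 s3"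
        have fr: "s3 v = s2 v" if "v \<notin> {''c'', ''u''}" for v using frA that by blast
        have m3: "marked s3 = marked s2" by (simp add: marked_def fr)
        have st3: "searched s3"
          using s2(6) unfolding searched_def static_def dead_marks_def range_length_def m3 by (simp add: fr)
        show "run (Cond (Less (Const 0) (var ''c''))
          (search ;;
           Cond (Less (Const 0) (var ''z''))
             (trade ;; set_range ;; set_var ''c'' (Const 0) ;; set_var ''g'' (Const 0))
             Skip)
          Skip) s3 (\<lambda>t' s'. I (\<tau> + (t3 + t') + 1) s')"
        proof (cases "U = {}")
          case True
          then have c0: "s3 ''c'' 0 = 0" using c3(1) by blast
          have "I (\<tau> + (t3 + 2) + 1) s3"
            unfolding I_def m3
            using s2 st3 c0 dead True t3 lohi by (auto simp: fr)
          then show ?thesis using c0 by simp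
        next
          case False
          then obtain u where u: "u \<in> U" "s3 ''c'' 0 = Suc u"
            "\<forall>v \<in> U. s2 ''pos'' (s2 ''obj'' u) \<le> s2 ''pos'' (s2 ''obj'' v)" using c3(2) by blast
          have ur: "u \<in> {lo..<hi}" using u(1) by (simp add: U_def)
          define a where "a = s0 ''obj'' u"
          obtain j where j: "j \<in> owners" "a \<in> w j" "a \<in> L i ! c" using own_at[OF ur] a_def by blast
          have jm: "j \<notin> marked s3" using U_iff[of u j] u(1) j(2) a_def m3 by blast
          have acc: "a \<in> acceptable (L i)" using j(3) c by (auto simp: acceptable_def)
          have pos_s2: "s2 ''pos'' (s2 ''obj'' v) = pr (s0 ''obj'' v)" if "v \<in> {lo..<hi}" for v
            using own_at[OF that] Cn2 pos staticD(1,3)[OF st2(1)] by auto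
          \<comment> \<open>Every obtainable object of the class is still eligible, so the highest
            eligible object, once found obtainable, is the one demanded by
            \<open>max_TG\<close>.\<close>
          have best: "pr a \<le> pr b" if b: "b \<in> L i ! c" "b \<in> obtainable L w i S" for b
          proof -
            obtain v where v: "v \<in> {lo..<hi}" "b = s0 ''obj'' v" "v \<in> U"
              using dead[OF b(1)] b(2) by blast
            then have "s2 ''pos'' (s2 ''obj'' u) \<le> s2 ''pos'' (s2 ''obj'' v)" using u(3) by blast
            then show ?thesis by (simp add: pos_s2[OF v(1)] pos_s2[OF ur] v(2) a_def)
          qed
          show ?thesis
            unfolding run_Cond run_Seq bval.simps aval.simps u(2)
            apply (simp split del: if_split)
            apply (rule run_mono[OF run_search[OF st3 G1 u(2) a_def[symmetric] j(2) jm acc]])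
            subgoal premises q for t4 s4
            proof -
              have t4: "t4 \<le> 35 * (G + 1) * card (marked s4 - marked s2)"
                and st4: "static s4" "s4 ''owner'' = s0 ''owner''" "untouched s3 s4"
                and mk4: "\<forall>y. s4 ''mark'' y \<le> Suc k" "marked s2 \<subseteq> marked s4" "j \<in> marked s4" "marked s4 \<subseteq> owners"
                and z0: "s4 ''z'' 0 = 0 \<Longrightarrow> dead_marks s4"
                and z1: "0 < s4 ''z'' 0 \<Longrightarrow> a \<in> obtainable L w i S" "0 < s4 ''z'' 0 \<Longrightarrow>
                   run trade s4 (\<lambda>t s''. t \<le> (6 * G + 8) * n1 \<and>
                    (\<forall>b j. b \<in> trading pr bfs_rule L w i a S j \<longleftrightarrow> s'' ''owner'' b = Suc j) \<and>
                    unchanged trade_vars s4 s'')"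
                using q unfolding m3 by blast+
              have un: "s4 ''p'' 0 = lo" "s4 ''q'' 0 = hi" "s4 ''g'' 0 = 1" "s4 ''c'' 0 = Suc u"
                using st4(3) s2(3-5) u(2) by (simp_all add: untouched_def fr)
              have sub: "marked s \<subseteq> marked s4" using s2(1) mk4(2) by blast
              have cards: "card (marked s4 - marked s) = card (marked s4 - marked s2) + card (marked s2 - marked s)"
                by (rule card_marked[OF s2(1) mk4(2,4)])
              have "j \<in> marked s4 - marked s2" using mk4(3) jm m3 by blast
              then have c1: "1 \<le> card (marked s4 - marked s2)"
                using mk4(4) finite_owners card_gt_0_iff[of "marked s4 - marked s2"]
                by (metis One_nat_def Suc_leI empty_iff finite_Diff finite_subset)
              define m where "m = card (marked s4 - marked s2)"
              have A: "\<tau> + (t3 + t4 + 15) \<le> 60 * (G + 1) * card (marked s4 - marked s)"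
              proof -
                \<comment> \<open>The constant 60 is 35 for the search plus 25 for the pick and
                  bookkeeping, charged to the at least one new mark.\<close>
                have "5 * G + 18 \<le> (25 * (G + 1)) * 1" by simp
                also have "\<dots> \<le> (25 * (G + 1)) * m"
                  by (rule mult_le_mono2) (use c1 in \<open>simp add: m_def\<close>)
                finally have "5 * G + 18 \<le> (25 * (G + 1)) * m" .
                then have "t3 + t4 + 15 \<le> 60 * (G + 1) * m"
                  using t3 t4 lohi(2) by (simp add: m_def algebra_simps)
                then show ?thesis using s2(7) unfolding cards m_def by (simp add: algebra_simps)
              qed
              show ?thesis
              proof (cases "s4 ''z'' 0 = 0")
                case True
                have "searched s4" using st4 z0[OF True] by (simp add: searched_def)
                then have "I (\<tau> + (t3 + (t4 + 4))) s4"
                  unfolding I_def using un sub mk4(4) A by simp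
                then show ?thesis using True by (simp add: eval_nat_numeral)
              next
                case False
                then have z: "0 < s4 ''z'' 0" by simp
                show ?thesis
                  using z
                  apply (simp split del: if_split)
                  apply (rule run_mono[OF z1(2)[OF z]])
                  subgoal premises r for t5 s5
                  proof -
                    have t5: "t5 \<le> (6 * G + 8) * n1"
                      and o5: "\<forall>b j. b \<in> trading pr bfs_rule L w i a S j \<longleftrightarrow> s5 ''owner'' b = Suc j"
                      and frB: "unchanged trade_vars s4 s5"
                      using conjunct1[OF r(2)] conjunct1[OF conjunct2[OF r(2)]]
                        conjunct2[OF conjunct2[OF r(2)]] by - assumption+
                    have fr5: "s5 v = s4 v" if "v \<notin> trade_vars" for v
                      by (rule frB[rule_format, OF that])
                    define s6 where "s6 = s5(''start'' := (s5 ''start'')(i := lo), ''end'' := (s5 ''end'')(i := hi),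
                      ''c'' := (s5 ''c'')(0 := 0), ''g'' := (s5 ''g'')(0 := 0))"
                    have s6: "s6 ''start'' = (s4 ''start'')(i := lo)" "s6 ''end'' = (s4 ''end'')(i := hi)"
                      "s6 ''owner'' = s5 ''owner''" "s6 ''c'' 0 = 0" "s6 ''g'' 0 = 0"
                      "\<And>v. v \<notin> {''start'', ''end'', ''c'', ''g'', ''x'', ''y'', ''n'', ''v'', ''best'', ''o'', ''owner''} \<Longrightarrow> s6 v = s4 v"
                      by (simp_all add: s6_def fr5)
                    have "range_length s6 v \<le> G" for v
                      using staticD(13)[OF st4(1), of v] lohi(2) by (simp add: range_length_def s6)
                    then have st6: "static s6" using st4(1) unfolding static_def by (simp add: s6)
                    have m6: "marked s6 = marked s4" by (simp add: marked_def s6)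
                    have "traded c s6"
                      unfolding traded_def using st6 mk4(1) j(3) z1(1)[OF z] best o5
                      by (auto simp: s6 lo_def hi_def intro!: bexI[of _ a])
                    then have "I (\<tau> + (t3 + (t4 + (t5 + 7)))) s6"
                      unfolding I_def m6 using sub mk4(4) A t5 by (simp add: s6 un)
                    then show ?thesis
                      unfolding set_range_def by (simp add: staticD(9)[OF st4(1)] fr5 un s6_def eval_nat_numeral)
                  qed
                  done
              qed
            qed
            done
        qed
      qed
    qed
    subgoal premises p for t s2
    proof -
      obtain \<tau> where \<tau>: "t = Suc \<tau>" "I \<tau> s2" "s2 ''c'' 0 = 0" using p by auto
      have d: "1 \<le> hi - lo" using lohi(1) by simp
      define A where "A = 60 * (G + 1) * card (marked s2 - marked s)"
      have I: "marked s \<subseteq> marked s2" "marked s2 \<subseteq> owners" "s2 ''q'' 0 = hi"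
        using \<tau>(2) unfolding I_def by blast+
      have "s2 ''g'' 0 = 1 \<and> searched s2 \<and> (\<forall>a \<in> L i ! c. a \<notin> obtainable L w i S) \<and> \<tau> \<le> A + 12 * (hi - lo) \<or>
         s2 ''g'' 0 = 0 \<and> traded c s2 \<and> \<tau> \<le> A + (6 * G + 8) * n1"
        using \<tau>(2,3) unfolding I_def A_def by (elim conjE disjE) simp_all
      then show ?thesis
      proof (elim disjE conjE)
        assume "s2 ''g'' 0 = 1" "searched s2" "\<forall>a \<in> L i ! c. a \<notin> obtainable L w i S" "\<tau> \<le> A + 12 * (hi - lo)"
        then show ?thesis using I(1-3) \<tau>(1) d by (simp add: A_def lo_def hi_def)
      next
        assume "s2 ''g'' 0 = 0" "traded c s2" "\<tau> \<le> A + (6 * G + 8) * n1"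
        then show ?thesis using I(1-3) \<tau>(1) d by (simp add: A_def lo_def hi_def)
      qed
    qed
    done
qed

end


section \<open>One step of the implementation\<close>

lemma first_class_greater:
  assumes "valid_pref n2 l" "m \<le> length l" "\<And>c. c < m \<Longrightarrow> l ! c \<inter> A = {}"
  shows "m < first_class n2 l A"
proof (cases "A \<inter> acceptable l = {}")
  case True
  then show ?thesis using valid_pref_length[OF assms(1)] assms(2) by (simp add: first_class_none)
next
  case False
  have "nth_class l (first_class n2 l A) \<inter> A \<noteq> {}" by (rule first_class_witness[OF False])
  then obtain c where c: "first_class n2 l A = Suc c" "l ! c \<inter> A \<noteq> {}"
    by (cases "first_class n2 l A") (auto simp: nth_class_def split: if_splits)
  then have "\<not> c < m" using assms(3) by blast
  then show ?thesis using c by simp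
qed

lemma first_class_at:
  assumes "valid_pref n2 l" "m < length l" "\<And>c. c < m \<Longrightarrow> l ! c \<inter> A = {}" "l ! m \<inter> A \<noteq> {}"
  shows "first_class n2 l A = Suc m"
proof -
  obtain a where "a \<in> A" "a \<in> nth_class l (Suc m)"
    using assms(4) nth_class_Suc[OF assms(2)] by auto
  then have "first_class n2 l A \<le> Suc m" by (rule first_class_le)
  moreover have "m < first_class n2 l A" by (rule first_class_greater) (use assms in auto)
  ultimately show ?thesis by simp
qed

context agent_step
begin

abbreviation "allocated \<equiv> (\<Union>j \<in> S. w j)"

abbreviation "step_result \<equiv> snd (sdmt2_step n2 pr bfs_rule L i (S, w))"

section \<open>The result of the mechanism's step, according to the first promising class\<close>

definition dead_below :: "nat \<Rightarrow> bool" where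
  "dead_below c \<longleftrightarrow> (\<forall>c' < c. \<forall>a \<in> L i ! c'. a \<in> allocated \<and> a \<notin> obtainable L w i S)"

lemmas Li = i_pref[OF L inv i]

lemma step_result_eq:
  "step_result = (let free = {..<n2} - allocated; j1 = first_class n2 (L i) free;
       j2 = first_class n2 (L i) (obtainable L w i S)
     in if j1 \<le> j2 then w(i := free \<inter> nth_class (L i) j1)
        else trading pr bfs_rule L w i (the (max_TG n2 pr L w i S)) S)"
  using max_TG_cases[of n2 L i pr w S, OF Li] unfolding sdmt2_step_def Let_def
  by (auto simp: first_class_none)

lemma own_rank_step: "own_rank n2 L step_result i = best_rank n2 L w i S"
  using step_inv(4)[OF L inv i path_rule_bfs_rule] by (metis prod.collapse)

lemma step_taken:
  assumes c: "c < length (L i)" "dead_below c" "\<not> L i ! c \<subseteq> allocated"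
  shows "step_result = w(i := L i ! c - allocated)" "own_rank n2 L step_result i = Suc c"
proof -
  let ?free = "{..<n2} - allocated"
  have sub: "L i ! c \<subseteq> {..<n2}" using nth_class_bound[OF Li, of "Suc c"] c(1) by (simp add: nth_class_Suc)
  have j1: "first_class n2 (L i) ?free = Suc c"
    using c sub by (intro first_class_at[OF Li c(1)]) (auto simp: dead_below_def)
  have j2: "c < first_class n2 (L i) (obtainable L w i S)"
    using c by (intro first_class_greater[OF Li]) (auto simp: dead_below_def)
  have "?free \<inter> L i ! c = L i ! c - allocated" using sub by auto
  then show "step_result = w(i := L i ! c - allocated)"
    unfolding step_result_eq using j1 j2 c(1) by (simp add: Let_def nth_class_Suc)
  show "own_rank n2 L step_result i = Suc c"
    unfolding own_rank_step best_rank_def using j1 j2 by simp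
qed

text \<open>Classes up to and including \<open>c\<close> contain no free object, while
  \<open>c\<close> is the first with an obtainable one, so the mechanism trades, and for the highest
  such object.\<close>

lemma step_traded:
  assumes c: "c < length (L i)" "dead_below c" "L i ! c \<subseteq> allocated"
    and a: "a \<in> L i ! c" "a \<in> obtainable L w i S"
      "\<And>b. b \<in> L i ! c \<Longrightarrow> b \<in> obtainable L w i S \<Longrightarrow> pr a \<le> pr b"
  shows "step_result = trading pr bfs_rule L w i a S" "own_rank n2 L step_result i = Suc c"
proof -
  let ?free = "{..<n2} - allocated" and ?H = "obtainable L w i S"
  have sub: "L i ! c \<subseteq> {..<n2}" using nth_class_bound[OF Li, of "Suc c"] c(1) by (simp add: nth_class_Suc)
  have "c' < Suc c \<Longrightarrow> L i ! c' \<inter> ?free = {}" for c'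
    using c(2,3) by (cases "c' = c") (auto simp: dead_below_def less_Suc_eq)
  then have j1: "Suc c < first_class n2 (L i) ?free"
    using c(1) by (intro first_class_greater[OF Li]) auto
  have j2: "first_class n2 (L i) ?H = Suc c"
    using c a by (intro first_class_at[OF Li c(1)]) (auto simp: dead_below_def)
  have "highest pr (?H \<inter> L i ! c) = a"
    by (rule highest_eq[OF common_order_inj[OF pr]]) (use a sub in auto)
  then have "max_TG n2 pr L w i S = Some a"
    unfolding max_TG_def Let_def j2 using a(2) c(1) by (auto simp: nth_class_Suc)
  then show "step_result = trading pr bfs_rule L w i a S"
    unfolding step_result_eq using j1 j2 by (simp add: Let_def)
  show "own_rank n2 L step_result i = Suc c"
    unfolding own_rank_step best_rank_def using j1 j2 by simp
qed

text \<open>Both indices take the default \<open>n2 + 1\<close>; the tie selects the first branch,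
  which allocates the empty class. The program accordingly leaves \<open>owner\<close> as it
  is.\<close>

lemma step_unmatched:
  assumes "dead_below (length (L i))"
  shows "step_result = w"
proof -
  let ?free = "{..<n2} - allocated" and ?H = "obtainable L w i S"
  have acc: "a \<in> allocated \<and> a \<notin> ?H" if "a \<in> acceptable (L i)" for a
    using that assms unfolding dead_below_def acceptable_def by (auto simp: in_set_conv_nth)
  have "first_class n2 (L i) ?free = n2 + 1" by (rule first_class_none) (use acc in auto)
  moreover have "first_class n2 (L i) ?H = n2 + 1" by (rule first_class_none) (use acc in auto)
  ultimately have "step_result = w(i := {})"
    unfolding step_result_eq using nth_class_beyond[OF Li] by (simp add: Let_def)
  then show ?thesis using wi[OF L inv i] by (simp add: fun_upd_idem)
qed

lemma owner_0: "s0 ''owner'' b = 0 \<longleftrightarrow> b \<notin> allocated"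
proof -
  have "b \<in> allocated" if "s0 ''owner'' b = Suc j" for j
  proof -
    have "b \<in> w j" using own that by blast
    then show ?thesis using inv_out[OF L inv, of j] by blast
  qed
  moreover have "s0 ''owner'' b \<noteq> 0" if "b \<in> allocated" using own that by auto
  ultimately show ?thesis by (metis not0_implies_Suc)
qed

lemma bd_le_end: "c \<le> length (L i) \<Longrightarrow> bd i c \<le> s0 ''off'' (Suc i)"
proof (induction rule: inc_induct)
  case (step c)
  then show ?case using bd_less[OF i(2), of c] by simp
qed (simp add: bd_end)

lemma run_scan_class:
  assumes c: "c < length (L i)" and s: "static s" and p: "s ''p'' 0 = bd i c"
  shows "run scan_class s (\<lambda>t s'. t \<le> 4 * (bd i (Suc c) - bd i c) + 3 \<and> s' ''q'' 0 = bd i (Suc c) \<and>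
    (s' ''f'' 0 = 0 \<longleftrightarrow> (\<forall>u \<in> {bd i c..<bd i (Suc c)}. s ''owner'' (s ''obj'' u) \<noteq> 0)) \<and>
    unchanged {''q'', ''f''} s s')"
proof -
  define lo hi where "lo = bd i c" and "hi = bd i (Suc c)"
  have lohi: "lo < hi" using bd_less[OF i(2) c] by (simp add: lo_def hi_def)
  have cls: "s ''cls'' u = Suc c" if "u \<in> {lo..<hi}" for u
    using bd_cls[OF i(2) c] that staticD(2)[OF s] by (simp add: lo_def hi_def)
  have e: "s ''e'' 0 = s0 ''off'' (Suc i)" by (rule staticD(10)[OF s])
  have hi_e: "hi \<le> s ''e'' 0" using bd_le_end[of "Suc c"] c by (simp add: hi_def e)
  \<comment> \<open>The scan cannot run past the class: the next position either starts class
    \<open>c + 1\<close>, stored as \<open>Suc (Suc c)\<close>, or is the end of the agent's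
    list.\<close>
  have stop: "\<not> (hi < s ''e'' 0 \<and> s ''cls'' hi = Suc c)"
  proof (cases "Suc c < length (L i)")
    case True
    then have "s ''cls'' hi = Suc (Suc c)"
      using bd_cls[OF i(2) True, of hi] bd_less[OF i(2) True] staticD(2)[OF s] by (simp add: hi_def)
    then show ?thesis by simp
  next
    case False
    then have "Suc c = length (L i)" using c by simp
    then have "hi = s ''e'' 0" using bd_end e by (simp add: hi_def)
    then show ?thesis by simp
  qed
  define I where "I \<tau> s' \<longleftrightarrow> lo \<le> s' ''q'' 0 \<and> s' ''q'' 0 \<le> hi \<and> \<tau> \<le> 4 * (s' ''q'' 0 - lo) \<and>
    (s' ''f'' 0 = 0 \<longleftrightarrow> (\<forall>u \<in> {lo..<s' ''q'' 0}. s ''owner'' (s ''obj'' u) \<noteq> 0)) \<and>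
    unchanged {''q'', ''f''} s s'" for \<tau> s'
  show ?thesis
    unfolding scan_class_def
    apply (simp split del: if_split)
    apply (rule run_mono)
     apply (rule run_while[where I = I and N = "4 * (hi - lo)"])
    subgoal using p lohi by (simp add: I_def lo_def)
    subgoal unfolding I_def by (meson diff_le_mono le_trans mult_le_mono2)
    subgoal premises r for \<tau> s1
    proof -
      note I = r(1)[unfolded I_def]
      have frA: "unchanged {''q'', ''f''} s s1" using I by argo
      have fr: "s1 v = s v" if "v \<notin> {''q'', ''f''}" for v by (rule frA[rule_format, OF that])
      define m where "m = s1 ''q'' 0"
      have m: "lo \<le> m" "m \<le> hi" "\<tau> \<le> 4 * (m - lo)"
        and f: "s1 ''f'' 0 = 0 \<longleftrightarrow> (\<forall>u \<in> {lo..<m}. s ''owner'' (s ''obj'' u) \<noteq> 0)"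
        using I unfolding m_def by blast+
      have "s ''cls'' m = Suc c" "m < s ''e'' 0"
        using r(2) cls[of lo] lohi p by (auto simp: fr m_def lo_def)
      then have mh: "m < hi" using stop m(2) by (cases "m = hi") auto
      have set: "{lo..<Suc m} = insert m {lo..<m}" using m(1) by auto
      define s2 where "s2 = (if s ''owner'' (s ''obj'' m) = 0 then s1(''f'' := (s1 ''f'')(0 := 1)) else s1)"
      have "I (\<tau> + 3 + 1) (s2(''q'' := (s2 ''q'')(0 := Suc m)))"
        unfolding I_def using m mh f set by (simp add: s2_def fr Suc_diff_le)
      moreover have "s1 ''q'' 0 = m" by (simp add: m_def)
      ultimately show ?thesis
        by (cases "s ''owner'' (s ''obj'' m) = 0") (simp_all add: fr s2_def eval_nat_numeral)
    qed
    subgoal premises r for t s1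
    proof -
      obtain \<tau> where \<tau>: "t = Suc \<tau>" "I \<tau> s1"
        "\<not> (s1 ''q'' 0 < s1 ''e'' 0 \<and> s1 ''cls'' (s1 ''q'' 0) = s1 ''cls'' (s1 ''p'' 0))"
        using r by auto
      note I = \<tau>(2)[unfolded I_def]
      have frA: "unchanged {''q'', ''f''} s s1" using I by argo
      have fr: "s1 v = s v" if "v \<notin> {''q'', ''f''}" for v by (rule frA[rule_format, OF that])
      have q: "lo \<le> s1 ''q'' 0" "s1 ''q'' 0 \<le> hi" using I by blast+
      have "s1 ''q'' 0 = hi"
      proof (rule ccontr)
        assume "s1 ''q'' 0 \<noteq> hi"
        then have "s1 ''q'' 0 < hi" using q by simp
        then have "s1 ''q'' 0 < s1 ''e'' 0" "s1 ''cls'' (s1 ''q'' 0) = Suc c" "s1 ''cls'' (s1 ''p'' 0) = Suc c"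
          using q hi_e cls[of "s1 ''q'' 0"] cls[of lo] lohi p by (simp_all add: fr lo_def)
        then show False using \<tau>(3) by simp
      qed
      then show ?thesis using \<tau>(1) I frA by (simp add: lo_def hi_def)
    qed
    done
qed

lemma run_take_free:
  fixes s :: store
  assumes "s ''p'' 0 = lo" "s ''q'' 0 = hi" "s ''i'' 0 = i" "lo \<le> hi"
  shows "run take_free s (\<lambda>t s'. t \<le> 4 * (hi - lo) + 2 \<and>
    (\<forall>b. s' ''owner'' b =
       (if b \<in> s ''obj'' ` {lo..<hi} \<and> s ''owner'' b = 0 then Suc i else s ''owner'' b)) \<and>
    unchanged {''u'', ''owner''} s s')"
proof -
  define I where "I \<tau> s' \<longleftrightarrow> lo \<le> s' ''u'' 0 \<and> s' ''u'' 0 \<le> hi \<and> \<tau> \<le> 4 * (s' ''u'' 0 - lo) \<and>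
    (\<forall>b. s' ''owner'' b =
       (if b \<in> s ''obj'' ` {lo..<s' ''u'' 0} \<and> s ''owner'' b = 0 then Suc i else s ''owner'' b)) \<and>
    unchanged {''u'', ''owner''} s s'" for \<tau> s'
  show ?thesis
    unfolding take_free_def
    apply (simp split del: if_split)
    apply (rule run_mono)
     apply (rule run_while[where I = I and N = "4 * (hi - lo)"])
    subgoal using assms by (simp add: I_def)
    subgoal unfolding I_def by (meson diff_le_mono le_trans mult_le_mono2)
    subgoal premises r for \<tau> s1
    proof -
      note I = r(1)[unfolded I_def]
      have frA: "unchanged {''u'', ''owner''} s s1" using I by argo
      have fr: "s1 v = s v" if "v \<notin> {''u'', ''owner''}" for v by (rule frA[rule_format, OF that])
      define m where "m = s1 ''u'' 0"
      have m: "lo \<le> m" "m \<le> hi" "\<tau> \<le> 4 * (m - lo)"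
        and o: "\<forall>b. s1 ''owner'' b =
          (if b \<in> s ''obj'' ` {lo..<m} \<and> s ''owner'' b = 0 then Suc i else s ''owner'' b)"
        using I unfolding m_def by blast+
      have mh: "m < hi" using r(2) assms(2) by (simp add: fr m_def)
      have set: "s ''obj'' ` {lo..<Suc m} = insert (s ''obj'' m) (s ''obj'' ` {lo..<m})"
        using m(1) by (auto simp: atLeastLessThanSuc)
      define s2 where "s2 = (if s1 ''owner'' (s ''obj'' m) = 0
        then s1(''owner'' := (s1 ''owner'')(s ''obj'' m := Suc i)) else s1)"
      have o2: "\<forall>b. s2 ''owner'' b =
          (if b \<in> s ''obj'' ` {lo..<Suc m} \<and> s ''owner'' b = 0 then Suc i else s ''owner'' b)"
        unfolding set s2_def using o by (auto split: if_splits)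
      have "I (\<tau> + 3 + 1) (s2(''u'' := (s2 ''u'')(0 := Suc m)))"
        unfolding I_def
      proof (intro conjI)
        show "\<forall>v. v \<notin> {''u'', ''owner''} \<longrightarrow> (s2(''u'' := (s2 ''u'')(0 := Suc m))) v = s v"
          by (simp add: s2_def fr)
      qed (use m mh o2 in \<open>simp_all add: Suc_diff_le\<close>)
      moreover have "s1 ''u'' 0 = m" by (simp add: m_def)
      ultimately show ?thesis
        using assms(3)
        by (cases "s1 ''owner'' (s ''obj'' m) = 0") (simp_all add: fr s2_def eval_nat_numeral)
    qed
    subgoal premises r for t s1
    proof -
      obtain \<tau> where \<tau>: "t = Suc \<tau>" "I \<tau> s1" "\<not> s1 ''u'' 0 < s1 ''q'' 0" using r by auto
      note I = \<tau>(2)[unfolded I_def]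
      have frA: "unchanged {''u'', ''owner''} s s1" using I by argo
      then have "s1 ''q'' 0 = hi" using assms(2) by simp
      then have u: "s1 ''u'' 0 = hi" using \<tau>(3) I by linarith
      show ?thesis using \<tau>(1) I frA unfolding u by simp
    qed
    done
qed

definition taken :: "nat \<Rightarrow> store \<Rightarrow> bool" where
  "taken c s \<longleftrightarrow> static s \<and> (\<forall>y. s ''mark'' y \<le> Suc k) \<and>
     s ''start'' i = bd i c \<and> s ''end'' i = bd i (Suc c) \<and> \<not> L i ! c \<subseteq> allocated \<and>
     (\<forall>b j. b \<in> (w(i := L i ! c - allocated)) j \<longleftrightarrow> s ''owner'' b = Suc j)"

lemma run_process_class:
  assumes c: "c < length (L i)" and s: "searched s" and p: "s ''p'' 0 = bd i c" "s ''g'' 0 = 1"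
  shows "run process_class s (\<lambda>t s'. t \<le> 60 * (G + 1) * card (marked s' - marked s) + 35 * (bd i (Suc c) - bd i c)
      + (if s' ''g'' 0 = 0 then (6 * G + 8) * n1 else 0) \<and>
    marked s \<subseteq> marked s' \<and> marked s' \<subseteq> owners \<and>
    (s' ''g'' 0 = 1 \<and> searched s' \<and> s' ''p'' 0 = bd i (Suc c) \<and>
       (\<forall>a \<in> L i ! c. a \<in> allocated \<and> a \<notin> obtainable L w i S) \<or>
     s' ''g'' 0 = 0 \<and> traded c s' \<and> L i ! c \<subseteq> allocated \<or>
     s' ''g'' 0 = 0 \<and> taken c s'))"
proof -
  define lo hi where "lo = bd i c" and "hi = bd i (Suc c)"
  have lohi: "lo < hi" "hi - lo \<le> G" using bd_less[OF i(2) c] bd_G[OF i(2) c] by (simp_all add: lo_def hi_def)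
  have d: "1 \<le> hi - lo" using lohi(1) by simp
  have Cimg: "s0 ''obj'' ` {lo..<hi} = L i ! c" using bd_obj[OF i(2) c] by (simp add: lo_def hi_def)
  have st: "static s" "dead_marks s" "s ''owner'' = s0 ''owner''" using s by (simp_all add: searched_def)
  have mo: "marked s \<subseteq> owners" using st(2) by (simp add: dead_marks_def)
  show ?thesis
    unfolding process_class_def lo_def[symmetric] hi_def[symmetric]
    apply (simp split del: if_split)
    apply (rule run_mono[OF run_scan_class[OF c st(1) p(1), folded lo_def hi_def]])
    subgoal premises r for t1 s1
    proof -
      have t1: "t1 \<le> 4 * (hi - lo) + 3" and q1: "s1 ''q'' 0 = hi"
        and f1: "s1 ''f'' 0 = 0 \<longleftrightarrow> (\<forall>u \<in> {lo..<hi}. s ''owner'' (s ''obj'' u) \<noteq> 0)"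
        and frA: "unchanged {''q'', ''f''} s s1" using r by argo+
      have fr: "s1 v = s v" if "v \<notin> {''q'', ''f''}" for v by (rule frA[rule_format, OF that])
      have m1: "marked s1 = marked s" by (simp add: marked_def fr)
      have s1: "searched s1"
        using s unfolding searched_def static_def dead_marks_def range_length_def m1 by (simp add: fr)
      have f1': "s1 ''f'' 0 = 0 \<longleftrightarrow> L i ! c \<subseteq> allocated"
        unfolding f1 st(3) staticD(1)[OF st(1)] owner_0 Cimg[symmetric] by auto
      show ?thesis
      proof (cases "s1 ''f'' 0 = 0")
        case True
        have C: "L i ! c \<subseteq> allocated" using True f1' by simp
        note loop = run_try_class[OF c s1, folded lo_def hi_def, OF _ q1 _ C, unfolded m1]
        show ?thesis
          using True
          apply (simp split del: if_split)
          apply (rule run_mono[OF loop])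
          subgoal using p by (simp add: fr lo_def)
          subgoal using p by (simp add: fr)
          subgoal premises r2 for t2 s2
          proof -
            let ?s = "s2(''p'' := (s2 ''p'')(0 := s2 ''q'' 0))"
            have m2: "marked ?s = marked s2" by (simp add: marked_def)
            have r3: "t2 \<le> 60 * (G + 1) * card (marked s2 - marked s) + 20 * (hi - lo) +
                (if s2 ''g'' 0 = 0 then (6 * G + 8) * n1 else 0)"
              "marked s \<subseteq> marked s2" "marked s2 \<subseteq> owners" "s2 ''q'' 0 = hi"
              "s2 ''g'' 0 = 1 \<and> searched s2 \<and> (\<forall>a \<in> L i ! c. a \<notin> obtainable L w i S) \<or>
               s2 ''g'' 0 = 0 \<and> traded c s2" using r2(2) by blast+
            have "searched ?s" if "searched s2"
              using that unfolding searched_def static_def dead_marks_def range_length_def m2 by simp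
            moreover have "traded c ?s" if "traded c s2"
              using that unfolding traded_def static_def range_length_def by simp
            ultimately have "?s ''g'' 0 = 1 \<and> searched ?s \<and> ?s ''p'' 0 = hi \<and>
                (\<forall>a \<in> L i ! c. a \<in> allocated \<and> a \<notin> obtainable L w i S) \<or>
              ?s ''g'' 0 = 0 \<and> traded c ?s \<and> L i ! c \<subseteq> allocated \<or>
              ?s ''g'' 0 = 0 \<and> taken c ?s"
              using r3(4,5) C by auto
            moreover have "t1 + Suc (Suc t2) \<le> 60 * (G + 1) * card (marked s2 - marked s) + 35 * (hi - lo) +
                (if s2 ''g'' 0 = 0 then (6 * G + 8) * n1 else 0)"
              using r3(1) t1 d by linarith
            ultimately show ?thesis using r3(2,3) by (simp add: m2)
          qed
          done
      next
        case False
        then have NC: "\<not> L i ! c \<subseteq> allocated" using f1' by simp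
        have i1: "s1 ''i'' 0 = i" using staticD(9)[OF st(1)] by (simp add: fr)
        have p0: "s ''p'' 0 = lo" using p by (simp add: lo_def)
        then have p1: "s1 ''p'' 0 = lo" by (simp add: fr)
        show ?thesis
          using False
          apply (simp split del: if_split)
          apply (rule run_mono[OF run_take_free[of s1 lo hi, OF p1 q1 i1 less_imp_le[OF lohi(1)]]])
          subgoal premises r2 for t2 s2
          proof -
            have r3: "t2 \<le> 4 * (hi - lo) + 2" "\<forall>b. s2 ''owner'' b =
                (if b \<in> s1 ''obj'' ` {lo..<hi} \<and> s1 ''owner'' b = 0 then Suc i else s1 ''owner'' b)"
              "unchanged {''u'', ''owner''} s1 s2"
              using r2(2) by blast+
            have fr2: "s2 v = s1 v" if "v \<notin> {''u'', ''owner''}" for v by (rule r3(3)[rule_format, OF that])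
            define s3 where "s3 = s2(''start'' := (s2 ''start'')(i := lo), ''end'' := (s2 ''end'')(i := hi),
              ''g'' := (s2 ''g'')(0 := 0))"
            have s3: "s3 ''start'' = (s ''start'')(i := lo)" "s3 ''end'' = (s ''end'')(i := hi)"
              "s3 ''owner'' = s2 ''owner''" "s3 ''g'' 0 = 0"
              "\<And>v. v \<notin> {''start'', ''end'', ''g'', ''u'', ''owner'', ''q'', ''f''} \<Longrightarrow> s3 v = s v"
              by (simp_all add: s3_def fr2 fr)
            have "range_length s3 v \<le> G" for v
              using staticD(13)[OF st(1), of v] lohi(2) by (simp add: range_length_def s3)
            then have st3: "static s3" using st(1) unfolding static_def by (simp add: s3)
            have m3: "marked s3 = marked s" by (simp add: marked_def s3)
            have o3: "b \<in> (w(i := L i ! c - allocated)) j \<longleftrightarrow> s3 ''owner'' b = Suc j" for b j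
            proof -
              have ob: "s3 ''owner'' b = (if b \<in> L i ! c \<and> b \<notin> allocated then Suc i else s0 ''owner'' b)"
                using r3(2) by (simp add: s3 fr st(3) staticD(1)[OF st(1)] Cimg owner_0)
              show ?thesis
              proof (cases "j = i")
                case True
                have "s0 ''owner'' b \<noteq> Suc i" using own[of b i] wi[OF L inv i] by simp
                then show ?thesis using True ob by auto
              next
                case False
                have "b \<in> w j \<Longrightarrow> b \<in> allocated" using inv_out[OF L inv, of j] by blast
                then show ?thesis using False ob own[of b j] by auto
              qed
            qed
            have "taken c s3"
              unfolding taken_def using st3 st(2) NC o3 by (simp add: s3 lo_def hi_def dead_marks_def)
            then show ?thesis
              using t1 r3(1) d mo m3 s3(4) unfolding set_range_def
              by (simp add: fr fr2 staticD(9)[OF st(1)] p0 q1 s3_def)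
          qed
          done
      qed
    qed
    done
qed

text \<open>Stated in terms of the mechanism's step alone, so that taking, trading and staying
  unmatched share one postcondition. Bounding the marks by \<open>Suc k\<close> makes them outdated
  for the next agent, whose stamp is one larger.\<close>

definition processed :: "store \<Rightarrow> bool" where
  "processed s \<longleftrightarrow>
     (\<forall>b j. b \<in> step_result j \<longleftrightarrow> s ''owner'' b = Suc j) \<and>
     (\<forall>j \<in> insert i S. step_result j \<noteq> {} \<longrightarrow> (\<exists>c < length (L j). own_rank n2 L step_result j = Suc c \<and>
        s ''start'' j = bd j c \<and> s ''end'' j = bd j (Suc c))) \<and>
     (\<forall>j. range_length s j \<le> G) \<and> (\<forall>y. s ''mark'' y \<le> Suc k) \<and>
     (\<forall>v \<in> {''obj'', ''cls'', ''pos'', ''off'', ''order'', ''n1'', ''partner''}. s v = s0 v)"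

text \<open>The rank of \<open>j\<close> is unchanged by the step and at most \<open>n2\<close>, so
  \<open>j\<close> owned objects already before, and his range is the one recorded then.\<close>

lemma ranges_preserved:
  assumes "static s" "j \<in> S" "step_result j \<noteq> {}"
  shows "\<exists>c < length (L j). own_rank n2 L step_result j = Suc c \<and>
    s ''start'' j = bd j c \<and> s ''end'' j = bd j (Suc c)"
proof -
  have eq: "own_rank n2 L step_result j = own_rank n2 L w j"
    using step_inv(3)[OF L inv i path_rule_bfs_rule _ assms(2)] by (metis prod.collapse)
  have Lj: "valid_pref n2 (L j)" by (rule inv_pref[OF L inv assms(2)])
  have inv': "alloc_inv n1 n2 L (insert i S) step_result"
    using step_inv(1,2)[OF L inv i path_rule_bfs_rule] by (metis prod.collapse)
  have "step_result j \<inter> acceptable (L j) \<noteq> {}"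
    using assms(3) inv_class[OF L inv', of j] acceptable_iff by fastforce
  then have "own_rank n2 L step_result j \<le> n2" by (rule first_class_acceptable[OF Lj])
  then have "w j \<noteq> {}" using eq by (auto simp: first_class_none)
  moreover have "j \<noteq> i" using assms(2) i by blast
  ultimately show ?thesis
    using ranges[OF assms(2)] eq staticD(11,12)[OF assms(1)] by simp
qed

lemma processedI:
  assumes "static s" "\<forall>y. s ''mark'' y \<le> Suc k" "\<forall>b j. b \<in> step_result j \<longleftrightarrow> s ''owner'' b = Suc j"
    and "step_result i \<noteq> {} \<Longrightarrow> \<exists>c < length (L i). own_rank n2 L step_result i = Suc c \<and>
        s ''start'' i = bd i c \<and> s ''end'' i = bd i (Suc c)"
  shows "processed s"
  unfolding processed_def
  using assms ranges_preserved[OF assms(1)] staticD(13)[OF assms(1)]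
  by (auto simp: static_def)

lemma traded_processed:
  assumes c: "c < length (L i)" "dead_below c" "L i ! c \<subseteq> allocated" and t: "traded c s"
  shows "processed s"
proof -
  obtain a where a: "a \<in> L i ! c" "a \<in> obtainable L w i S"
    "\<And>b. b \<in> L i ! c \<Longrightarrow> b \<in> obtainable L w i S \<Longrightarrow> pr a \<le> pr b"
    "\<forall>b j. b \<in> trading pr bfs_rule L w i a S j \<longleftrightarrow> s ''owner'' b = Suc j"
    and s: "static s" "\<forall>y. s ''mark'' y \<le> Suc k" "s ''start'' i = bd i c" "s ''end'' i = bd i (Suc c)"
    using t unfolding traded_def by blast
  note st = step_traded[OF c a(1-3)]
  show ?thesis
    by (rule processedI[OF s(1,2)]) (use st a(4) s(3,4) c(1) in auto)
qed

lemma taken_processed: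
  assumes c: "c < length (L i)" "dead_below c" and t: "taken c s"
  shows "processed s"
proof -
  have s: "static s" "\<forall>y. s ''mark'' y \<le> Suc k" "s ''start'' i = bd i c" "s ''end'' i = bd i (Suc c)"
    "\<not> L i ! c \<subseteq> allocated" "\<forall>b j. b \<in> (w(i := L i ! c - allocated)) j \<longleftrightarrow> s ''owner'' b = Suc j"
    using t unfolding taken_def by blast+
  note st = step_taken[OF c s(5)]
  show ?thesis
    by (rule processedI[OF s(1,2)]) (use st s(3,4,6) c(1) in \<open>auto simp only:\<close>)
qed

lemma unmatched_processed:
  assumes "dead_below (length (L i))" "searched s"
  shows "processed s"
proof -
  have s: "static s" "\<forall>y. s ''mark'' y \<le> Suc k" "s ''owner'' = s0 ''owner''"
    using assms(2) by (simp_all add: searched_def dead_marks_def)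
  show ?thesis
    by (rule processedI[OF s(1,2)])
      (simp_all add: step_unmatched[OF assms(1)] wi[OF L inv i] own s(3))
qed

text \<open>Marks accumulate over all classes of the agent, so the searches together cost at most
  \<open>60 * (G + 1) * n1\<close>; a single trade adds \<open>(6 * G + 8) * n1\<close>. The 36 per
  list entry are 35 for processing a class and one for the test of the loop.\<close>

lemma run_process_agent:
  assumes order: "s0 ''order'' k = i" and marks: "\<And>y. s0 ''mark'' y \<le> k"
  shows "run process_agent s0 (\<lambda>t s'.
    t \<le> (66 * G + 68) * n1 + 36 * (s0 ''off'' (Suc i) - s0 ''off'' i) + 6 \<and>
    processed s' \<and> s' ''k'' 0 = Suc k)"
proof -
  define m where "m = length (L i)"
  define I where "I \<tau> s \<longleftrightarrow>
    (\<exists>c \<le> m. s ''g'' 0 = 1 \<and> searched s \<and> s ''p'' 0 = bd i c \<and> dead_below c \<and>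
       \<tau> \<le> 60 * (G + 1) * card (marked s) + 36 * (bd i c - bd i 0)) \<or>
    s ''g'' 0 = 0 \<and> processed s \<and> s ''k'' 0 = k \<and>
      \<tau> \<le> 60 * (G + 1) * n1 + 36 * (bd i m - bd i 0) + (6 * G + 8) * n1" for \<tau> s
  define s1 where "s1 = s0(''i'' := (s0 ''i'')(0 := i), ''p'' := (s0 ''p'')(0 := s0 ''off'' i),
    ''e'' := (s0 ''e'')(0 := s0 ''off'' (Suc i)), ''g'' := (s0 ''g'')(0 := 1))"
  have card_n1: "card (marked s) \<le> n1" if "searched s" for s
  proof -
    have "marked s \<subseteq> {..<n1}" using that owners_n1 unfolding searched_def dead_marks_def by blast
    then show ?thesis using card_mono[of "{..<n1}"] by fastforce
  qed
  have bd_mono: "bd i c \<le> bd i m" if "c \<le> m" for c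
    using bd_le_end[of c] that bd_end by (simp add: m_def)
  have bd_0: "bd i 0 \<le> bd i c" if "c \<le> m" for c
    using that
  proof (induction c)
    case (Suc c) then show ?case using bd_less[OF i(2), of c] by (simp add: m_def)
  qed simp
  have "s1 ''mark'' y \<noteq> Suc k" for y using marks[of y] by (simp add: s1_def)
  then have m1: "marked s1 = {}" by (simp add: marked_def)
  have "static s1" unfolding static_def range_length_def using len by (simp add: s1_def range_length_def)
  moreover have "dead_marks s1" unfolding dead_marks_def m1 using marks by (simp add: s1_def le_SucI)
  ultimately have sr1: "searched s1" unfolding searched_def by (simp add: s1_def)
  have I1: "I 0 s1"
    unfolding I_def using sr1 by (auto simp: s1_def bd_start dead_below_def intro!: disjI1 exI[of _ 0])
  show ?thesis
    unfolding process_agent_def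
    apply (simp add: k order split del: if_split)
    apply (simp only: s1_def[symmetric, unfolded One_nat_def])
    apply (rule run_mono)
     apply (rule run_while[where I = I and N = "60 * (G + 1) * n1 + 36 * (bd i m - bd i 0) + (6 * G + 8) * n1", OF I1])
    subgoal premises r for \<tau> s
      using r unfolding I_def
    proof (elim disjE exE conjE)
      fix c assume c: "c \<le> m" "searched s"
        "\<tau> \<le> 60 * (G + 1) * card (marked s) + 36 * (bd i c - bd i 0)"
      have "60 * (G + 1) * card (marked s) \<le> 60 * (G + 1) * n1"
        by (rule mult_le_mono2[OF card_n1[OF c(2)]])
      moreover have "36 * (bd i c - bd i 0) \<le> 36 * (bd i m - bd i 0)"
        using bd_mono[OF c(1)] by simp
      ultimately show ?thesis using c(3) by linarith
    qed
    subgoal premises r for \<tau> s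
    proof -
      have g: "0 < s ''g'' 0" "s ''p'' 0 < s ''e'' 0" using r(2) by simp_all
      then obtain c where c: "c \<le> m" "s ''g'' 0 = 1" "searched s" "s ''p'' 0 = bd i c" "dead_below c"
        "\<tau> \<le> 60 * (G + 1) * card (marked s) + 36 * (bd i c - bd i 0)"
        using r(1) unfolding I_def by auto
      have "s ''e'' 0 = bd i m"
        using c(3) staticD(10) bd_end unfolding searched_def m_def by metis
      then have "c \<noteq> m" using g(2) c(4) by auto
      then have cm: "c < length (L i)" using c(1) by (simp add: m_def)
      have d: "bd i c < bd i (Suc c)" by (rule bd_less[OF i(2) cm])
      have sum: "bd i (Suc c) - bd i 0 = (bd i (Suc c) - bd i c) + (bd i c - bd i 0)"
        using d bd_0[OF c(1)] by simp
      show ?thesis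
      proof (rule run_mono[OF run_process_class[OF cm c(3,4,2)]], elim conjE)
        fix t s'
        assume t: "t \<le> 60 * (G + 1) * card (marked s' - marked s) + 35 * (bd i (Suc c) - bd i c) +
            (if s' ''g'' 0 = 0 then (6 * G + 8) * n1 else 0)"
          and mk: "marked s \<subseteq> marked s'" "marked s' \<subseteq> owners"
          and cases: "s' ''g'' 0 = 1 \<and> searched s' \<and> s' ''p'' 0 = bd i (Suc c) \<and>
              (\<forall>a \<in> L i ! c. a \<in> allocated \<and> a \<notin> obtainable L w i S) \<or>
            s' ''g'' 0 = 0 \<and> traded c s' \<and> L i ! c \<subseteq> allocated \<or>
            s' ''g'' 0 = 0 \<and> taken c s'"
        have fin: "finite (marked s')" using mk(2) finite_owners finite_subset by blast
        \<comment> \<open>Marks are never removed while one agent is served, so the charges of the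
          successive classes add up.\<close>
        have cards: "card (marked s') = card (marked s' - marked s) + card (marked s)"
          using card_Diff_subset[OF finite_subset[OF mk(1) fin] mk(1)] card_mono[OF fin mk(1)] by simp
        define A B where "A = 60 * (G + 1) * card (marked s' - marked s)"
          and "B = 60 * (G + 1) * card (marked s)"
        have AB: "60 * (G + 1) * card (marked s') = A + B"
          unfolding cards A_def B_def by (simp add: algebra_simps)
        have time: "\<tau> + t + 1 \<le> 60 * (G + 1) * card (marked s') + 36 * (bd i (Suc c) - bd i 0) +
            (if s' ''g'' 0 = 0 then (6 * G + 8) * n1 else 0)"
        proof -
          define d1 d0 X where "d1 = bd i (Suc c) - bd i c" and "d0 = bd i c - bd i 0"
            and "X = (if s' ''g'' 0 = 0 then (6 * G + 8) * n1 else 0)"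
          have "t \<le> A + 35 * d1 + X" "\<tau> \<le> B + 36 * d0" "1 \<le> d1"
            using t c(6) d by (simp_all add: A_def B_def d1_def d0_def X_def)
          then show ?thesis unfolding AB sum d1_def[symmetric] d0_def[symmetric] X_def[symmetric] by simp
        qed
        have n: "60 * (G + 1) * card (marked s') \<le> 60 * (G + 1) * n1"
          using card_mono[OF _ subset_trans[OF mk(2) owners_n1]] by (intro mult_le_mono2) fastforce
        have h: "36 * (bd i (Suc c) - bd i 0) \<le> 36 * (bd i m - bd i 0)"
          using bd_mono[of "Suc c"] cm by (simp add: m_def)
        have time': "\<tau> + t + 1 \<le> 60 * (G + 1) * n1 + 36 * (bd i m - bd i 0) + (6 * G + 8) * n1"
          if "s' ''g'' 0 = 0"
          using time[unfolded if_P[OF that]] by (rule le_trans) (intro add_mono n h order_refl)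
        from cases show "I (\<tau> + t + 1) s'"
        proof (elim disjE conjE)
          assume s': "s' ''g'' 0 = 1" "searched s'" "s' ''p'' 0 = bd i (Suc c)"
            "\<forall>a \<in> L i ! c. a \<in> allocated \<and> a \<notin> obtainable L w i S"
          have "dead_below (Suc c)"
            using c(5) s'(4) unfolding dead_below_def by (simp add: less_Suc_eq)
          then show ?thesis
            unfolding I_def using s' time cm
            by (intro disjI1 exI[of _ "Suc c"]) (simp add: m_def)
        next
          assume s': "s' ''g'' 0 = 0" "traded c s'" "L i ! c \<subseteq> allocated"
          then show ?thesis
            unfolding I_def using traded_processed[OF cm c(5) s'(3,2)] time' k staticD(7)[of s']
            by (simp add: traded_def)
        next
          assume s': "s' ''g'' 0 = 0" "taken c s'"
          then show ?thesis
            unfolding I_def using taken_processed[OF cm c(5) s'(2)] time' k staticD(7)[of s']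
            by (simp add: taken_def)
        qed
      qed
    qed
    subgoal premises r for t s
    proof -
      obtain \<tau> where \<tau>: "t = Suc \<tau>" "I \<tau> s" "\<not> (0 < s ''g'' 0 \<and> s ''p'' 0 < s ''e'' 0)" using r by auto
      have *: "processed s \<and> s ''k'' 0 = k \<and>
        \<tau> \<le> 60 * (G + 1) * n1 + 36 * (bd i m - bd i 0) + (6 * G + 8) * n1"
        using \<tau>(2) unfolding I_def
      proof (elim disjE exE conjE)
        fix c assume c: "c \<le> m" "s ''g'' 0 = 1" "searched s" "s ''p'' 0 = bd i c" "dead_below c"
          "\<tau> \<le> 60 * (G + 1) * card (marked s) + 36 * (bd i c - bd i 0)"
        have "s ''e'' 0 = bd i m"
          using c(3) staticD(10) bd_end unfolding searched_def m_def by metis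
        then have "\<not> bd i c < bd i m" using \<tau>(3) c(2,4) by simp
        moreover have "bd i c < bd i m" if "c < m"
          using bd_less[OF i(2), of c] bd_mono[of "Suc c"] that by (simp add: m_def)
        ultimately have cm: "c = m" using c(1) by fastforce
        have "60 * (G + 1) * card (marked s) \<le> 60 * (G + 1) * n1"
          by (rule mult_le_mono2[OF card_n1[OF c(3)]])
        then have "\<tau> \<le> 60 * (G + 1) * n1 + 36 * (bd i m - bd i 0) + (6 * G + 8) * n1"
          using c(6) unfolding cm by linarith
        moreover have "s ''k'' 0 = k" using c(3) k staticD(7)[of s] by (simp add: searched_def)
        moreover have "processed s" using unmatched_processed c(3,5) unfolding cm m_def by blast
        ultimately show ?thesis by blast
      qed blast
      let ?s = "s(''k'' := (s ''k'')(0 := Suc k))"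
      have "processed ?s" using * unfolding processed_def range_length_def by simp
      moreover have "bd i m = s0 ''off'' (Suc i)" "bd i 0 = s0 ''off'' i" using bd_end bd_start by (simp_all add: m_def)
      ultimately show ?thesis using * \<tau>(1) by (simp add: algebra_simps)
    qed
    done
qed

end


section \<open>The input\<close>

lemma concat_nth_sum:
  assumes "i < length xss" "j < length (xss ! i)"
  shows "(\<Sum>i' < i. length (xss ! i')) + j < length (concat xss) \<and>
    concat xss ! ((\<Sum>i' < i. length (xss ! i')) + j) = xss ! i ! j"
  using assms
proof (induction xss arbitrary: i)
  case (Cons xs xss)
  show ?case
  proof (cases i)
    case 0 then show ?thesis using Cons.prems by (simp add: nth_append)
  next
    case (Suc i')
    then show ?thesis
      using Cons.IH[of i'] Cons.prems by (simp add: sum.lessThan_Suc_shift nth_append add.assoc del: sum.lessThan_Suc)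
  qed
qed simp

lemma length_concat_sum: "length (concat xss) = (\<Sum>i < length xss. length (xss ! i))"
  by (induction xss) (simp_all add: sum.lessThan_Suc_shift del: sum.lessThan_Suc)

lemma length_entries: "length (entries cs) = (\<Sum>c < length cs. length (cs ! c))"
  unfolding entries_def length_concat_sum by simp

lemma entries_nth:
  assumes "c < length cs" "j < length (cs ! c)"
  shows "(\<Sum>c' < c. length (cs ! c')) + j < length (entries cs)"
    and "entries cs ! ((\<Sum>c' < c. length (cs ! c')) + j) = (Suc c, cs ! c ! j)"
proof -
  let ?xss = "map (\<lambda>k. map (\<lambda>a. (k + 1, a)) (cs ! k)) [0..<length cs]"
  have eq: "(\<Sum>c' < c. length (?xss ! c')) = (\<Sum>c' < c. length (cs ! c'))"
    by (rule sum.cong) (use assms(1) in auto)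
  from concat_nth_sum[of c ?xss j, unfolded eq] assms
  show "(\<Sum>c' < c. length (cs ! c')) + j < length (entries cs)"
    "entries cs ! ((\<Sum>c' < c. length (cs ! c')) + j) = (Suc c, cs ! c ! j)"
    unfolding entries_def by auto
qed

locale sdmt2_instance =
  fixes n1 n2 :: nat and \<sigma> :: "nat list" and pr :: "nat \<Rightarrow> nat" and L :: profile
    and D :: "nat \<Rightarrow> nat list list"
  assumes order: "agent_order n1 \<sigma>" and pr: "common_order n2 pr"
    and L: "valid_profile n1 n2 L" and listing: "listing n1 D L"
begin

abbreviation "input \<equiv> input_store n1 n2 \<sigma> pr D"

definition "offset i = (\<Sum>j < i. length (entries (D j)))"

definition "bound i c = offset i + (\<Sum>c' < c. length (D i ! c'))"

abbreviation "G \<equiv> max_class_size n1 L"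

lemma L_D: "i < n1 \<Longrightarrow> L i = map set (D i)" and D_distinct: "i < n1 \<Longrightarrow> c < length (D i) \<Longrightarrow> distinct (D i ! c)"
  using listing unfolding listing_def by simp_all

lemma length_order: "length \<sigma> = n1" and set_order: "set \<sigma> = {..<n1}" and distinct_order: "distinct \<sigma>"
  using order distinct_card[of \<sigma>] unfolding agent_order_def by auto

lemma input_n1: "input ''n1'' 0 = n1" and input_order: "k < n1 \<Longrightarrow> input ''order'' k = \<sigma> ! k"
  and input_pos: "a < n2 \<Longrightarrow> input ''pos'' a = pr a"
  and input_off: "i \<le> n1 \<Longrightarrow> input ''off'' i = offset i"
  and input_zero: "v \<in> {''k'', ''owner'', ''start'', ''end'', ''mark'', ''partner''} \<Longrightarrow> input v = (\<lambda>_. 0)"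
  using length_order
  by (auto simp: input_store_def Let_def table_def offset_def simp del: upt_Suc map_map)

lemma input_entry:
  assumes "i < n1" "c < length (L i)" "j < length (D i ! c)"
  shows "input ''cls'' (bound i c + j) = Suc c" "input ''obj'' (bound i c + j) = D i ! c ! j"
proof -
  let ?xss = "map (\<lambda>i. entries (D i)) [0..<n1]"
  let ?j = "(\<Sum>c' < c. length (D i ! c')) + j"
  have c: "c < length (D i)" using assms(1,2) L_D by simp
  note e = entries_nth[OF c assms(3)]
  have eq: "(\<Sum>i' < i. length (?xss ! i')) = offset i"
    unfolding offset_def by (rule sum.cong) (use assms(1) in auto)
  have "offset i + ?j < length (concat ?xss) \<and> concat ?xss ! (offset i + ?j) = (Suc c, D i ! c ! j)"
    using concat_nth_sum[of i ?xss ?j, unfolded eq] assms(1) e by simp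
  then show "input ''cls'' (bound i c + j) = Suc c" "input ''obj'' (bound i c + j) = D i ! c ! j"
    by (simp_all add: input_store_def Let_def table_def bound_def add.assoc del: map_map)
qed

lemma class_size:
  assumes "i < n1" "c < length (L i)"
  shows "bound i (Suc c) = bound i c + card (L i ! c)" "0 < card (L i ! c)" "card (L i ! c) \<le> G"
    "length (D i ! c) = card (L i ! c)"
proof -
  have c: "c < length (D i)" using assms L_D by simp
  show len: "length (D i ! c) = card (L i ! c)"
    using distinct_card[OF D_distinct[OF assms(1) c]] c L_D[OF assms(1)] by simp
  then show "bound i (Suc c) = bound i c + card (L i ! c)" by (simp add: bound_def)
  have "valid_pref n2 (L i)" using L assms(1) by (simp add: valid_profile_def)
  then have "L i ! c \<noteq> {}" by (rule nth_class_nonempty) (rule assms(2))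
  moreover have "finite (L i ! c)" using c L_D[OF assms(1)] by simp
  ultimately show "0 < card (L i ! c)" by (simp add: card_gt_0_iff)
  have "card (L i ! c) \<in> card ` set (L i)" using assms(2) by simp
  then show "card (L i ! c) \<le> G"
    unfolding max_class_size_def using assms(1) by (intro Max_ge) auto
qed

lemma bound_positions:
  assumes "i < n1" "c < length (L i)" "u \<in> {bound i c..<bound i (Suc c)}"
  obtains j where "j < length (D i ! c)" "u = bound i c + j"
  using assms class_size[OF assms(1,2)] by (metis add_less_cancel_left atLeastLessThan_iff le_Suc_ex)

lemma bound_objects:
  assumes "i < n1" "c < length (L i)"
  shows "input ''obj'' ` {bound i c..<bound i (Suc c)} = L i ! c"
    and "inj_on (input ''obj'') {bound i c..<bound i (Suc c)}"
proof -
  have c: "c < length (D i)" using assms L_D by simp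
  have set: "L i ! c = set (D i ! c)" using c L_D[OF assms(1)] by simp
  have "{bound i c..<bound i (Suc c)} = (\<lambda>j. bound i c + j) ` {..<length (D i ! c)}"
  proof (intro equalityI subsetI)
    fix u assume "u \<in> {bound i c..<bound i (Suc c)}"
    then show "u \<in> (\<lambda>j. bound i c + j) ` {..<length (D i ! c)}"
      by (rule bound_positions[OF assms]) auto
  next
    fix u assume "u \<in> (\<lambda>j. bound i c + j) ` {..<length (D i ! c)}"
    then show "u \<in> {bound i c..<bound i (Suc c)}" using class_size[OF assms] by auto
  qed
  then show im: "input ''obj'' ` {bound i c..<bound i (Suc c)} = L i ! c"
    unfolding set using input_entry(2)[OF assms] by (auto simp: image_image set_conv_nth image_iff)
  have "card {bound i c..<bound i (Suc c)} = card (L i ! c)" using class_size[OF assms] by simp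
  then show "inj_on (input ''obj'') {bound i c..<bound i (Suc c)}"
    using im by (intro eq_card_imp_inj_on) auto
qed

text \<open>The classes of an agent are disjoint and listed without repetition, so the number of
  stored entries is the number of acceptable objects.\<close>

lemma offset_total: "offset n1 = total_length n1 L"
proof -
  have "length (entries (D i)) = card (acceptable (L i))" if i: "i < n1" for i
  proof -
    have v: "valid_pref n2 (L i)" using L i by (simp add: valid_profile_def)
    have "acceptable (L i) = (\<Union>c < length (L i). L i ! c)"
      unfolding acceptable_def by (auto simp: set_conv_nth)
    also have "card \<dots> = (\<Sum>c < length (L i). card (L i ! c))"
    proof (rule card_UN_disjoint)
      show "\<forall>c \<in> {..<length (L i)}. finite (L i ! c)" using L_D[OF i] by simp
      show "\<forall>c \<in> {..<length (L i)}. \<forall>d \<in> {..<length (L i)}. c \<noteq> d \<longrightarrow> L i ! c \<inter> L i ! d = {}"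
        using nth_class_disjoint[OF v, of _ "Suc _" "Suc _"] by (auto simp: nth_class_Suc)
    qed simp
    also have "\<dots> = (\<Sum>c < length (D i). length (D i ! c))"
      by (rule sum.cong) (use class_size(4)[OF i] L_D[OF i] in auto)
    finally show ?thesis by (simp add: length_entries)
  qed
  then show ?thesis by (simp add: offset_def total_length_def)
qed

lemma bound_last: "i < n1 \<Longrightarrow> bound i (length (L i)) = offset (Suc i)"
  using L_D[of i] by (simp add: bound_def offset_def length_entries)


section \<open>Running the implementation\<close>

abbreviation "ownership_after k \<equiv> sdmt2_ownership n2 pr bfs_rule L (take k \<sigma>)"

definition state_ok :: "nat \<Rightarrow> store \<Rightarrow> bool" where
  "state_ok k s \<longleftrightarrow>
     (\<forall>a j. a \<in> ownership_after k j \<longleftrightarrow> s ''owner'' a = Suc j) \<and>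
     (\<forall>j \<in> set (take k \<sigma>). ownership_after k j \<noteq> {} \<longrightarrow>
        (\<exists>c < length (L j). own_rank n2 L (ownership_after k) j = Suc c \<and>
           s ''start'' j = bound j c \<and> s ''end'' j = bound j (Suc c))) \<and>
     (\<forall>j. range_length s j \<le> G) \<and> (\<forall>y. s ''mark'' y \<le> k) \<and> s ''k'' 0 = k \<and>
     (\<forall>v \<in> {''obj'', ''cls'', ''pos'', ''off'', ''order'', ''n1'', ''partner''}. s v = input v)"

lemma state_ok_init: "state_ok 0 input"
  unfolding state_ok_def by (simp add: sdmt2_ownership_def input_zero range_length_def)

lemma run_after:
  assumes "k \<le> n1"
  shows "run_sdmt2 n2 pr bfs_rule L (take k \<sigma>) = (set (take k \<sigma>), ownership_after k)"
    and "alloc_inv n1 n2 L (set (take k \<sigma>)) (ownership_after k)"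
proof -
  obtain S w where r: "run_sdmt2 n2 pr bfs_rule L (take k \<sigma>) = (S, w)" by fastforce
  have "distinct (take k \<sigma>)" "set (take k \<sigma>) \<subseteq> {..<n1}"
    using distinct_order set_order set_take_subset[of k \<sigma>] by auto
  then have "S = set (take k \<sigma>) \<and> alloc_inv n1 n2 L S w"
    using run_inv[OF L path_rule_bfs_rule _ _ r] by blast
  then show "run_sdmt2 n2 pr bfs_rule L (take k \<sigma>) = (set (take k \<sigma>), ownership_after k)"
    "alloc_inv n1 n2 L (set (take k \<sigma>)) (ownership_after k)"
    using r by (auto simp: sdmt2_ownership_def)
qed

lemma run_agent:
  assumes kn: "k < n1" and s: "state_ok k s"
  shows "run process_agent s (\<lambda>t s'.
    t \<le> (66 * G + 68) * n1 + 36 * length (entries (D (\<sigma> ! k))) + 6 \<and> state_ok (Suc k) s')"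
proof -
  let ?i = "\<sigma> ! k" and ?S = "set (take k \<sigma>)" and ?w = "ownership_after k"
  have ik: "?i < n1" using kn length_order set_order nth_mem[of k \<sigma>] by auto
  have iS: "?i \<notin> ?S"
    using kn length_order distinct_order by (auto simp: in_set_conv_nth nth_eq_iff_index_eq)
  note so = s[unfolded state_ok_def]
  have inp: "s ''obj'' = input ''obj''" "s ''cls'' = input ''cls''" "s ''pos'' = input ''pos''"
    "s ''off'' = input ''off''" "s ''order'' = input ''order''" "s ''n1'' = input ''n1''"
    "s ''partner'' = input ''partner''" and k0: "s ''k'' 0 = k"
    using so by simp_all
  interpret agent_step n1 n2 L pr ?S ?w ?i k G bound s
  proof unfold_locales
    show "alloc_inv n1 n2 L ?S ?w" by (rule run_after) (use kn in simp)
    fix j c assume jc: "j < n1" "c < length (L j)"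
    show "bound j c < bound j (Suc c)" "bound j (Suc c) - bound j c \<le> G"
      using class_size[OF jc] by simp_all
    show "s ''obj'' ` {bound j c..<bound j (Suc c)} = L j ! c"
      "inj_on (s ''obj'') {bound j c..<bound j (Suc c)}"
      unfolding inp using bound_objects[OF jc] by simp_all
    show "s ''cls'' u = Suc c" if "u \<in> {bound j c..<bound j (Suc c)}" for u
      using bound_positions[OF jc that] input_entry(1)[OF jc] unfolding inp by metis
  next
    show "bound ?i 0 = s ''off'' ?i" unfolding inp using ik by (simp add: input_off bound_def)
    show "bound ?i (length (L ?i)) = s ''off'' (Suc ?i)" unfolding inp using ik by (simp add: input_off bound_last)
    show "s ''pos'' a = pr a" if "a < n2" for a unfolding inp using that by (rule input_pos)
    show "a \<in> ?w j \<longleftrightarrow> s ''owner'' a = Suc j" for a j using so by blast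
    show "\<exists>c < length (L j). own_rank n2 L ?w j = Suc c \<and> s ''start'' j = bound j c \<and> s ''end'' j = bound j (Suc c)"
      if "j \<in> ?S" "?w j \<noteq> {}" for j using so that by blast
    show "range_length s j \<le> G" for j using so by blast
  qed (use L ik iS pr k0 in auto)
  have off: "s ''off'' (Suc ?i) - s ''off'' ?i = length (entries (D ?i))"
    unfolding inp using ik by (simp add: input_off offset_def)
  have run: "run process_agent s (\<lambda>t s'.
    t \<le> (66 * G + 68) * n1 + 36 * (s ''off'' (Suc ?i) - s ''off'' ?i) + 6 \<and>
    processed s' \<and> s' ''k'' 0 = Suc k)"
    by (rule run_process_agent) (use so kn in \<open>simp_all add: inp input_order\<close>)
  have take: "take (Suc k) \<sigma> = take k \<sigma> @ [?i]"
    using kn length_order by (simp add: take_Suc_conv_app_nth)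
  have "ownership_after (Suc k) = snd (sdmt2_step n2 pr bfs_rule L ?i (run_sdmt2 n2 pr bfs_rule L (take k \<sigma>)))"
    unfolding sdmt2_ownership_def take by simp
  then have next_w: "ownership_after (Suc k) = step_result"
    using run_after(1)[of k] kn by simp
  show ?thesis
  proof (rule run_mono[OF run], elim conjE, intro conjI)
    fix t s' assume t: "t \<le> (66 * G + 68) * n1 + 36 * (s ''off'' (Suc ?i) - s ''off'' ?i) + 6"
      and p: "processed s'" "s' ''k'' 0 = Suc k"
    show "t \<le> (66 * G + 68) * n1 + 36 * length (entries (D ?i)) + 6" using t unfolding off .
    have "set (take (Suc k) \<sigma>) = insert ?i ?S" by (simp add: take)
    then show "state_ok (Suc k) s'"
      using p inp unfolding state_ok_def next_w processed_def by simp
  qed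
qed

lemma run_partners:
  assumes s: "state_ok n1 s"
  shows "run assign_partners s (\<lambda>t s'. t \<le> (6 * G + 9) * n1 + 2 \<and>
    stored_matching n1 s' = sdmt2 n1 n2 \<sigma> pr bfs_rule L)"
proof -
  define w where "w = ownership_after n1"
  note so = s[unfolded state_ok_def, folded w_def]
  have take: "take n1 \<sigma> = \<sigma>" using length_order by simp
  have inv: "alloc_inv n1 n2 L {..<n1} w"
    using run_after(2)[of n1] set_order by (simp add: take w_def)
  have own: "a \<in> w j \<longleftrightarrow> s ''owner'' a = Suc j" for a j using so by blast
  \<comment> \<open>Holds for every agent: one without objects may have a leftover range, but no
    position in it is owned by him.\<close>
  have image: "s ''obj'' ` owned_positions s j j = w j" for j
  proof (cases "w j = {}")
    case True
    then show ?thesis using own[of _ j] by (auto simp: owned_positions_def)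
  next
    case False
    then have j: "j \<in> {..<n1}" using inv_out[OF L inv, of j] by blast
    then obtain c where c: "c < length (L j)" "own_rank n2 L w j = Suc c"
      "s ''start'' j = bound j c" "s ''end'' j = bound j (Suc c)"
      using bspec[OF so[THEN conjunct2, THEN conjunct1], of j] False set_order by (auto simp: take)
    have "s ''obj'' ` {s ''start'' j..<s ''end'' j} = L j ! c"
      using bound_objects(1)[OF _ c(1)] j so c by simp
    moreover have "w j \<subseteq> L j ! c" using inv_class[OF L inv, of j] c by (simp add: nth_class_Suc)
    moreover have "s ''obj'' ` owned_positions s j j = s ''obj'' ` {s ''start'' j..<s ''end'' j} \<inter> w j"
      unfolding owned_positions_def using own by auto
    ultimately show ?thesis by blast
  qed
  define I where "I \<tau> s' \<longleftrightarrow> s' ''i'' 0 \<le> n1 \<and> \<tau> \<le> (6 * G + 8) * s' ''i'' 0 \<and>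
    (\<forall>j. s' ''partner'' j = (if j < s' ''i'' 0 \<and> w j \<noteq> {} then Suc (highest pr (w j)) else 0)) \<and>
    unchanged {''i'', ''n'', ''v'', ''best'', ''partner''} s s'" for \<tau> s'
  have n1: "s ''n1'' 0 = n1" using so input_n1 by simp
  have p0: "s ''partner'' = (\<lambda>_. 0)" using so input_zero by simp
  show ?thesis
    unfolding assign_partners_def
    apply (simp split del: if_split)
    apply (rule run_mono)
     apply (rule run_while[where I = I and N = "(6 * G + 8) * n1"])
    subgoal by (simp add: I_def p0)
    subgoal unfolding I_def by (meson le_trans mult_le_mono2)
    subgoal premises r for \<tau> s1
    proof -
      note I = r(1)[unfolded I_def]
      have frA: "unchanged {''i'', ''n'', ''v'', ''best'', ''partner''} s s1" using I by argo
      have fr: "s1 v = s v" if "v \<notin> {''i'', ''n'', ''v'', ''best'', ''partner''}" for v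
        by (rule frA[rule_format, OF that])
      define j where "j = s1 ''i'' 0"
      have j: "j < n1" using r(2) by (simp add: fr n1 j_def)
      have op: "owned_positions s1 j j = owned_positions s j j" and rl: "range_length s1 j = range_length s j"
        by (simp_all add: owned_positions_def range_length_def fr)
      note fb = run_find_best[of "''i''" "''i''" s1, folded j_def, unfolded op rl]
      show ?thesis
        apply (simp split del: if_split)
        apply (rule run_mono[OF fb])
          apply simp
         apply simp
        subgoal premises q for t2 s2
        proof -
          let ?P = "owned_positions s j j"
          have t2: "t2 \<le> 6 * range_length s j + 3" and n2: "s2 ''n'' 0 = card ?P"
            and best: "?P \<noteq> {} \<longrightarrow> s2 ''best'' 0 \<in> s1 ''obj'' ` ?P \<and>
              (\<forall>u \<in> ?P. s1 ''pos'' (s2 ''best'' 0) \<le> s1 ''pos'' (s1 ''obj'' u))"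
            and frB: "unchanged find_vars s1 s2"
            using q by argo+
          have fr2: "s2 v = s1 v" if "v \<notin> find_vars" for v
            by (rule frB[rule_format, OF that])
          have "range_length s j \<le> G" using so by blast
          then have t2': "t2 \<le> 6 * G + 3" using t2 by simp
          have P_iff: "0 < card ?P \<longleftrightarrow> w j \<noteq> {}"
            using image[of j] by (auto simp: card_gt_0_iff owned_positions_def)
          have hi: "highest pr (w j) = s2 ''best'' 0" if ne: "w j \<noteq> {}"
          proof (rule highest_eq[OF common_order_inj[OF pr inv_bound[OF L inv]]])
            have P: "?P \<noteq> {}" using ne image[of j] by auto
            have in_w: "s2 ''best'' 0 \<in> w j" using best P image[of j] by (simp add: fr)
            then show "s2 ''best'' 0 \<in> w j" .
            fix b assume b: "b \<in> w j"
            then have "b \<in> s ''obj'' ` ?P" using image[of j] by simp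
            then have le: "s ''pos'' (s2 ''best'' 0) \<le> s ''pos'' b"
              using best P by (elim imageE) (simp add: fr)
            have "b < n2" "s2 ''best'' 0 < n2" using b in_w inv_bound[OF L inv, of j] by blast+
            then show "pr (s2 ''best'' 0) \<le> pr b" using le so input_pos by simp
          qed
          define s3 where "s3 = (if w j \<noteq> {} then s2(''partner'' := (s2 ''partner'')(j := Suc (s2 ''best'' 0))) else s2)"
          have part: "s1 ''partner'' v = (if v < j \<and> w v \<noteq> {} then Suc (highest pr (w v)) else 0)" for v
            using I unfolding j_def by blast
          have "I (\<tau> + (t2 + 4)) (s3(''i'' := (s3 ''i'')(0 := Suc j)))"
            unfolding I_def
          proof (intro conjI allI impI)
            have "\<tau> \<le> (6 * G + 8) * j" using I unfolding j_def by blast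
            then show "\<tau> + (t2 + 4) \<le> (6 * G + 8) * (s3(''i'' := (s3 ''i'')(0 := Suc j))) ''i'' 0"
              using t2' by simp
            show "(s3(''i'' := (s3 ''i'')(0 := Suc j))) ''partner'' v =
                (if v < (s3(''i'' := (s3 ''i'')(0 := Suc j))) ''i'' 0 \<and> w v \<noteq> {}
                 then Suc (highest pr (w v)) else 0)" for v
              using hi part[of v] by (cases "v = j") (auto simp: s3_def fr2 less_Suc_eq)
            show "(s3(''i'' := (s3 ''i'')(0 := Suc j))) v = s v"
              if "v \<notin> {''i'', ''n'', ''v'', ''best'', ''partner''}" for v
              using that fr[OF that] fr2[of v] by (simp add: s3_def)
          qed (use j in simp)
          moreover have "s2 ''i'' 0 = j" by (simp add: fr2 j_def)
          ultimately show ?thesis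
            using n2 P_iff by (cases "w j = {}") (simp_all add: s3_def eval_nat_numeral)
        qed
        done
    qed
    subgoal premises r for t s1
    proof -
      obtain \<tau> where \<tau>: "t = Suc \<tau>" "I \<tau> s1" "\<not> s1 ''i'' 0 < s1 ''n1'' 0" using r by auto
      note I = \<tau>(2)[unfolded I_def]
      have frA: "unchanged {''i'', ''n'', ''v'', ''best'', ''partner''} s s1" using I by argo
      then have "s1 ''n1'' 0 = n1" using n1 by simp
      then have i: "s1 ''i'' 0 = n1" using \<tau>(3) I by linarith
      have part: "s1 ''partner'' v = (if v < n1 \<and> w v \<noteq> {} then Suc (highest pr (w v)) else 0)" for v
        using I unfolding i by blast
      have "sdmt2_ownership n2 pr bfs_rule L \<sigma> = w" by (simp add: w_def take)
      then have "stored_matching n1 s1 = sdmt2 n1 n2 \<sigma> pr bfs_rule L"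
        unfolding stored_matching_def sdmt2_def Let_def by (auto simp: part split: if_splits)
      moreover have "\<tau> \<le> (6 * G + 8) * n1" using I unfolding i by blast
      ultimately show ?thesis using \<tau>(1) by (simp add: algebra_simps)
    qed
    done
qed

lemma implementation:
  "\<exists>T. implements_sdmt2 Skip more_agents process_agent assign_partners bfs_rule n1 n2 \<sigma> pr L D T \<and>
     T \<le> n1 * ((66 * G + 68) * n1 + 7) + 36 * total_length n1 L + (6 * G + 9) * n1 + 4"
proof -
  define B where "B k = (66 * G + 68) * n1 + 36 * length (entries (D (\<sigma> ! k))) + 6" for k
  \<comment> \<open>\<open>implements_sdmt2\<close> asks for the stores between the executions of
    the body, so a whole sequence is chosen, each store being an outcome of running the body from
    the previous one.\<close>
  have "\<exists>f. \<forall>k. (k \<le> n1 \<longrightarrow> state_ok k (f k)) \<and> (k = 0 \<longrightarrow> f k = input) \<and>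
    (k < n1 \<longrightarrow> (\<exists>t \<le> B k. exec process_agent (f k) t (f (Suc k))))"
  proof -
    have "\<exists>f. \<forall>k. ((k \<le> n1 \<longrightarrow> state_ok k (f k)) \<and> (k = 0 \<longrightarrow> f k = input)) \<and>
      (k < n1 \<longrightarrow> (\<exists>t \<le> B k. exec process_agent (f k) t (f (Suc k))))"
    proof (rule dependent_nat_choice)
      show "\<exists>s. (0 \<le> n1 \<longrightarrow> state_ok 0 s) \<and> (0 = 0 \<longrightarrow> s = input)" using state_ok_init by auto
      fix s k assume s: "(k \<le> n1 \<longrightarrow> state_ok k s) \<and> (k = 0 \<longrightarrow> s = input)"
      show "\<exists>s'. ((Suc k \<le> n1 \<longrightarrow> state_ok (Suc k) s') \<and> (Suc k = 0 \<longrightarrow> s' = input)) \<and>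
        (k < n1 \<longrightarrow> (\<exists>t \<le> B k. exec process_agent s t s'))"
      proof (cases "k < n1")
        case True
        then show ?thesis using run_agent[OF True, of s] s unfolding run_def B_def by fastforce
      qed auto
    qed
    then show ?thesis by blast
  qed
  then obtain f where f: "\<And>k. k \<le> n1 \<Longrightarrow> state_ok k (f k)" "f 0 = input"
    "\<And>k. k < n1 \<Longrightarrow> \<exists>t \<le> B k. exec process_agent (f k) t (f (Suc k))" by metis
  have guard: "bval more_agents (f k) \<longleftrightarrow> k < n1" if "k \<le> n1" for k
    using f(1)[OF that] input_n1 by (simp add: state_ok_def more_agents_def)
  have "\<exists>T. exec (While more_agents process_agent) (f k) T (f n1) \<and> T \<le> 1 + (\<Sum>k \<in> {k..<n1}. B k + 1)"
    if "k \<le> n1" for k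
    using that
  proof (induction rule: inc_induct)
    case base
    then show ?case using exec.WhileFalse[of more_agents "f n1"] guard[of n1] by auto
  next
    case (step k)
    then obtain T where T: "exec (While more_agents process_agent) (f (Suc k)) T (f n1)"
      "T \<le> 1 + (\<Sum>k \<in> {Suc k..<n1}. B k + 1)" by blast
    obtain t where t: "t \<le> B k" "exec process_agent (f k) t (f (Suc k))" using f(3) step by blast
    have "exec (While more_agents process_agent) (f k) (1 + t + T) (f n1)"
      by (rule exec.WhileTrue[OF _ t(2) T(1)]) (use guard[of k] step in simp)
    moreover have "(\<Sum>k \<in> {k..<n1}. B k + 1) = B k + 1 + (\<Sum>k \<in> {Suc k..<n1}. B k + 1)"
      using step(2) by (simp add: sum.atLeast_Suc_lessThan)
    ultimately show ?case using T(2) t(1) by (intro exI[of _ "1 + t + T"]) simp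
  qed
  from this[of 0] obtain T1 where T1: "exec (While more_agents process_agent) input T1 (f n1)"
    "T1 \<le> 1 + (\<Sum>k < n1. B k + 1)" using f(2) by (auto simp: atLeast0LessThan)
  obtain T2 out where T2: "exec assign_partners (f n1) T2 out" "T2 \<le> (6 * G + 9) * n1 + 2"
    "stored_matching n1 out = sdmt2 n1 n2 \<sigma> pr bfs_rule L"
    using run_partners[OF f(1)[of n1]] unfolding run_def by auto
  have T: "exec (Seq Skip (Seq (While more_agents process_agent) assign_partners)) input (1 + (T1 + T2)) out"
    by (intro exec.Seq[OF exec.Skip] exec.Seq[OF T1(1) T2(1)])
  \<comment> \<open>The order is a permutation of the agents, so summing list lengths along it gives
    the total length.\<close>
  have "(\<Sum>k < n1. length (entries (D (\<sigma> ! k)))) = (\<Sum>i < n1. length (entries (D i)))"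
  proof (rule sum.reindex_bij_betw)
    show "bij_betw ((!) \<sigma>) {..<n1} {..<n1}"
      by (rule bij_betw_nth) (use distinct_order length_order set_order in auto)
  qed
  also have "\<dots> = total_length n1 L" using offset_total by (simp add: offset_def)
  finally have sum: "(\<Sum>k < n1. length (entries (D (\<sigma> ! k)))) = total_length n1 L" .
  have "(\<Sum>k < n1. B k + 1) = n1 * ((66 * G + 68) * n1 + 7) + 36 * total_length n1 L"
    unfolding B_def sum[symmetric] by (simp add: sum.distrib sum_distrib_left algebra_simps)
  then have time: "1 + (T1 + T2) \<le> n1 * ((66 * G + 68) * n1 + 7) + 36 * total_length n1 L + (6 * G + 9) * n1 + 4"
    using T1(2) T2(2) by linarith
  have own: "stored_ownership (f k) = ownership_after k" if "k \<le> n1" for k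
    using f(1)[OF that] unfolding state_ok_def stored_ownership_def by auto
  have "implements_sdmt2 Skip more_agents process_agent assign_partners bfs_rule n1 n2 \<sigma> pr L D (1 + (T1 + T2))"
    unfolding implements_sdmt2_def
  proof (intro conjI exI)
    show "exec (Seq Skip (Seq (While more_agents process_agent) assign_partners)) input (1 + (T1 + T2)) out"
      by (rule T)
    show "stored_matching n1 out = sdmt2 n1 n2 \<sigma> pr bfs_rule L" by (rule T2)
    show "exec Skip input 1 (f 0)" unfolding f(2) by (rule exec.Skip)
    show "\<forall>k < n1. bval more_agents (f k) \<and> (\<exists>t. exec process_agent (f k) t (f (k + 1)))"
      using guard f(3) by (metis Suc_eq_plus1 less_imp_le)
    show "\<not> bval more_agents (f n1)" using guard[of n1] by simp
    show "\<forall>k \<le> n1. stored_ownership (f k) = ownership_after k" using own by blast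
  qed
  then show ?thesis using time by blast
qed

end

text \<open>With \<open>n \<le> n^2\<close>, \<open>n^2 \<le> N\<close> and
  \<open>n * g \<le> N\<close> every term without \<open>m\<close> is at most a multiple of
  \<open>N\<close>; the coefficients 66, 68, 7, 6, 9 and 4 add up to 160.\<close>

lemma running_time_bound:
  fixes n g m :: nat
  assumes "1 \<le> n" "1 \<le> g"
  shows "n * ((66 * g + 68) * n + 7) + 36 * m + (6 * g + 9) * n + 4 \<le> 160 * (n ^ 2 * g + m)"
proof -
  define N where "N = n ^ 2 * g"
  have n2: "n \<le> n ^ 2" using assms(1) by (simp add: power2_eq_square)
  have g2: "n ^ 2 \<le> N" using assms(2) by (simp add: N_def)
  have ng: "n * g \<le> N" unfolding N_def by (rule mult_le_mono1[OF n2])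
  have "n * ((66 * g + 68) * n + 7) + 36 * m + (6 * g + 9) * n + 4 =
      66 * N + 68 * n ^ 2 + 7 * n + 36 * m + 6 * (n * g) + 9 * n + 4"
    by (simp add: N_def power2_eq_square algebra_simps)
  also have "\<dots> \<le> 160 * (N + m)"
  proof -
    have "66 * N + 68 * a + 7 * n + 36 * m + 6 * b + 9 * n + 4 \<le> 160 * (N + m)"
      if "n \<le> a" "a \<le> N" "b \<le> N" for a b
      using that assms(1) by simp
    then show ?thesis using n2 g2 ng by blast
  qed
  finally show ?thesis by (simp add: N_def)
qed

text \<open>A nonempty input provides an agent and a nonempty class; without them the additive and
  linear terms of the running time could not be absorbed.\<close>

lemma total_length_pos:
  assumes "valid_profile n1 n2 L" "0 < total_length n1 L"
  shows "1 \<le> n1" "1 \<le> max_class_size n1 L"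
proof -
  obtain i where i: "i < n1" "0 < card (acceptable (L i))"
    using assms(2) unfolding total_length_def by (metis gr0I lessThan_iff sum.neutral)
  show "1 \<le> n1" using i by simp
  obtain a where "a \<in> acceptable (L i)" using i(2) by (metis card.empty ex_in_conv less_irrefl)
  then obtain C where C: "C \<in> set (L i)" "a \<in> C" by (auto simp: acceptable_def)
  have "C \<subseteq> {..<n2}" using assms(1) i C by (auto simp: valid_profile_def valid_pref_def)
  then have "finite C" using finite_subset by blast
  then have "1 \<le> card C" using C by (metis One_nat_def Suc_leI card_gt_0_iff empty_iff)
  also have "card C \<le> max_class_size n1 L"
    unfolding max_class_size_def using i C by (intro Max_ge) auto
  finally show "1 \<le> max_class_size n1 L" .
qed

theorem theorem4p4:
  shows
    "(\<forall>n1 n2 \<sigma> pr sel.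
        agent_order n1 \<sigma> \<and> common_order n2 pr \<and> path_rule sel \<longrightarrow>
          truthful n1 n2 (sdmt2 n1 n2 \<sigma> pr sel) \<and>
          (\<forall>L. valid_profile n1 n2 L \<longrightarrow> pareto_optimal n1 n2 L (sdmt2 n1 n2 \<sigma> pr sel L))) \<and>
     (\<exists>sel init b body final (c :: nat).
        path_rule sel \<and>
        (\<forall>n1 n2 \<sigma> pr L D.
           agent_order n1 \<sigma> \<and> common_order n2 pr \<and> valid_profile n1 n2 L \<and> listing n1 D L \<longrightarrow>
             (\<exists>T. implements_sdmt2 init b body final sel n1 n2 \<sigma> pr L D T \<and>
                  (total_length n1 L > 0 \<longrightarrow>
                     T \<le> c * (n1 ^ 2 * max_class_size n1 L + total_length n1 L)))))"
proof (intro conjI allI impI; (elim conjE)?)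
  fix n1 n2 \<sigma> pr sel
  assume a: "agent_order n1 \<sigma>" "common_order n2 pr" "path_rule sel"
  show "truthful n1 n2 (sdmt2 n1 n2 \<sigma> pr sel)" by (rule sdmt2_truthful[OF a(3,1)])
  show "pareto_optimal n1 n2 L (sdmt2 n1 n2 \<sigma> pr sel L)" if "valid_profile n1 n2 L" for L
    by (rule sdmt2_pareto_optimal[OF that a(3,1)])
next
  have "\<exists>T. implements_sdmt2 Skip more_agents process_agent assign_partners bfs_rule n1 n2 \<sigma> pr L D T \<and>
      (total_length n1 L > 0 \<longrightarrow> T \<le> 160 * (n1 ^ 2 * max_class_size n1 L + total_length n1 L))"
    if "agent_order n1 \<sigma> \<and> common_order n2 pr \<and> valid_profile n1 n2 L \<and> listing n1 D L"
    for n1 n2 \<sigma> pr L D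
  proof -
    interpret sdmt2_instance n1 n2 \<sigma> pr L D using that by unfold_locales auto
    show ?thesis
      using implementation running_time_bound total_length_pos[OF L] by (meson le_trans)
  qed
  then show "\<exists>sel init b body final (c :: nat).
        path_rule sel \<and>
        (\<forall>n1 n2 \<sigma> pr L D.
           agent_order n1 \<sigma> \<and> common_order n2 pr \<and> valid_profile n1 n2 L \<and> listing n1 D L \<longrightarrow>
             (\<exists>T. implements_sdmt2 init b body final sel n1 n2 \<sigma> pr L D T \<and>
                  (total_length n1 L > 0 \<longrightarrow>
                     T \<le> c * (n1 ^ 2 * max_class_size n1 L + total_length n1 L))))"
    using path_rule_bfs_rule by blast
qed

end
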